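(* If $u \in \mathcal{U}$, then the functions $$z \mapsto \|T_{u-u(z)}k_z\|_{2} \quad\text{and}\quad z \mapsto \|H_{u}k_z\|_{2}$$ (defined for $z\in D$) have nontangential limits $0$ at almost every point of $\partial D$.
   Context: $D$ is the open unit disk in $\mathbb{C}$ and $dA$ is area measure on $D$ normalized so that $D$ has measure $1$. The Bergman space $L^2_a$ is the Hilbert space of analytic functions on $D$ lying in $L^2(D,dA)$; $\|\cdot\|_2$ is the norm of $L^2(D,dA)$. For $z\in D$, $k_z(w)=(1-|z|^2)/(1-\bar z w)^2$ is the normalized Bergman reproducing kernel. $P$ is the orthogonal projection of $L^2(D,dA)$ onto $L^2_a$. For $u\in L^\infty(D,dA)$, the Toeplitz operator $T_u$ on $L^2_a$ is $T_uf=P(uf)$, and the Hankel operator $H_u\colon L^2_a\to L^2(D,dA)\ominus L^2_a$ is $H_uf=(1-P)(uf)$. $H^\infty$ is the algebra of bounded analytic functions on $D$, and $\mathcal{U}$ is the $C^*$-subalgebra of $L^\infty(D,dA)$ generated by $H^\infty$ (its elements are represented by bounded continuous functions on $D$, so that $u(z)$ makes sense for $z\in D$). In $T_{u-u(z)}$, $u(z)$ is a constant. "Almost every point of $\partial D$" is with respect to arc length measure on $\partial D$. *)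

theory Defs
  imports "HOL-Probability.Essential_Supremum" "HOL-Complex_Analysis.Complex_Analysis"
begin

section \<open>Function spaces on the unit disc\<close>

text \<open>
  Functions on the disc are total functions on \<^typ>\<open>complex\<close> whose values off the disc are
  irrelevant: \<open>dA\<close> below has the open disc as its \<^const>\<open>space\<close>. Elements of \<open>L\<^sup>2\<close> and
  \<open>L\<^sup>\<infinity>\<close> are represented by functions rather than by classes modulo equality almost everywhere.
\<close>

abbreviation disc :: "complex set"
  where "disc \<equiv> ball 0 1"

definition dA :: "complex measure"
  where "dA = uniform_measure (lebesgue_on disc) disc"

definition L2 :: "(complex \<Rightarrow> complex) set"
  where "L2 = {f \<in> borel_measurable dA. integrable dA (\<lambda>w. (cmod (f w))\<^sup>2)}"

definition L2_inner :: "(complex \<Rightarrow> complex) \<Rightarrow> (complex \<Rightarrow> complex) \<Rightarrow> complex"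
  where "L2_inner f g = (LINT w|dA. f w * cnj (g w))"

definition L2_norm :: "(complex \<Rightarrow> complex) \<Rightarrow> real"
  where "L2_norm f = sqrt (LINT w|dA. (cmod (f w))\<^sup>2)"

definition bergman_space :: "(complex \<Rightarrow> complex) set"
  where "bergman_space = {f \<in> L2. f holomorphic_on disc}"

definition bergman_kernel :: "complex \<Rightarrow> complex \<Rightarrow> complex"
  where "bergman_kernel z w = of_real (1 - (cmod z)\<^sup>2) / (1 - cnj z * w)\<^sup>2"

text \<open>
  Orthogonal projection onto the Bergman space. The value \<open>0\<close> off the disc only serves to single
  out one function.
\<close>

definition bergman_proj :: "(complex \<Rightarrow> complex) \<Rightarrow> complex \<Rightarrow> complex"
  where "bergman_proj f = (THE g. g \<in> bergman_space \<and> (\<forall>w. w \<notin> disc \<longrightarrow> g w = 0) \<and>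
    (\<forall>h\<in>bergman_space. L2_inner (\<lambda>w. f w - g w) h = 0))"

definition toeplitz :: "(complex \<Rightarrow> complex) \<Rightarrow> (complex \<Rightarrow> complex) \<Rightarrow> complex \<Rightarrow> complex"
  where "toeplitz u f = bergman_proj (\<lambda>w. u w * f w)"

definition hankel :: "(complex \<Rightarrow> complex) \<Rightarrow> (complex \<Rightarrow> complex) \<Rightarrow> complex \<Rightarrow> complex"
  where "hankel u f = (\<lambda>w. u w * f w - bergman_proj (\<lambda>w. u w * f w) w)"


section \<open>The algebra generated by bounded analytic functions\<close>

definition Linf_norm :: "(complex \<Rightarrow> complex) \<Rightarrow> ereal"
  where "Linf_norm f = esssup dA (\<lambda>w. ereal (cmod (f w)))"

definition Linf :: "(complex \<Rightarrow> complex) set"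
  where "Linf = {f \<in> borel_measurable dA. Linf_norm f < \<infinity>}"

definition Hinf :: "(complex \<Rightarrow> complex) set"
  where "Hinf = {f. f holomorphic_on disc \<and> bounded (f ` disc)}"

text \<open>
  The last clause is norm closedness. It also makes \<open>A\<close> closed under equality almost everywhere,
  so that \<open>A\<close> is a set of classes.
\<close>

definition cstar_subalgebra :: "(complex \<Rightarrow> complex) set \<Rightarrow> bool"
  where "cstar_subalgebra A \<longleftrightarrow>
    A \<subseteq> Linf \<and>
    (\<lambda>w. 0) \<in> A \<and>
    (\<forall>f\<in>A. \<forall>g\<in>A. (\<lambda>w. f w + g w) \<in> A) \<and>
    (\<forall>f\<in>A. \<forall>g\<in>A. (\<lambda>w. f w * g w) \<in> A) \<and>
    (\<forall>c. \<forall>f\<in>A. (\<lambda>w. c * f w) \<in> A) \<and>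
    (\<forall>f\<in>A. (\<lambda>w. cnj (f w)) \<in> A) \<and>
    (\<forall>f\<in>Linf. (\<forall>\<epsilon>>0. \<exists>g\<in>A. Linf_norm (\<lambda>w. f w - g w) < ereal \<epsilon>) \<longrightarrow> f \<in> A)"

definition calU :: "(complex \<Rightarrow> complex) set"
  where "calU = cstar_subalgebra hull Hinf"

text \<open>
  The continuous representative of a class in \<open>calU\<close>: the point value \<open>u(z)\<close> is
  \<open>cont_rep u z\<close>. Existence is shown in \<open>calU_cont_rep\<close> below; the value \<open>0\<close> off the
  disc only serves to single out one function.
\<close>

definition cont_rep :: "(complex \<Rightarrow> complex) \<Rightarrow> complex \<Rightarrow> complex"
  where "cont_rep u = (THE v. continuous_on disc v \<and> (\<forall>w. w \<notin> disc \<longrightarrow> v w = 0) \<and>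
    (AE w in dA. u w = v w))"


section \<open>Boundary behaviour\<close>

definition nontangential_region :: "real \<Rightarrow> complex \<Rightarrow> complex set"
  where "nontangential_region \<alpha> \<zeta> = {z \<in> disc. cmod (z - \<zeta>) < \<alpha> * (1 - cmod z)}"

definition has_nontangential_limit :: "(complex \<Rightarrow> 'a::topological_space) \<Rightarrow> 'a \<Rightarrow> complex \<Rightarrow> bool"
  where "has_nontangential_limit f l \<zeta> \<longleftrightarrow>
    (\<forall>\<alpha>>1. (f \<longlongrightarrow> l) (at \<zeta> within nontangential_region \<alpha> \<zeta>))"

text \<open>Arc length on the unit circle, as the image of Lebesgue measure under \<^const>\<open>cis\<close>.\<close>

definition arc_length :: "complex measure"
  where "arc_length =
    distr (lebesgue_on {0..<2 * pi}) (restrict_space borel (sphere 0 1)) cis"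

lemma measurable_cis_arc:
  "cis \<in> lebesgue_on {0..<2 * pi} \<rightarrow>\<^sub>M restrict_space borel (sphere 0 1)"
proof (rule measurable_restrict_space2)
  show "cis \<in> lebesgue_on {0..<2 * pi} \<rightarrow>\<^sub>M borel"
    by (rule continuous_imp_measurable_on_sets_lebesgue) (auto intro!: continuous_intros)
qed auto


section \<open>Existence and uniqueness of the continuous representative\<close>

lemma space_dA [simp]: "space dA = disc"
  by (simp add: dA_def space_restrict_space)

lemma sets_dA [measurable_cong]: "sets dA = sets (lebesgue_on disc)"
  by (simp add: dA_def)

lemma AE_dA_iff: "(AE w in dA. P w) \<longleftrightarrow> (AE w in lebesgue. w \<in> disc \<longrightarrow> P w)"
proof -
  have D: "disc \<in> sets lebesgue" by simp
  have e: "emeasure (lebesgue_on disc) disc = emeasure lebesgue disc"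
    by (rule emeasure_restrict_space) (use D in auto)
  have "emeasure lebesgue disc = ennreal pi"
    by (simp add: emeasure_ball unit_ball_vol_2)
  then have "(AE w in dA. P w) \<longleftrightarrow> (AE w in lebesgue_on disc. w \<in> disc \<longrightarrow> P w)"
    unfolding dA_def by (intro AE_uniform_measure) (simp_all add: e)
  also have "\<dots> \<longleftrightarrow> (AE w in lebesgue. w \<in> disc \<longrightarrow> P w)"
    using D by (subst AE_restrict_space_iff) auto
  finally show ?thesis .
qed

lemma continuous_measurable_dA:
  assumes "continuous_on disc v"
  shows "v \<in> borel_measurable dA"
  using continuous_imp_measurable_on_sets_lebesgue[OF assms] measurable_cong_sets[OF sets_dA refl]
  by auto

lemma continuous_AE_le:
  fixes v :: "complex \<Rightarrow> complex"
  assumes v: "continuous_on disc v" and ae: "AE w in dA. cmod (v w) \<le> c" and z: "z \<in> disc"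
  shows "cmod (v z) \<le> c"
proof (rule ccontr)
  let ?S = "{w \<in> disc. c < cmod (v w)}"
  assume "\<not> ?thesis"
  then have ne: "?S \<noteq> {}" using z by auto
  have "continuous_on disc (\<lambda>w. cmod (v w))" using v by (intro continuous_intros)
  then have "open (disc \<inter> (\<lambda>w. cmod (v w)) -` {c<..})"
    by (intro continuous_open_preimage) auto
  moreover have "disc \<inter> (\<lambda>w. cmod (v w)) -` {c<..} = ?S" by auto
  ultimately have op: "open ?S" by simp
  have "AE w in lebesgue. w \<notin> ?S"
    using ae unfolding AE_dA_iff by eventually_elim auto
  then have "?S \<in> null_sets lebesgue"
    using op by (subst AE_iff_null_sets) (auto intro: lmeasurable_open)
  then have "negligible ?S" by (simp add: negligible_iff_null_sets)
  then show False using open_not_negligible[OF op ne] by simp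
qed

lemma bounded_imp_Linf:
  assumes f: "f \<in> borel_measurable dA" and "AE w in dA. cmod (f w) \<le> c"
  shows "f \<in> Linf"
proof -
  have "esssup dA (\<lambda>w. ereal (cmod (f w))) \<le> ereal c"
    using assms by (intro esssup_I) auto
  then show ?thesis using f by (auto simp: Linf_def Linf_norm_def)
qed

lemma Linf_norm_less_AE:
  assumes "Linf_norm f < ereal e"
  shows "AE w in dA. cmod (f w) \<le> e"
proof -
  have "AE w in dA. ereal (cmod (f w)) \<le> Linf_norm f"
    unfolding Linf_norm_def by (rule esssup_AE)
  then show ?thesis
    by eventually_elim (use assms in \<open>metis ereal_less_eq(3) le_less_trans less_imp_le\<close>)
qed

lemma bounded_discE:
  fixes v :: "complex \<Rightarrow> complex"
  assumes "bounded (v ` disc)"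
  obtains c where "\<And>w. w \<in> disc \<Longrightarrow> cmod (v w) \<le> c"
  using assms unfolding bounded_iff by blast

lemma calU_cont_rep_ex:
  assumes "u \<in> calU"
  shows "\<exists>v. continuous_on disc v \<and> bounded (v ` disc) \<and> (AE w in dA. u w = v w)"
proof -
  define R where "R f v \<longleftrightarrow> continuous_on disc v \<and> bounded (v ` disc) \<and> (AE w in dA. f w = v w)"
    for f v :: "complex \<Rightarrow> complex"
  define B where "B = {f \<in> borel_measurable dA. \<exists>v. R f v}"
  have BI: "f \<in> B" if "f \<in> borel_measurable dA" "R f v" for f v
    using that by (auto simp: B_def)
  have B_Linf: "B \<subseteq> Linf"
  proof
    fix f assume "f \<in> B"
    then obtain v where f: "f \<in> borel_measurable dA" and v: "R f v" by (auto simp: B_def)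
    then obtain c where c: "\<And>w. w \<in> disc \<Longrightarrow> cmod (v w) \<le> c"
      using bounded_discE unfolding R_def by metis
    have "AE w in dA. w \<in> disc" using AE_space[of dA] by simp
    moreover have "AE w in dA. f w = v w" using v by (simp add: R_def)
    ultimately have "AE w in dA. cmod (f w) \<le> c"
      by eventually_elim (use c in auto)
    then show "f \<in> Linf" by (rule bounded_imp_Linf[OF f])
  qed
  have closed: "f \<in> B"
    if f: "f \<in> Linf" and lim: "\<forall>\<epsilon>>0. \<exists>g\<in>B. Linf_norm (\<lambda>w. f w - g w) < ereal \<epsilon>" for f
  proof -
    have "\<exists>v. continuous_on disc v \<and> bounded (v ` disc) \<and>
        (AE w in dA. cmod (f w - v w) \<le> inverse (real (Suc n)))" for n
    proof -
      obtain g where g: "g \<in> B" "Linf_norm (\<lambda>w. f w - g w) < ereal (inverse (real (Suc n)))"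
        using lim by (metis inverse_positive_iff_positive of_nat_0_less_iff zero_less_Suc)
      obtain v where v: "R g v" using g(1) by (auto simp: B_def)
      have "AE w in dA. cmod (f w - g w) \<le> inverse (real (Suc n))"
        by (rule Linf_norm_less_AE[OF g(2)])
      moreover have "AE w in dA. g w = v w" using v by (simp add: R_def)
      ultimately have "AE w in dA. cmod (f w - v w) \<le> inverse (real (Suc n))"
        by eventually_elim auto
      then show ?thesis using v by (auto simp: R_def)
    qed
    then have "\<forall>n. \<exists>v. continuous_on disc v \<and> bounded (v ` disc) \<and>
        (AE w in dA. cmod (f w - v w) \<le> inverse (real (Suc n)))" by blast
    from choice[OF this] obtain v where cont: "\<And>n. continuous_on disc (v n)"
      and bdd: "\<And>n. bounded (v n ` disc)"
      and ae: "\<And>n. AE w in dA. cmod (f w - v n w) \<le> inverse (real (Suc n))"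
      by blast
    have diff: "cmod (v m w - v n w) \<le> inverse (real (Suc m)) + inverse (real (Suc n))"
      if "w \<in> disc" for m n w
    proof (rule continuous_AE_le[OF _ _ that])
      show "continuous_on disc (\<lambda>w. v m w - v n w)"
        by (intro continuous_intros cont)
      show "AE w in dA. cmod (v m w - v n w) \<le> inverse (real (Suc m)) + inverse (real (Suc n))"
        using ae[of m] ae[of n]
      proof eventually_elim
        case (elim w)
        have "cmod (v m w - v n w) \<le> cmod (f w - v n w) + cmod (f w - v m w)"
          using norm_triangle_ineq4[of "f w - v n w" "f w - v m w"] by simp
        then show ?case using elim by simp
      qed
    qed
    have "uniformly_Cauchy_on disc v"
    proof (rule uniformly_Cauchy_onI)
      fix e :: real assume "e > 0"
      then obtain M where M: "inverse (real (Suc M)) < e / 2"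
        using reals_Archimedean[of "e / 2"] by auto
      have "dist (v m w) (v n w) < e" if "w \<in> disc" "m \<ge> M" "n \<ge> M" for w m n
      proof -
        have "inverse (real (Suc m)) \<le> inverse (real (Suc M))"
          "inverse (real (Suc n)) \<le> inverse (real (Suc M))"
          using that by (auto intro!: le_imp_inverse_le)
        then show ?thesis using diff[OF that(1), of m n] M unfolding dist_norm by linarith
      qed
      then show "\<exists>M. \<forall>x\<in>disc. \<forall>m\<ge>M. \<forall>n\<ge>M. dist (v m x) (v n x) < e" by blast
    qed
    then obtain l where l: "uniform_limit disc v l sequentially"
      using uniformly_convergent_eq_Cauchy[of disc v] by (auto simp: uniformly_convergent_on_def)
    have "continuous_on disc l"
      by (rule uniform_limit_theorem[OF always_eventually l]) (use cont in auto)
    moreover have "bounded (l ` disc)"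
    proof -
      have "\<forall>\<^sub>F n in sequentially. \<forall>x\<in>disc. dist (v n x) (l x) < 1"
        using l by (simp add: uniform_limit_iff)
      then obtain n where n: "\<forall>x\<in>disc. dist (v n x) (l x) < 1"
        using eventually_happens'[OF sequentially_bot] by blast
      obtain c where c: "\<And>x. x \<in> disc \<Longrightarrow> cmod (v n x) \<le> c"
        using bounded_discE[OF bdd[of n]] by blast
      have "cmod (l x) \<le> c + 1" if "x \<in> disc" for x
      proof -
        have "cmod (l x) \<le> cmod (v n x) + cmod (l x - v n x)"
          using norm_triangle_ineq[of "v n x" "l x - v n x"] by simp
        then show ?thesis using c[OF that] n that by (force simp: dist_norm norm_minus_commute)
      qed
      then show ?thesis unfolding bounded_iff by blast
    qed
    moreover have "AE w in dA. f w = l w"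
    proof -
      have "AE w in dA. \<forall>n. cmod (f w - v n w) \<le> inverse (real (Suc n))"
        using ae by (simp add: AE_all_countable)
      moreover have "AE w in dA. w \<in> disc" using AE_space[of dA] by simp
      ultimately show ?thesis
      proof eventually_elim
        case (elim w)
        have "(\<lambda>n. v n w) \<longlonglongrightarrow> l w"
          by (rule tendsto_uniform_limitI[OF l]) (use elim in auto)
        moreover have "(\<lambda>n. v n w) \<longlonglongrightarrow> f w"
        proof (rule Lim_transform_bound[where f = "\<lambda>n. v n w - f w", THEN Lim_null[THEN iffD2]])
          show "\<forall>\<^sub>F n in sequentially. norm (v n w - f w) \<le> norm (inverse (real (Suc n)))"
            using elim(1) by (auto simp: norm_minus_commute)
          show "(\<lambda>n. inverse (real (Suc n))) \<longlonglongrightarrow> 0" by (rule LIMSEQ_inverse_real_of_nat)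
        qed
        ultimately show ?case using LIMSEQ_unique by blast
      qed
    qed
    ultimately show ?thesis
      using f by (intro BI[of _ l]) (auto simp: Linf_def R_def)
  qed
  have add: "(\<lambda>w. f w + g w) \<in> B" and mult: "(\<lambda>w. f w * g w) \<in> B"
    if fg: "f \<in> B" "g \<in> B" for f g
  proof -
    obtain v v' where v: "R f v" "R g v'" using fg by (auto simp: B_def)
    obtain c c' where c: "\<And>w. w \<in> disc \<Longrightarrow> cmod (v w) \<le> c"
        "\<And>w. w \<in> disc \<Longrightarrow> cmod (v' w) \<le> c'"
      using v bounded_discE unfolding R_def by metis
    have ae: "AE w in dA. f w = v w" "AE w in dA. g w = v' w" using v by (auto simp: R_def)
    have meas: "f \<in> borel_measurable dA" "g \<in> borel_measurable dA"
      using fg by (auto simp: B_def)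
    have "AE w in dA. f w + g w = v w + v' w" "AE w in dA. f w * g w = v w * v' w"
      using ae by (auto elim: eventually_elim2)
    moreover have "continuous_on disc (\<lambda>w. v w + v' w)" "continuous_on disc (\<lambda>w. v w * v' w)"
      using v by (auto simp: R_def intro!: continuous_intros)
    moreover have "bounded ((\<lambda>w. v w + v' w) ` disc)"
      unfolding bounded_iff by (force intro: norm_triangle_le add_mono c)
    moreover have "bounded ((\<lambda>w. v w * v' w) ` disc)"
      unfolding bounded_iff
    proof (intro exI ballI)
      fix x assume "x \<in> (\<lambda>w. v w * v' w) ` disc"
      then obtain w where "w \<in> disc" "x = v w * v' w" by auto
      then show "norm x \<le> c * c'"
        using mult_mono[OF c[of w]] order_trans[OF norm_ge_zero c(1)[of w]] by (simp add: norm_mult)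
    qed
    ultimately have "R (\<lambda>w. f w + g w) (\<lambda>w. v w + v' w)" "R (\<lambda>w. f w * g w) (\<lambda>w. v w * v' w)"
      by (auto simp: R_def)
    then show "(\<lambda>w. f w + g w) \<in> B" "(\<lambda>w. f w * g w) \<in> B"
      using meas by (auto intro!: BI)
  qed
  have const: "(\<lambda>w. c) \<in> B" for c
    by (rule BI[of _ "\<lambda>w. c"]) (auto simp: R_def image_constant_conv)
  have conj: "(\<lambda>w. cnj (f w)) \<in> B" if fB: "f \<in> B" for f
  proof -
    obtain v where v: "R f v" and f: "f \<in> borel_measurable dA" using fB by (auto simp: B_def)
    have "continuous_on disc (\<lambda>w. cnj (v w))"
      using v by (intro continuous_on_cnj) (simp add: R_def)
    moreover have "bounded ((\<lambda>w. cnj (v w)) ` disc)"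
      using v unfolding R_def bounded_iff by fastforce
    moreover have "AE w in dA. cnj (f w) = cnj (v w)"
      using v by (auto simp: R_def)
    moreover have "(\<lambda>w. cnj (f w)) \<in> borel_measurable dA"
      by (rule borel_measurable_continuous_on[OF _ f]) (intro continuous_on_cnj continuous_on_id)
    ultimately show ?thesis by (intro BI[of _ "\<lambda>w. cnj (v w)"]) (simp_all add: R_def)
  qed
  have "cstar_subalgebra B"
    unfolding cstar_subalgebra_def
  proof (intro conjI ballI allI impI)
    show "B \<subseteq> Linf" by (rule B_Linf)
    show "(\<lambda>w. 0) \<in> B" by (rule const)
    show "(\<lambda>w. f w + g w) \<in> B" if "f \<in> B" "g \<in> B" for f g by (rule add[OF that])
    show "(\<lambda>w. f w * g w) \<in> B" if "f \<in> B" "g \<in> B" for f g by (rule mult[OF that])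
    show "(\<lambda>w. c * f w) \<in> B" if "f \<in> B" for c f by (rule mult[OF const that])
    show "(\<lambda>w. cnj (f w)) \<in> B" if "f \<in> B" for f by (rule conj[OF that])
    show "f \<in> B" if "f \<in> Linf" "\<forall>\<epsilon>>0. \<exists>g\<in>B. Linf_norm (\<lambda>w. f w - g w) < ereal \<epsilon>" for f
      by (rule closed[OF that])
  qed
  moreover have "Hinf \<subseteq> B"
  proof
    fix f assume f: "f \<in> Hinf"
    then have "continuous_on disc f"
      by (auto simp: Hinf_def intro: holomorphic_on_imp_continuous_on)
    then show "f \<in> B"
      using f by (intro BI[of _ f] continuous_measurable_dA) (auto simp: Hinf_def R_def)
  qed
  ultimately have "calU \<subseteq> B" unfolding calU_def by (intro hull_minimal)
  then show ?thesis using assms by (auto simp: B_def R_def)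
qed

lemma cont_rep_unique:
  fixes v v' :: "complex \<Rightarrow> complex"
  assumes "continuous_on disc v" "continuous_on disc v'"
    and "AE w in dA. u w = v w" "AE w in dA. u w = v' w" and "z \<in> disc"
  shows "v z = v' z"
proof -
  have "AE w in dA. cmod (v w - v' w) \<le> 0"
    using assms(3,4) by eventually_elim simp
  then have "cmod (v z - v' z) \<le> 0"
    by (intro continuous_AE_le[OF _ _ assms(5), of "\<lambda>w. v w - v' w"] continuous_intros assms)
  then show ?thesis by simp
qed

lemma calU_cont_rep:
  assumes "u \<in> calU"
  shows "continuous_on disc (cont_rep u)" and "bounded (cont_rep u ` disc)"
    and "AE w in dA. u w = cont_rep u w"
proof -
  obtain v where v: "continuous_on disc v" "bounded (v ` disc)" "AE w in dA. u w = v w"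
    using calU_cont_rep_ex[OF assms] by blast
  define v0 where "v0 = (\<lambda>w. if w \<in> disc then v w else 0)"
  have v0: "continuous_on disc v0" "bounded (v0 ` disc)"
    using v continuous_on_cong[of disc disc v0 v] image_cong[of disc disc v0 v]
    by (simp_all add: v0_def)
  have "AE w in dA. w \<in> disc" using AE_space[of dA] by simp
  then have ae: "AE w in dA. u w = v0 w"
    using v(3) by eventually_elim (simp add: v0_def)
  have "cont_rep u = v0"
    unfolding cont_rep_def
  proof (rule the_equality)
    show "continuous_on disc v0 \<and> (\<forall>w. w \<notin> disc \<longrightarrow> v0 w = 0) \<and> (AE w in dA. u w = v0 w)"
      using v0 ae by (simp add: v0_def)
  next
    fix v' assume v': "continuous_on disc v' \<and> (\<forall>w. w \<notin> disc \<longrightarrow> v' w = 0) \<and> (AE w in dA. u w = v' w)"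
    show "v' = v0"
    proof
      fix z show "v' z = v0 z"
        using cont_rep_unique[of v' v0 u z] v' v0(1) ae by (cases "z \<in> disc") (auto simp: v0_def)
    qed
  qed
  then show "continuous_on disc (cont_rep u)" "bounded (cont_rep u ` disc)"
    "AE w in dA. u w = cont_rep u w"
    using v0 ae by simp_all
qed

end

theory Submission
  imports Defs
begin

text \<open>
  Since \<open>k\<^sub>z\<close> is analytic and \<open>P\<close> is an orthogonal projection, both
  norms are at most \<open>\<parallel>(u - u(z)) k\<^sub>z\<parallel>\<^sub>2\<close>. The functions \<open>u\<close> for which this
  quantity has nontangential limit \<open>0\<close> almost everywhere form a \<open>C\<^sup>*\<close>-algebra, so it suffices
  to treat \<open>u = f \<in> H\<^sup>\<infinity>\<close>.

  For such \<open>f\<close> the integral of \<open>|f'|\<^sup>2 (1 - |w|\<^sup>2)\<close> over the disc is finite (Littlewood--Paley). By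
  Fubini the integral of \<open>|f'|\<^sup>2\<close> over the cone with vertex \<open>\<zeta>\<close> is finite for almost every \<open>\<zeta>\<close>,
  and subharmonicity of \<open>|f'|\<^sup>2\<close> turns this into \<open>(1 - |z|) |f'(z)| \<rightarrow> 0\<close> nontangentially. Hence \<open>f\<close>
  is nearly constant on pseudohyperbolic discs about \<open>z\<close>, which carry almost all of the mass of
  \<open>|k\<^sub>z|\<^sup>2\<close>.
\<close>


section \<open>Rotation invariance and Parseval on circles\<close>

text \<open>Constants must be fixed in the right order. The disc \<open>pdisc R z\<close> carries
  the mass \<open>R\<^sup>2\<close> of |k_z|^2 whatever \<open>z\<close> is, so \<open>R\<close> is
  chosen first; for this \<open>R\<close> the discs about points of one cone stay in a single wider
  cone, and the decay of f' is applied there. Countability keeps the exceptional sets null in two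
  places: integer apertures control all cones, and a uniform limit in the algebra is approached by a
  sequence. The quantity carried through the algebra is the square \<open>osc\<close> of the norm:
  sums, products and uniform limits then reduce to pointwise inequalities integrated against
  |k_z|^2, which has total mass 1. The two operators reach u - u(z) differently. The Toeplitz
  operator contains it; for the Hankel operator, (1 - P)(u k_z) realises the distance from u k_z to
  the Bergman space, and u(z) k_z is a competitor in that space. The nearest point is constructed
  directly, from a minimizing sequence and bounded point evaluations; the explicit area integrals
  come from power series coefficients.\<close>

lemma sigma_finite_lborel_rotate:
  fixes c :: complex
  assumes c: "cmod c = 1"
  shows "sigma_finite_measure (distr lborel borel ((*) c))"
proof
  let ?A = "range (\<lambda>n::nat. ball (0::complex) (real n))"
  have "emeasure (distr lborel borel ((*) c)) (ball 0 (real n)) \<noteq> \<infinity>" for n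
  proof -
    have "(*) c -` ball 0 (real n) = ball (0::complex) (real n)" using c by (auto simp: norm_mult)
    then have "emeasure (distr lborel borel ((*) c)) (ball 0 (real n)) = emeasure lborel (ball (0::complex) (real n))"
      by (subst emeasure_distr) auto
    then show ?thesis using emeasure_lborel_ball_finite[of "0::complex" "real n"] by (simp add: less_top)
  qed
  moreover have "\<Union>?A = UNIV" using reals_Archimedean2 by auto
  ultimately show "\<exists>A. countable A \<and> A \<subseteq> sets (distr lborel borel ((*) c)) \<and> \<Union> A = space (distr lborel borel ((*) c)) \<and>
     (\<forall>a\<in>A. emeasure (distr lborel borel ((*) c)) a \<noteq> \<infinity>)"
    by (intro exI[of _ ?A]) auto
qed

text \<open>
  Uniqueness of Haar measure: the convolution of \<open>1\<^sub>A\<close> and \<open>1\<^sub>B\<close>, with \<open>B\<close> the unit ball, is integrated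
  in both orders against Lebesgue measure and its rotation, which agree on \<open>B\<close>.
\<close>

lemma lborel_rotate:
  fixes c :: complex
  assumes c: "cmod c = 1"
  shows "distr lborel borel ((*) c) = lborel"
proof -
  define \<mu> where "\<mu> = distr lborel borel ((*) c)"
  have [measurable]: "(*) c \<in> borel_measurable borel" by simp
  have [measurable_cong]: "sets \<mu> = sets borel" by (simp add: \<mu>_def)
  have c0: "c \<noteq> 0" using c by auto
  have int: "(\<integral>\<^sup>+x. f x \<partial>\<mu>) = (\<integral>\<^sup>+x. f (c * x) \<partial>lborel)" if "f \<in> borel_measurable borel" for f
    unfolding \<mu>_def using that by (subst nn_integral_distr) auto
  have shift: "(\<integral>\<^sup>+x. f (y + x) \<partial>lborel) = (\<integral>\<^sup>+x. f x \<partial>lborel)"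
    if [measurable]: "f \<in> borel_measurable borel" for f and y :: complex
  proof -
    have "(\<integral>\<^sup>+x. f x \<partial>lborel) = (\<integral>\<^sup>+x. f x \<partial>distr lborel borel ((+) y))"
      by (simp add: lborel_distr_plus)
    also have "\<dots> = (\<integral>\<^sup>+x. f (y + x) \<partial>lborel)" by (rule nn_integral_distr) auto
    finally show ?thesis by simp
  qed
  \<comment> \<open>Multiplication by \<open>c\<close> is additive, so translating by
    \<open>y\<close> after the rotation is translating by \<open>y / c\<close> before it, where
    invariance of \<open>lborel\<close> applies.\<close>
  have shift\<mu>: "(\<integral>\<^sup>+x. f (y + x) \<partial>\<mu>) = (\<integral>\<^sup>+x. f x \<partial>\<mu>)"
    if [measurable]: "f \<in> borel_measurable borel" for f y
  proof -
    have "(\<integral>\<^sup>+x. f (y + x) \<partial>\<mu>) = (\<integral>\<^sup>+x. f (c * (y / c + x)) \<partial>lborel)"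
      using c0 by (subst int) (auto simp: distrib_left)
    also have "\<dots> = (\<integral>\<^sup>+x. f x \<partial>\<mu>)"
      by (subst shift[where f = "\<lambda>x. f (c * x)"]) (auto simp: int)
    finally show ?thesis .
  qed
  have ball: "emeasure \<mu> (ball 0 1) = emeasure lborel (ball 0 1 :: complex set)"
    unfolding \<mu>_def using c
    by (subst emeasure_distr) (auto intro!: arg_cong[where f = "emeasure lborel"] simp: norm_mult)
  have "sigma_finite_measure \<mu>"
    unfolding \<mu>_def by (rule sigma_finite_lborel_rotate[OF c])
  then interpret p: pair_sigma_finite \<mu> "lborel :: complex measure"
    by (simp add: pair_sigma_finite_def lborel.sigma_finite_measure_axioms)
  have "emeasure \<mu> A = emeasure lborel A" if [measurable]: "A \<in> sets borel" for A
  proof -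
    let ?B = "ball 0 1 :: complex set"
    have [measurable]: "?B \<in> sets borel" by simp
    have "emeasure \<mu> A * emeasure lborel ?B = (\<integral>\<^sup>+x. indicator A x * emeasure lborel ?B \<partial>\<mu>)"
      by (simp add: nn_integral_multc)
    also have "\<dots> = (\<integral>\<^sup>+x. \<integral>\<^sup>+y. indicator A x * indicator ?B (- x + y) \<partial>lborel \<partial>\<mu>)"
    proof (rule nn_integral_cong)
      fix x
      have "(\<integral>\<^sup>+y. indicator A x * indicator ?B (- x + y) \<partial>lborel) =
          (\<integral>\<^sup>+y. indicator A x * indicator ?B y \<partial>lborel)"
        by (rule shift) measurable
      then show "indicator A x * emeasure lborel ?B =
          (\<integral>\<^sup>+y. indicator A x * indicator ?B (- x + y) \<partial>lborel)"
        by (simp add: nn_integral_cmult_indicator)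
    qed
    also have "\<dots> = (\<integral>\<^sup>+y. \<integral>\<^sup>+x. indicator A x * indicator ?B (- x + y) \<partial>\<mu> \<partial>lborel)"
      by (rule p.Fubini'[symmetric]) measurable
    \<comment> \<open>Replacing \<open>x\<close> by \<open>y + x\<close> removes \<open>y\<close>
      from the indicator of the ball, so after the second exchange the inner integral over
      \<open>y\<close> is the Lebesgue measure of \<open>A\<close>.\<close>
    also have "\<dots> = (\<integral>\<^sup>+y. \<integral>\<^sup>+x. indicator A (y + x) * indicator ?B (- x) \<partial>\<mu> \<partial>lborel)"
    proof (rule nn_integral_cong)
      fix y
      have "(\<integral>\<^sup>+x. indicator A (y + x) * indicator ?B (- (y + x) + y) \<partial>\<mu>) =
          (\<integral>\<^sup>+x. indicator A x * indicator ?B (- x + y) \<partial>\<mu>)"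
        by (rule shift\<mu>) measurable
      then show "(\<integral>\<^sup>+x. indicator A x * indicator ?B (- x + y) \<partial>\<mu>) =
          (\<integral>\<^sup>+x. indicator A (y + x) * indicator ?B (- x) \<partial>\<mu>)"
        by simp
    qed
    also have "\<dots> = (\<integral>\<^sup>+x. \<integral>\<^sup>+y. indicator A (y + x) * indicator ?B (- x) \<partial>lborel \<partial>\<mu>)"
      by (rule p.Fubini') measurable
    also have "\<dots> = (\<integral>\<^sup>+x. emeasure lborel A * indicator ?B x \<partial>\<mu>)"
    proof (rule nn_integral_cong)
      fix x
      have "(\<integral>\<^sup>+y. indicator A (y + x) * indicator ?B (- x) \<partial>lborel) =
          (\<integral>\<^sup>+y. indicator A (x + y) * indicator ?B x \<partial>lborel)"
        by (intro nn_integral_cong) (auto simp: add.commute indicator_def)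
      also have "\<dots> = emeasure lborel A * indicator ?B x"
        by (subst shift[where f = "\<lambda>y. indicator A y * indicator ?B x"]) (auto simp: nn_integral_multc)
      finally show "(\<integral>\<^sup>+y. indicator A (y + x) * indicator ?B (- x) \<partial>lborel) =
        emeasure lborel A * indicator ?B x" .
    qed
    also have "\<dots> = emeasure lborel A * emeasure lborel ?B"
      by (simp add: nn_integral_cmult ball)
    finally have "emeasure lborel ?B * emeasure \<mu> A = emeasure lborel ?B * emeasure lborel A"
      by (simp add: mult.commute)
    then show ?thesis
      by (subst (asm) ennreal_mult_cancel_left) (auto simp: emeasure_ball unit_ball_vol_2)
  qed
  then show ?thesis
    unfolding \<mu>_def by (intro measure_eqI) auto
qed

lemma nn_integral_rotate:
  fixes c :: complex
  assumes "cmod c = 1" and [measurable]: "f \<in> borel_measurable borel"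
  shows "(\<integral>\<^sup>+x. f (c * x) \<partial>lborel) = (\<integral>\<^sup>+x. f x \<partial>lborel)"
proof -
  have "(\<integral>\<^sup>+x. f x \<partial>lborel) = (\<integral>\<^sup>+x. f x \<partial>distr lborel borel ((*) c))"
    by (simp add: lborel_rotate assms)
  also have "\<dots> = (\<integral>\<^sup>+x. f (c * x) \<partial>lborel)" by (rule nn_integral_distr) auto
  finally show ?thesis by simp
qed

lemma nn_integral_affine_complex:
  fixes z :: complex
  assumes r: "r > 0" and [measurable]: "f \<in> borel_measurable borel"
  shows "(\<integral>\<^sup>+x. f x \<partial>lborel) = ennreal (r\<^sup>2) * (\<integral>\<^sup>+x. f (z + of_real r * x) \<partial>lborel)"
proof -
  have "(\<integral>\<^sup>+x. f x \<partial>lborel) =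
      (\<integral>\<^sup>+x. f x \<partial>density (distr lborel borel (\<lambda>x. z + r *\<^sub>R x)) (\<lambda>_. \<bar>r\<bar>^DIM(complex)))"
    using lborel_affine[of r z] r by simp
  also have "\<dots> = ennreal (r\<^sup>2) * (\<integral>\<^sup>+x. f (z + of_real r * x) \<partial>lborel)"
    using r by (simp add: nn_integral_density nn_integral_distr nn_integral_cmult scaleR_conv_of_real)
  finally show ?thesis .
qed

section \<open>Parseval on circles\<close>

text \<open>The parameter measure for averages over rotations, of mass 2 pi. The closed interval
  makes every continuous integrand integrable; the doubled endpoint is a null set.\<close>

abbreviation circ :: "real measure" where "circ \<equiv> restrict_space lborel {0..2 * pi}"

lemma finite_measure_circ: "finite_measure circ"
  by (rule finite_measureI) (simp add: emeasure_restrict_space space_restrict_space)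

lemma circ_integral:
  fixes f :: "real \<Rightarrow> 'a::euclidean_space"
  assumes f: "continuous_on {0..2*pi} f"
  shows "integrable circ f" "integral\<^sup>L circ f = integral {0..2*pi} f"
proof -
  have i: "set_integrable lborel {0..2*pi} f"
    by (rule borel_integrable_atLeastAtMost') (rule f)
  then show "integrable circ f"
    by (simp add: integrable_restrict_space set_integrable_def)
  show "integral\<^sup>L circ f = integral {0..2*pi} f"
    using set_borel_integral_eq_integral(2)[OF i]
    by (simp add: integral_restrict_space set_lebesgue_integral_def)
qed

lemma integral_cis:
  "integral\<^sup>L circ (\<lambda>t. cis (real m * t) * cnj (cis (real n * t))) = (if m = n then of_real (2 * pi) else 0)"
proof -
  define k where "k = real m - real n"
  have eq: "cis (real m * t) * cnj (cis (real n * t)) = cis (k * t)" for t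
    by (simp add: k_def cis_cnj cis_mult algebra_simps)
  have "integral\<^sup>L circ (\<lambda>t. cis (k * t)) = integral {0..2*pi} (\<lambda>t. cis (k * t))"
    by (rule circ_integral) (intro continuous_intros)
  also have "\<dots> = (if m = n then of_real (2 * pi) else 0)"
  proof (cases "m = n")
    case True
    then show ?thesis by (simp add: k_def scaleR_conv_of_real)
  next
    case False
    then have k: "k \<noteq> 0" by (simp add: k_def)
    have "((\<lambda>t. cis (k * t)) has_integral (cis (k * (2 * pi)) / (\<i> * k) - cis (k * 0) / (\<i> * k))) {0..2*pi}"
    proof (rule fundamental_theorem_of_calculus)
      fix t :: real
      have "((\<lambda>x. exp (\<i> * k * x) / (\<i> * k)) has_field_derivative exp (\<i> * k * of_real t)) (at (of_real t))"
        using k by (auto intro!: derivative_eq_intros)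
      from has_vector_derivative_real_field[OF this, of "{0..2*pi}"]
      show "((\<lambda>t. cis (k * t) / (\<i> * k)) has_vector_derivative cis (k * t)) (at t within {0..2*pi})"
        by (simp add: cis_conv_exp mult.assoc)
    qed simp
    moreover have "cis (k * (2 * pi)) = 1"
    proof -
      have "k * (2 * pi) = 2 * pi * of_int (int m - int n)" by (simp add: k_def)
      then show ?thesis by (simp only: cis_multiple_2pi) auto
    qed
    ultimately show ?thesis using False by (simp add: integral_unique)
  qed
  finally show ?thesis by (simp add: eq)
qed

lemma circ_parseval_finite:
  fixes c :: "nat \<Rightarrow> complex"
  shows "integral\<^sup>L circ (\<lambda>t. (cmod (\<Sum>n<N. c n * cis (real n * t)))\<^sup>2) = 2 * pi * (\<Sum>n<N. (cmod (c n))\<^sup>2)"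
proof -
  have int: "integrable circ (\<lambda>t. c m * cnj (c n) * (cis (real m * t) * cnj (cis (real n * t))))" for m n
    by (rule circ_integral) (intro continuous_intros)
  have "complex_of_real (integral\<^sup>L circ (\<lambda>t. (cmod (\<Sum>n<N. c n * cis (real n * t)))\<^sup>2)) =
      integral\<^sup>L circ (\<lambda>t. complex_of_real ((cmod (\<Sum>n<N. c n * cis (real n * t)))\<^sup>2))"
    by (simp del: of_real_power)
  also have "\<dots> = integral\<^sup>L circ (\<lambda>t. \<Sum>m<N. \<Sum>n<N. c m * cnj (c n) * (cis (real m * t) * cnj (cis (real n * t))))"
    by (rule Bochner_Integration.integral_cong)
       (simp_all add: complex_norm_square sum_product mult_ac del: of_real_power)
  also have "\<dots> = (\<Sum>m<N. \<Sum>n<N. c m * cnj (c n) * (if m = n then of_real (2 * pi) else 0))"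
    using int by (simp add: integral_cis)
  also have "\<dots> = of_real (2 * pi * (\<Sum>n<N. (cmod (c n))\<^sup>2))"
    by (simp add: if_distrib complex_norm_square sum_distrib_left mult_ac del: of_real_power cong: if_cong)
  finally show ?thesis by (simp only: of_real_eq_iff)
qed

text \<open>On the circle through \<open>v\<close> the partial sums converge uniformly, by absolute
  convergence at radius \<open>cmod v\<close>, and the absolute sum \<open>K\<close> dominates them.
  Hence the finite identity passes to the limit.\<close>

lemma circ_parseval:
  fixes c :: "nat \<Rightarrow> complex" and F :: "complex \<Rightarrow> complex"
  assumes F: "\<And>w. w \<in> disc \<Longrightarrow> (\<lambda>n. c n * w ^ n) sums F w" and v: "v \<in> disc"
  shows "continuous_on UNIV (\<lambda>t. F (cis t * v))"
    and "(\<lambda>n. (cmod (c n))\<^sup>2 * (cmod v) ^ (2 * n)) sums (integral\<^sup>L circ (\<lambda>t. (cmod (F (cis t * v)))\<^sup>2) / (2 * pi))"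
proof -
  define S where "S N t = (\<Sum>n<N. (c n * v ^ n) * cis (real n * t))" for N t
  \<comment> \<open>Absolute convergence at \<open>v\<close> follows from convergence at a point of
    larger modulus.\<close>
  obtain w where w: "w \<in> disc" "cmod v < cmod w"
  proof -
    obtain r where "cmod v < r" "r < 1" using v dense[of "cmod v" 1] by auto
    then show ?thesis using that[of "of_real r"] norm_ge_zero[of v] by auto
  qed
  have "summable (\<lambda>n. norm (c n * v ^ n))"
    by (rule powser_insidea[OF sums_summable[OF F[OF w(1)]] w(2)])
  then have sm: "summable (\<lambda>n. cmod (c n * v ^ n))" .
  have in_disc: "cis t * v \<in> disc" for t using v by (simp add: norm_mult)
  have sums: "(\<lambda>n. (c n * v ^ n) * cis (real n * t)) sums F (cis t * v)" for t
  proof -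
    have eq: "c n * (cis t * v) ^ n = (c n * v ^ n) * cis (real n * t)" for n
      by (simp add: power_mult_distrib Complex.DeMoivre)
    show ?thesis using F[OF in_disc[of t]] by (simp only: eq)
  qed
  have lim: "(\<lambda>N. S N t) \<longlonglongrightarrow> F (cis t * v)" for t
    using sums[of t] by (simp add: sums_def S_def)
  have "uniform_limit UNIV S (\<lambda>t. \<Sum>n. (c n * v ^ n) * cis (real n * t)) sequentially"
    unfolding S_def by (rule Weierstrass_m_test[OF _ sm]) (auto simp: norm_mult)
  then have ul: "uniform_limit UNIV S (\<lambda>t. F (cis t * v)) sequentially"
    using sums_unique[OF sums] by simp
  show cont: "continuous_on UNIV (\<lambda>t. F (cis t * v))"
    by (rule uniform_limit_theorem[OF always_eventually ul])
       (auto simp: S_def intro!: continuous_intros)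
  define K where "K = (\<Sum>n. cmod (c n * v ^ n))"
  have bd: "cmod (S N t) \<le> K" for N t
  proof -
    have "cmod (S N t) \<le> (\<Sum>n<N. cmod (c n * v ^ n))"
      unfolding S_def by (rule sum_norm_le) (simp add: norm_mult)
    also have "\<dots> \<le> K" unfolding K_def by (rule sum_le_suminf[OF sm]) auto
    finally show ?thesis .
  qed
  have "(\<lambda>N. integral\<^sup>L circ (\<lambda>t. (cmod (S N t))\<^sup>2)) \<longlonglongrightarrow> integral\<^sup>L circ (\<lambda>t. (cmod (F (cis t * v)))\<^sup>2)"
  proof (rule integral_dominated_convergence[where w = "\<lambda>_. K\<^sup>2"])
    show "(\<lambda>t. (cmod (F (cis t * v)))\<^sup>2) \<in> borel_measurable circ"
      by (intro borel_measurable_integrable circ_integral(1) continuous_intros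
          continuous_on_subset[OF cont]) auto
    show "(\<lambda>t. (cmod (S N t))\<^sup>2) \<in> borel_measurable circ" for N
      unfolding S_def by (intro borel_measurable_integrable circ_integral(1) continuous_intros)
    show "integrable circ (\<lambda>_. K\<^sup>2)" by (rule circ_integral) auto
    show "AE t in circ. (\<lambda>N. (cmod (S N t))\<^sup>2) \<longlonglongrightarrow> (cmod (F (cis t * v)))\<^sup>2"
      by (intro AE_I2 tendsto_intros lim)
    show "AE t in circ. norm ((cmod (S N t))\<^sup>2) \<le> K\<^sup>2" for N
      by (intro AE_I2) (simp add: bd power_mono)
  qed
  then have "(\<lambda>N. integral\<^sup>L circ (\<lambda>t. (cmod (S N t))\<^sup>2) / (2 * pi)) \<longlonglongrightarrow> integral\<^sup>L circ (\<lambda>t. (cmod (F (cis t * v)))\<^sup>2) / (2 * pi)"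
    by (intro tendsto_intros) auto
  then show "(\<lambda>n. (cmod (c n))\<^sup>2 * (cmod v) ^ (2 * n)) sums (integral\<^sup>L circ (\<lambda>t. (cmod (F (cis t * v)))\<^sup>2) / (2 * pi))"
    unfolding sums_def S_def circ_parseval_finite
    by (simp add: norm_mult norm_power power_mult_distrib power_mult[symmetric] mult.commute[of 2])
qed

lemma circ_parseval_nn:
  fixes c :: "nat \<Rightarrow> complex" and F :: "complex \<Rightarrow> complex"
  assumes F: "\<And>w. w \<in> disc \<Longrightarrow> (\<lambda>n. c n * w ^ n) sums F w" and v: "v \<in> disc"
  shows "(\<integral>\<^sup>+t. ennreal ((cmod (F (cis t * v)))\<^sup>2) \<partial>circ) =
    ennreal (2 * pi) * (\<Sum>n. ennreal ((cmod (c n))\<^sup>2 * (cmod v) ^ (2 * n)))"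
proof -
  note P = circ_parseval[OF F v]
  have "integrable circ (\<lambda>t. (cmod (F (cis t * v)))\<^sup>2)"
    by (intro circ_integral(1) continuous_intros continuous_on_subset[OF P(1)]) auto
  then have "(\<integral>\<^sup>+t. ennreal ((cmod (F (cis t * v)))\<^sup>2) \<partial>circ) = ennreal (integral\<^sup>L circ (\<lambda>t. (cmod (F (cis t * v)))\<^sup>2))"
    by (rule nn_integral_eq_integral) simp
  also have "\<dots> = ennreal (2 * pi) * ennreal (integral\<^sup>L circ (\<lambda>t. (cmod (F (cis t * v)))\<^sup>2) / (2 * pi))"
    by (subst ennreal_mult[symmetric]) auto
  also have "ennreal (integral\<^sup>L circ (\<lambda>t. (cmod (F (cis t * v)))\<^sup>2) / (2 * pi)) =
     (\<Sum>n. ennreal ((cmod (c n))\<^sup>2 * (cmod v) ^ (2 * n)))"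
    using P(2) by (subst suminf_ennreal_eq[OF _ P(2)]) auto
  finally show ?thesis .
qed


section \<open>Parseval on the disc\<close>

text \<open>\<open>F\<close> is arbitrary off \<open>S\<close>, so only the product with the
  indicator can be measurable. Multiplying by the indicator before taking the modulus reduces this
  to continuity on \<open>S\<close>.\<close>

lemma borel_measurable_norm_square_indicator:
  fixes F :: "complex \<Rightarrow> complex"
  assumes S: "open S" and F: "continuous_on S F"
  shows "(\<lambda>v. ennreal ((cmod (F v))\<^sup>2) * indicator S v) \<in> borel_measurable borel"
proof -
  have [measurable]: "(\<lambda>v. indicator S v *\<^sub>R F v) \<in> borel_measurable borel"
    by (rule borel_measurable_continuous_on_indicator) (use assms in auto)
  have "(\<lambda>v. ennreal ((cmod (F v))\<^sup>2) * indicator S v) = (\<lambda>v. ennreal ((cmod (indicator S v *\<^sub>R F v))\<^sup>2))"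
    by (auto simp: indicator_def)
  also have "\<dots> \<in> borel_measurable borel" by measurable
  finally show ?thesis .
qed

text \<open>Averaging over rotations reduces this to Parseval on each circle and replaces polar coordinates.\<close>

lemma disc_parseval:
  fixes c :: "nat \<Rightarrow> complex" and F :: "complex \<Rightarrow> complex" and h :: "real \<Rightarrow> ennreal"
  assumes F: "\<And>w. w \<in> disc \<Longrightarrow> (\<lambda>n. c n * w ^ n) sums F w" and [measurable]: "h \<in> borel_measurable borel"
  shows "(\<integral>\<^sup>+v\<in>disc. ennreal ((cmod (F v))\<^sup>2) * h (cmod v) \<partial>lborel) =
    (\<Sum>n. ennreal ((cmod (c n))\<^sup>2) * (\<integral>\<^sup>+v\<in>disc. ennreal ((cmod v) ^ (2 * n)) * h (cmod v) \<partial>lborel))"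
proof -
  have hol: "F holomorphic_on disc"
    by (rule power_series_holomorphic[where a = c]) (use F in auto)
  note [measurable] = borel_measurable_norm_square_indicator[OF open_ball holomorphic_on_imp_continuous_on[OF hol]]
  have [measurable]: "disc \<in> sets borel" by simp
  define G where "G v = (ennreal ((cmod (F v))\<^sup>2) * indicator disc v) * h (cmod v)" for v
  have G[measurable]: "G \<in> borel_measurable borel" unfolding G_def by measurable
  have [measurable]: "cis \<in> borel_measurable circ"
    by (intro measurable_restrict_space1) (auto intro!: borel_measurable_continuous_onI continuous_intros)
  interpret c: finite_measure circ by (rule finite_measure_circ)
  interpret p: pair_sigma_finite circ "lborel :: complex measure" ..
  have "ennreal (2 * pi) * (\<integral>\<^sup>+v. G v \<partial>lborel) = (\<integral>\<^sup>+t. (\<integral>\<^sup>+v. G v \<partial>lborel) \<partial>circ)"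
    by (simp add: emeasure_restrict_space space_restrict_space mult.commute)
  also have "\<dots> = (\<integral>\<^sup>+t. (\<integral>\<^sup>+v. G (cis t * v) \<partial>lborel) \<partial>circ)"
    by (simp add: nn_integral_rotate)
  also have "\<dots> = (\<integral>\<^sup>+v. (\<integral>\<^sup>+t. G (cis t * v) \<partial>circ) \<partial>lborel)"
    by (rule p.Fubini'[symmetric]) measurable
  also have "\<dots> = (\<integral>\<^sup>+v. ennreal (2 * pi) *
      (\<Sum>n. ennreal ((cmod (c n))\<^sup>2) * (ennreal ((cmod v) ^ (2 * n)) * h (cmod v) * indicator disc v)) \<partial>lborel)"
  proof (rule nn_integral_cong)
    fix v :: complex
    show "(\<integral>\<^sup>+t. G (cis t * v) \<partial>circ) = ennreal (2 * pi) *
      (\<Sum>n. ennreal ((cmod (c n))\<^sup>2) * (ennreal ((cmod v) ^ (2 * n)) * h (cmod v) * indicator disc v))"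
    proof (cases "v \<in> disc")
      case True
      have [measurable]: "(\<lambda>t. F (cis t * v)) \<in> borel_measurable circ"
        using borel_measurable_continuous_onI[OF circ_parseval(1)[OF F True]]
        by (intro measurable_restrict_space1) auto
      have "(\<integral>\<^sup>+t. G (cis t * v) \<partial>circ) = (\<integral>\<^sup>+t. ennreal ((cmod (F (cis t * v)))\<^sup>2) * h (cmod v) \<partial>circ)"
        using True by (intro nn_integral_cong) (simp add: G_def norm_mult)
      also have "\<dots> = (\<integral>\<^sup>+t. ennreal ((cmod (F (cis t * v)))\<^sup>2) \<partial>circ) * h (cmod v)"
        by (rule nn_integral_multc) measurable
      also have "\<dots> = ennreal (2 * pi) * ((\<Sum>n. ennreal ((cmod (c n))\<^sup>2 * (cmod v) ^ (2 * n))) * h (cmod v))"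
        by (subst circ_parseval_nn[OF F True]) (auto simp: mult.assoc)
      also have "(\<Sum>n. ennreal ((cmod (c n))\<^sup>2 * (cmod v) ^ (2 * n))) * h (cmod v) =
          (\<Sum>n. ennreal ((cmod (c n))\<^sup>2 * (cmod v) ^ (2 * n)) * h (cmod v))"
        by (rule ennreal_suminf_multc[symmetric])
      also have "\<dots> = (\<Sum>n. ennreal ((cmod (c n))\<^sup>2) * (ennreal ((cmod v) ^ (2 * n)) * h (cmod v) * indicator disc v))"
        using True by (simp add: ennreal_mult mult.assoc)
      finally show ?thesis .
    next
      case False
      then show ?thesis by (simp add: G_def norm_mult)
    qed
  qed
  also have "\<dots> = ennreal (2 * pi) * (\<Sum>n. ennreal ((cmod (c n))\<^sup>2) *
      (\<integral>\<^sup>+v\<in>disc. ennreal ((cmod v) ^ (2 * n)) * h (cmod v) \<partial>lborel))"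
    by (simp add: nn_integral_cmult nn_integral_suminf)
  finally have "(\<integral>\<^sup>+v. G v \<partial>lborel) = (\<Sum>n. ennreal ((cmod (c n))\<^sup>2) *
      (\<integral>\<^sup>+v\<in>disc. ennreal ((cmod v) ^ (2 * n)) * h (cmod v) \<partial>lborel))"
    by (subst (asm) ennreal_mult_cancel_left) auto
  then show ?thesis by (simp add: G_def mult_ac)
qed

text \<open>Layer cake: |v|^(2n) is the integral of n s^(n-1) over 0 \<le> s \<le> |v|^2. After
  Fubini the inner integral is the area pi (1 - s) of the annulus sqrt s \<le> |v| < 1. The exponent
  n - 1 is why n = 0 is treated apart.\<close>

lemma disc_moment:
  "(\<integral>\<^sup>+v\<in>disc. ennreal ((cmod v) ^ (2 * n)) \<partial>lborel) = ennreal (pi / (real n + 1))"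
proof (cases n)
  case 0
  then show ?thesis by (simp add: emeasure_ball unit_ball_vol_2)
next
  case (Suc m)
  have [measurable]: "disc \<in> sets borel" by simp
  have 1: "ennreal ((cmod v) ^ (2 * n)) =
    (\<integral>\<^sup>+s. ennreal (real n * s ^ m) * indicator {0..(cmod v)\<^sup>2} s \<partial>lborel)" for v
  proof -
    have "(\<integral>\<^sup>+s. ennreal (real n * s ^ m) * indicator {0..(cmod v)\<^sup>2} s \<partial>lborel) =
        ennreal (((cmod v)\<^sup>2) ^ n - 0 ^ n)"
    proof (rule nn_integral_FTC_Icc)
      show "((\<lambda>s. s ^ n) has_real_derivative real n * s ^ m) (at s)" for s
        using DERIV_pow[of n s] by (simp add: Suc)
    qed auto
    then show ?thesis by (simp only: power_mult) (simp add: Suc)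
  qed
  have 2: "(\<integral>\<^sup>+v. indicator {0..(cmod v)\<^sup>2} s * indicator disc v \<partial>lborel) = ennreal (pi * (1 - s)) * indicator {0..1} s" for s :: real
  proof (cases "0 \<le> s \<and> s \<le> 1")
    case True
    have "(\<integral>\<^sup>+v. indicator {0..(cmod v)\<^sup>2} s * indicator disc v \<partial>lborel) =
        (\<integral>\<^sup>+v. indicator (disc - ball 0 (sqrt s)) v \<partial>lborel)"
    proof (intro nn_integral_cong)
      fix v :: complex
      have "s \<le> (cmod v)\<^sup>2 \<longleftrightarrow> sqrt s \<le> cmod v"
        using True real_sqrt_le_iff[of s "(cmod v)\<^sup>2"] by simp
      then show "indicator {0..(cmod v)\<^sup>2} s * indicator disc v = (indicator (disc - ball 0 (sqrt s)) v :: ennreal)"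
        using True by (auto simp: indicator_def)
    qed
    also have "\<dots> = emeasure lborel (disc - ball 0 (sqrt s))" by simp
    also have "\<dots> = emeasure lborel disc - emeasure lborel (ball (0::complex) (sqrt s))"
    proof (rule emeasure_Diff)
      show "ball (0::complex) (sqrt s) \<subseteq> disc" using True by (intro subset_ball) simp
    qed (use True in \<open>auto simp: emeasure_ball\<close>)
    also have "\<dots> = ennreal (pi * (1 - s))"
      using True by (simp add: emeasure_ball unit_ball_vol_2 ennreal_minus algebra_simps)
    finally show ?thesis using True by simp
  next
    case False
    have eq0: "indicator {0..(cmod v)\<^sup>2} s * indicator disc v = (0::ennreal)" for v
      using False abs_square_less_1[of "cmod v"] by (auto simp: indicator_def)
    show ?thesis unfolding eq0 using False by simp
  qed
  have "(\<integral>\<^sup>+v\<in>disc. ennreal ((cmod v) ^ (2 * n)) \<partial>lborel) =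
     (\<integral>\<^sup>+v. \<integral>\<^sup>+s. ennreal (real n * s ^ m) * (indicator {0..(cmod v)\<^sup>2} s * indicator disc v) \<partial>lborel \<partial>lborel)"
  proof (rule nn_integral_cong)
    fix v :: complex
    have "ennreal ((cmod v) ^ (2 * n)) * indicator disc v =
        (\<integral>\<^sup>+s. ennreal (real n * s ^ m) * indicator {0..(cmod v)\<^sup>2} s * indicator disc v \<partial>lborel)"
      unfolding 1 by (rule nn_integral_multc[symmetric]) measurable
    then show "ennreal ((cmod v) ^ (2 * n)) * indicator disc v =
        (\<integral>\<^sup>+s. ennreal (real n * s ^ m) * (indicator {0..(cmod v)\<^sup>2} s * indicator disc v) \<partial>lborel)"
      by (simp only: mult.assoc)
  qed
  also have "\<dots> = (\<integral>\<^sup>+s. \<integral>\<^sup>+v. ennreal (real n * s ^ m) * (indicator {0..(cmod v)\<^sup>2} s * indicator disc v) \<partial>lborel \<partial>lborel)"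
    by (rule lborel_pair.Fubini'[symmetric])
       (unfold indicator_def atLeastAtMost_iff mem_ball dist_0_norm, measurable)
  also have "\<dots> = (\<integral>\<^sup>+s. ennreal (real n * s ^ m * (pi * (1 - s))) * indicator {0..1} s \<partial>lborel)"
  proof (rule nn_integral_cong)
    fix s :: real
    have "(\<integral>\<^sup>+v. ennreal (real n * s ^ m) * (indicator {0..(cmod v)\<^sup>2} s * indicator disc v) \<partial>lborel) =
        ennreal (real n * s ^ m) * (ennreal (pi * (1 - s)) * indicator {0..1} s)"
      by (subst nn_integral_cmult)
         (simp_all only: 2, unfold indicator_def atLeastAtMost_iff mem_ball dist_0_norm, measurable)
    also have "\<dots> = ennreal (real n * s ^ m * (pi * (1 - s))) * indicator {0..1} s"
      by (auto simp: indicator_def ennreal_mult)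
    finally show "(\<integral>\<^sup>+v. ennreal (real n * s ^ m) * (indicator {0..(cmod v)\<^sup>2} s * indicator disc v) \<partial>lborel) = \<dots>" .
  qed
  \<comment> \<open>The antiderivative is \<open>pi * (s ^ n - n * s ^ (n + 1) / (n + 1))\<close>,
    which vanishes at 0 because \<open>n\<close> is positive here.\<close>
  also have "\<dots> = ennreal ((pi * (1 - real n / (real n + 1))) - 0)"
  proof -
    have "(\<integral>\<^sup>+s. ennreal (real n * s ^ m * (pi * (1 - s))) * indicator {0..1} s \<partial>lborel) =
      ennreal ((\<lambda>s. pi * (s ^ n - real n * s ^ (n + 1) / (real n + 1))) 1 - (\<lambda>s. pi * (s ^ n - real n * s ^ (n + 1) / (real n + 1))) 0)"
    proof (rule nn_integral_FTC_Icc)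
      fix s :: real
      have "((\<lambda>s. pi * (s ^ n - real n * s ^ (n + 1) / (real n + 1))) has_real_derivative
          pi * (real n * s ^ (n - 1) - real n * (real (n + 1) * s ^ (n + 1 - 1)) / (real n + 1))) (at s)"
        by (intro DERIV_cmult DERIV_diff DERIV_cdivide) (use DERIV_pow[of n s] DERIV_pow[of "n+1" s] in auto)
      also have "pi * (real n * s ^ (n - 1) - real n * (real (n + 1) * s ^ (n + 1 - 1)) / (real n + 1)) = real n * s ^ m * (pi * (1 - s))"
        by (simp add: Suc divide_simps) (simp add: algebra_simps)
      finally show "((\<lambda>s. pi * (s ^ n - real n * s ^ (n + 1) / (real n + 1))) has_real_derivative real n * s ^ m * (pi * (1 - s))) (at s)" .
    qed auto
    then show ?thesis by (simp add: Suc)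
  qed
  also have "pi * (1 - real n / (real n + 1)) - 0 = pi / (real n + 1)" by (simp add: field_simps)
  finally show ?thesis .
qed

text \<open>The coefficients are (n + 1) b^n and the moments pi / (n + 1). One factor n + 1 cancels,
  and what remains is pi times the same derivative of the geometric series, now at |b|^2.\<close>

lemma disc_kernel_integral:
  fixes b :: complex
  assumes b: "cmod b < 1"
  shows "(\<integral>\<^sup>+v\<in>disc. ennreal ((cmod (1 / (1 - b * v)\<^sup>2))\<^sup>2) \<partial>lborel) = ennreal (pi / (1 - (cmod b)\<^sup>2)\<^sup>2)"
proof -
  have F: "(\<lambda>n. of_nat (Suc n) * b ^ n * v ^ n) sums (1 / (1 - b * v)\<^sup>2)" if "v \<in> disc" for v
  proof -
    have "cmod (b * v) < 1"
      using b that mult_strict_mono'[of "cmod b" 1 "cmod v" 1] by (simp add: norm_mult)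
    from geometric_deriv_sums[OF this] show ?thesis by (simp add: power_mult_distrib mult_ac)
  qed
  have "(\<integral>\<^sup>+v\<in>disc. ennreal ((cmod (1 / (1 - b * v)\<^sup>2))\<^sup>2) \<partial>lborel) =
      (\<Sum>n. ennreal ((cmod (of_nat (Suc n) * b ^ n))\<^sup>2) * ennreal (pi / (real n + 1)))"
    using disc_parseval[OF F, of "\<lambda>_. 1"] by (simp add: disc_moment)
  also have "\<dots> = (\<Sum>n. ennreal (pi * (of_nat (Suc n) * ((cmod b)\<^sup>2) ^ n)))"
  proof (intro suminf_cong)
    fix n
    have "ennreal ((cmod (of_nat (Suc n) * b ^ n))\<^sup>2) * ennreal (pi / (real n + 1)) =
       ennreal ((cmod (of_nat (Suc n) * b ^ n))\<^sup>2 * (pi / (real n + 1)))"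
      by (rule ennreal_mult[symmetric]) auto
    also have "(cmod (of_nat (Suc n) * b ^ n))\<^sup>2 * (pi / (real n + 1)) = pi * (of_nat (Suc n) * ((cmod b)\<^sup>2) ^ n)"
    proof -
      have "cmod (of_nat (Suc n) * b ^ n) = (real n + 1) * cmod b ^ n"
        using norm_of_nat[of "Suc n", where 'a = complex] by (simp add: norm_mult norm_power del: of_nat_Suc)
      then show ?thesis by (simp add: power2_eq_square power_mult_distrib field_simps)
    qed
    finally show "ennreal ((cmod (of_nat (Suc n) * b ^ n))\<^sup>2) * ennreal (pi / (real n + 1)) = \<dots>" .
  qed
  also have "\<dots> = ennreal (pi * (1 / (1 - (cmod b)\<^sup>2)\<^sup>2))"
  proof (rule suminf_ennreal_eq)
    have "norm ((cmod b)\<^sup>2) < 1" using b by (simp add: abs_square_less_1)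
    from geometric_deriv_sums[OF this]
    show "(\<lambda>n. pi * (of_nat (Suc n) * ((cmod b)\<^sup>2) ^ n)) sums (pi * (1 / (1 - (cmod b)\<^sup>2)\<^sup>2))"
      by (rule sums_mult)
  qed auto
  finally show ?thesis by simp
qed

text \<open>The sub-mean value property of |g|^2: after rescaling to the unit disc, the left side is
  the zeroth term of the Parseval series for the right side.\<close>

lemma holomorphic_local_bound:
  fixes g :: "complex \<Rightarrow> complex"
  assumes g: "g holomorphic_on ball z r" and r: "r > 0"
  shows "ennreal (pi * r\<^sup>2 * (cmod (g z))\<^sup>2) \<le> (\<integral>\<^sup>+v\<in>ball z r. ennreal ((cmod (g v))\<^sup>2) \<partial>lborel)"
proof -
  define F where "F v = g (z + of_real r * v)" for v
  have in_ball: "z + of_real r * v \<in> ball z r \<longleftrightarrow> v \<in> disc" for v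
    using r by (simp add: dist_norm norm_mult)
  have F: "F holomorphic_on disc"
    unfolding F_def by (intro holomorphic_on_compose_gen[OF _ g, unfolded o_def] holomorphic_intros) (use in_ball in auto)
  have sums: "(\<lambda>n. (deriv ^^ n) F 0 / fact n * w ^ n) sums F w" if "w \<in> disc" for w
    using holomorphic_power_series[OF F that] by simp
  let ?c = "\<lambda>n. (deriv ^^ n) F 0 / fact n"
  have [measurable]: "(\<lambda>v. ennreal ((cmod (g v))\<^sup>2) * indicator (ball z r) v) \<in> borel_measurable borel"
    by (rule borel_measurable_norm_square_indicator) (use g holomorphic_on_imp_continuous_on in auto)
  have "ennreal (pi * (cmod (g z))\<^sup>2) = ennreal ((cmod (?c 0))\<^sup>2) * (\<integral>\<^sup>+v\<in>disc. ennreal ((cmod v) ^ (2 * 0)) \<partial>lborel)"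
    unfolding disc_moment by (simp add: F_def ennreal_mult'' mult.commute)
  also have "\<dots> \<le> (\<Sum>n. ennreal ((cmod (?c n))\<^sup>2) * (\<integral>\<^sup>+v\<in>disc. ennreal ((cmod v) ^ (2 * n)) \<partial>lborel))"
    using sum_le_suminf[of "\<lambda>n. ennreal ((cmod (?c n))\<^sup>2) * (\<integral>\<^sup>+v\<in>disc. ennreal ((cmod v) ^ (2 * n)) \<partial>lborel)" "{0}"]
    by simp
  also have "\<dots> = (\<integral>\<^sup>+v\<in>disc. ennreal ((cmod (F v))\<^sup>2) \<partial>lborel)"
    using disc_parseval[OF sums, of "\<lambda>_. 1"] by simp
  finally have "ennreal (r\<^sup>2) * ennreal (pi * (cmod (g z))\<^sup>2) \<le> ennreal (r\<^sup>2) * (\<integral>\<^sup>+v\<in>disc. ennreal ((cmod (F v))\<^sup>2) \<partial>lborel)"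
    by (rule mult_left_mono) simp
  also have "\<dots> = ennreal (r\<^sup>2) * (\<integral>\<^sup>+v. ennreal ((cmod (g (z + of_real r * v)))\<^sup>2) * indicator (ball z r) (z + of_real r * v) \<partial>lborel)"
  proof -
    have "indicator (ball z r) (z + of_real r * v) = (indicator disc v :: ennreal)" for v
      using in_ball[of v] by (simp add: indicator_def)
    then show ?thesis by (simp add: F_def)
  qed
  also have "\<dots> = (\<integral>\<^sup>+v\<in>ball z r. ennreal ((cmod (g v))\<^sup>2) \<partial>lborel)"
    by (rule nn_integral_affine_complex[OF r, symmetric]) measurable
  finally show ?thesis by (simp add: ennreal_mult'[symmetric] mult_ac)
qed


section \<open>The Bergman projection\<close>

lemma emeasure_disc: "emeasure lborel disc = ennreal pi"
  by (simp add: emeasure_ball unit_ball_vol_2)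

text \<open>Values of \<open>g\<close> off the disc do not count for \<open>dA\<close>, so Borel
  measurability is asked of the product with the indicator only. Completion of the measure leaves
  the integral unchanged.\<close>

lemma nn_integral_dA:
  assumes "(\<lambda>v. g v * indicator disc v) \<in> borel_measurable borel"
  shows "(\<integral>\<^sup>+v. g v \<partial>dA) = (\<integral>\<^sup>+v\<in>disc. g v \<partial>lborel) / ennreal pi"
proof -
  have D: "disc \<in> sets (lebesgue_on disc)" by auto
  have m: "g \<in> borel_measurable (lebesgue_on disc)"
    using assms by (subst borel_measurable_restrict_space_iff_ennreal)
      (auto simp: measurable_completion mult.commute)
  have "emeasure (lebesgue_on disc) disc = ennreal pi"
    by (subst emeasure_restrict_space) (auto simp: emeasure_disc)
  then have "(\<integral>\<^sup>+v. g v \<partial>dA) = (\<integral>\<^sup>+v. g v * indicator disc v \<partial>lebesgue_on disc) / ennreal pi"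
    unfolding dA_def by (subst nn_integral_uniform_measure[OF m D]) simp
  also have "(\<integral>\<^sup>+v. g v * indicator disc v \<partial>lebesgue_on disc) = (\<integral>\<^sup>+v\<in>disc. g v \<partial>lborel)"
    by (subst nn_integral_restrict_space)
       (auto simp: nn_integral_completion indicator_def intro!: nn_integral_cong)
  finally show ?thesis .
qed

lemma emeasure_dA: "emeasure dA disc = 1"
proof -
  have "emeasure dA (space dA) = (\<integral>\<^sup>+v. 1 \<partial>dA)" by simp
  also have "\<dots> = (\<integral>\<^sup>+v\<in>disc. 1 \<partial>lborel) / ennreal pi" by (rule nn_integral_dA) (auto intro!: borel_measurable_indicator)
  also have "\<dots> = 1" by (simp add: emeasure_disc divide_ennreal)
  finally show ?thesis by simp
qed

interpretation dA: finite_measure dA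
  by (rule finite_measureI) (simp add: emeasure_dA)

section \<open>Square-integrable functions and bounded point evaluations\<close>

lemma L2_nn:
  assumes "f \<in> L2"
  shows "(\<integral>\<^sup>+w. ennreal ((cmod (f w))\<^sup>2) \<partial>dA) = ennreal (LINT w|dA. (cmod (f w))\<^sup>2)"
  using assms by (intro nn_integral_eq_integral) (auto simp: L2_def)

lemma L2_I:
  assumes "f \<in> borel_measurable dA" "(\<integral>\<^sup>+w. ennreal ((cmod (f w))\<^sup>2) \<partial>dA) < \<infinity>"
  shows "f \<in> L2"
  using assms unfolding L2_def by (auto simp: integrable_iff_bounded)

lemma L2_add: assumes "f \<in> L2" "g \<in> L2" shows "(\<lambda>w. f w + g w) \<in> L2"
proof -
  have [measurable]: "f \<in> borel_measurable dA" "g \<in> borel_measurable dA" using assms by (auto simp: L2_def)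
  have "integrable dA (\<lambda>w. 2 * (cmod (f w))\<^sup>2 + 2 * (cmod (g w))\<^sup>2)" using assms by (auto simp: L2_def)
  then have "integrable dA (\<lambda>w. (cmod (f w + g w))\<^sup>2)"
  proof (rule Bochner_Integration.integrable_bound)
    show "AE w in dA. norm ((cmod (f w + g w))\<^sup>2) \<le> norm (2 * (cmod (f w))\<^sup>2 + 2 * (cmod (g w))\<^sup>2)"
    proof (intro AE_I2)
      fix w
      have "(cmod (f w + g w))\<^sup>2 \<le> (cmod (f w) + cmod (g w))\<^sup>2"
        by (intro power_mono norm_triangle_ineq) simp
      also have "\<dots> \<le> 2 * (cmod (f w))\<^sup>2 + 2 * (cmod (g w))\<^sup>2"
        using zero_le_power2[of "cmod (f w) - cmod (g w)"] by (simp add: power2_eq_square algebra_simps)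
      finally show "norm ((cmod (f w + g w))\<^sup>2) \<le> norm (2 * (cmod (f w))\<^sup>2 + 2 * (cmod (g w))\<^sup>2)" by simp
    qed
  qed simp
  then show ?thesis by (simp add: L2_def)
qed

lemma L2_cmult: assumes "f \<in> L2" shows "(\<lambda>w. c * f w) \<in> L2"
  using assms by (auto simp: L2_def norm_mult power_mult_distrib)

lemma L2_diff: assumes "f \<in> L2" "g \<in> L2" shows "(\<lambda>w. f w - g w) \<in> L2"
  using L2_add[OF assms(1) L2_cmult[OF assms(2), of "-1"]] by simp

lemma L2_inner_integrable:
  assumes "f \<in> L2" "g \<in> L2"
  shows "integrable dA (\<lambda>w. f w * cnj (g w))"
proof -
  have [measurable]: "f \<in> borel_measurable dA" "g \<in> borel_measurable dA" using assms by (auto simp: L2_def)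
  have [measurable]: "(\<lambda>w. cnj (g w)) \<in> borel_measurable dA"
    by (rule borel_measurable_continuous_on[OF _ \<open>g \<in> borel_measurable dA\<close>]) (intro continuous_on_cnj continuous_on_id)
  have "integrable dA (\<lambda>w. (cmod (f w))\<^sup>2 + (cmod (g w))\<^sup>2)" using assms by (auto simp: L2_def)
  then show ?thesis
  proof (rule Bochner_Integration.integrable_bound)
    show "AE w in dA. norm (f w * cnj (g w)) \<le> norm ((cmod (f w))\<^sup>2 + (cmod (g w))\<^sup>2)"
    proof (intro AE_I2)
      fix w
      have "2 * (cmod (f w) * cmod (g w)) \<le> (cmod (f w))\<^sup>2 + (cmod (g w))\<^sup>2"
        using zero_le_power2[of "cmod (f w) - cmod (g w)"] by (simp add: power2_eq_square algebra_simps)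
      moreover have "0 \<le> cmod (f w) * cmod (g w)" by simp
      ultimately have "cmod (f w) * cmod (g w) \<le> (cmod (f w))\<^sup>2 + (cmod (g w))\<^sup>2" by linarith
      then show "norm (f w * cnj (g w)) \<le> norm ((cmod (f w))\<^sup>2 + (cmod (g w))\<^sup>2)"
        by (simp add: norm_mult)
    qed
  qed simp
qed

text \<open>Serves twice: with a small \<open>c\<close> for the variation of a minimizer, and with
  \<open>c = 1\<close> and a vanishing inner product for Pythagoras.\<close>

lemma L2_square_diff_scaled:
  assumes f: "f \<in> L2" and g: "g \<in> L2"
  shows "(LINT w|dA. (cmod (f w - c * g w))\<^sup>2) =
    (LINT w|dA. (cmod (f w))\<^sup>2) - 2 * Re (cnj c * L2_inner f g) + (cmod c)\<^sup>2 * (LINT w|dA. (cmod (g w))\<^sup>2)"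
proof -
  have eq: "(cmod (f w - c * g w))\<^sup>2 = (cmod (f w))\<^sup>2 - 2 * Re (cnj c * (f w * cnj (g w))) + (cmod c)\<^sup>2 * (cmod (g w))\<^sup>2" for w
  proof -
    have "(cmod (f w - c * g w))\<^sup>2 = (cmod (f w))\<^sup>2 - 2 * Re (f w * cnj (c * g w)) + (cmod (c * g w))\<^sup>2"
      by (simp only: cmod_power2) (simp add: power2_eq_square algebra_simps)
    then show ?thesis by (simp add: norm_mult power_mult_distrib mult_ac)
  qed
  define R where "R w = Re (cnj c * (f w * cnj (g w)))" for w
  have i: "integrable dA (\<lambda>w. cnj c * (f w * cnj (g w)))"
    using L2_inner_integrable[OF f g] by auto
  have "integral\<^sup>L dA R = Re (LINT w|dA. cnj c * (f w * cnj (g w)))"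
    unfolding R_def by (rule integral_Re[OF i])
  then have "integral\<^sup>L dA R = Re (cnj c * L2_inner f g)"
    unfolding L2_inner_def by (simp only: integral_mult_right_zero)
  moreover have "integrable dA R" unfolding R_def using i by (rule integrable_Re)
  ultimately show ?thesis
    using f g unfolding eq R_def[symmetric] by (simp add: L2_def)
qed

lemma bergman_add: "f \<in> bergman_space \<Longrightarrow> g \<in> bergman_space \<Longrightarrow> (\<lambda>w. f w + g w) \<in> bergman_space"
  by (auto simp: bergman_space_def intro!: L2_add holomorphic_intros)

lemma bergman_cmult: "f \<in> bergman_space \<Longrightarrow> (\<lambda>w. c * f w) \<in> bergman_space"
  by (auto simp: bergman_space_def intro!: L2_cmult holomorphic_intros)

lemma bergman_diff: "f \<in> bergman_space \<Longrightarrow> g \<in> bergman_space \<Longrightarrow> (\<lambda>w. f w - g w) \<in> bergman_space"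
  by (auto simp: bergman_space_def intro!: L2_diff holomorphic_intros)

text \<open>The ball of radius \<open>1 - r\<close> about \<open>z\<close> stays inside the disc.
  The bound is uniform over |z| \<le> r, so norm-Cauchy sequences converge locally uniformly, and a
  member of norm 0 vanishes at every point of the disc.\<close>

lemma bergman_local_bound:
  assumes g: "g \<in> bergman_space" and r: "cmod z \<le> r" "r < 1"
  shows "(cmod (g z))\<^sup>2 \<le> (LINT w|dA. (cmod (g w))\<^sup>2) / (1 - r)\<^sup>2"
proof -
  have hol: "g holomorphic_on disc" and L: "g \<in> L2" using g by (auto simp: bergman_space_def)
  have sub: "ball z (1 - r) \<subseteq> disc"
  proof
    fix w assume "w \<in> ball z (1 - r)"
    then have "cmod (w - z) < 1 - r" by (simp add: dist_norm norm_minus_commute)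
    then show "w \<in> disc" using norm_triangle_ineq[of "w - z" z] r by simp
  qed
  have m: "(\<lambda>v. ennreal ((cmod (g v))\<^sup>2) * indicator disc v) \<in> borel_measurable borel"
    by (rule borel_measurable_norm_square_indicator) (use hol holomorphic_on_imp_continuous_on in auto)
  have "ennreal (pi * (1 - r)\<^sup>2 * (cmod (g z))\<^sup>2) \<le> (\<integral>\<^sup>+v\<in>ball z (1 - r). ennreal ((cmod (g v))\<^sup>2) \<partial>lborel)"
    using r by (intro holomorphic_local_bound holomorphic_on_subset[OF hol sub]) auto
  also have "\<dots> \<le> (\<integral>\<^sup>+v\<in>disc. ennreal ((cmod (g v))\<^sup>2) \<partial>lborel)"
    using sub by (intro nn_integral_mono mult_left_mono) (auto simp: indicator_def)
  also have "\<dots> = ennreal pi * (\<integral>\<^sup>+v. ennreal ((cmod (g v))\<^sup>2) \<partial>dA)"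
    unfolding nn_integral_dA[OF m] by (simp add: ennreal_times_divide mult.commute[of "ennreal pi"] ennreal_mult_divide_eq)
  also have "\<dots> = ennreal (pi * (LINT w|dA. (cmod (g w))\<^sup>2))"
    unfolding L2_nn[OF L] by (subst ennreal_mult[symmetric]) auto
  finally have "pi * (1 - r)\<^sup>2 * (cmod (g z))\<^sup>2 \<le> pi * (LINT w|dA. (cmod (g w))\<^sup>2)"
    by (subst (asm) ennreal_le_iff) auto
  then have "(1 - r)\<^sup>2 * (cmod (g z))\<^sup>2 \<le> (LINT w|dA. (cmod (g w))\<^sup>2)" by simp
  then show ?thesis using r by (simp add: pos_le_divide_eq mult.commute)
qed

section \<open>The orthogonal projection as nearest point\<close>

text \<open>A minimizing sequence is Cauchy in norm by the parallelogram law. Bounded point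
  evaluations make it converge uniformly on smaller discs, so the limit is holomorphic; Fatou's
  lemma shows that the limit attains the infimum.\<close>

lemma bergman_minimizer:
  assumes h: "h \<in> L2"
  obtains g where "g \<in> bergman_space" "\<And>k. k \<in> bergman_space \<Longrightarrow>
    (LINT w|dA. (cmod (h w - g w))\<^sup>2) \<le> (LINT w|dA. (cmod (h w - k w))\<^sup>2)"
proof -
  define N where "N f = (LINT w|dA. (cmod (f w))\<^sup>2)" for f :: "complex \<Rightarrow> complex"
  have N0: "0 \<le> N f" for f by (simp add: N_def)
  define d where "d = (INF k\<in>bergman_space. N (\<lambda>w. h w - k w))"
  have zero: "(\<lambda>w. 0) \<in> bergman_space" by (simp add: bergman_space_def L2_def)
  have bdd: "bdd_below ((\<lambda>k. N (\<lambda>w. h w - k w)) ` bergman_space)" using N0 by (auto intro!: bdd_belowI[of _ 0])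
  have d_le: "d \<le> N (\<lambda>w. h w - k w)" if "k \<in> bergman_space" for k
    unfolding d_def by (rule cINF_lower[OF bdd that])
  have "\<exists>k\<in>bergman_space. N (\<lambda>w. h w - k w) < d + inverse (real (Suc n))" for n
  proof (rule ccontr)
    assume "\<not> ?thesis"
    then have "d + inverse (real (Suc n)) \<le> d"
      unfolding d_def by (intro cINF_greatest) (use zero in \<open>auto simp: not_less d_def\<close>)
    then show False by (simp add: not_le[symmetric] del: of_nat_Suc)
  qed
  then obtain g where gB: "\<And>n. g n \<in> bergman_space"
      and gd: "\<And>n. N (\<lambda>w. h w - g n w) < d + inverse (real (Suc n))" by metis
  have gL: "g n \<in> L2" and ghol: "g n holomorphic_on disc" for n using gB by (auto simp: bergman_space_def)
  have cauchy: "N (\<lambda>w. g n w - g m w) \<le> 2 * inverse (real (Suc n)) + 2 * inverse (real (Suc m))" for m n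
  proof -
    \<comment> \<open>The midpoint is itself a competitor, so its squared distance to
      \<open>h\<close> is at least \<open>d\<close>; this bounds the last term of the parallelogram
      law.\<close>
    define k where "k w = (1/2) * (g n w + g m w)" for w
    have k: "k \<in> bergman_space" unfolding k_def by (intro bergman_cmult bergman_add gB)
    have kL: "k \<in> L2" using k by (simp add: bergman_space_def)
    have par: "(cmod (g n w - g m w))\<^sup>2 =
       2 * (cmod (h w - g n w))\<^sup>2 + 2 * (cmod (h w - g m w))\<^sup>2 - 4 * (cmod (h w - k w))\<^sup>2" for w
      by (simp only: cmod_power2 k_def) (simp add: power2_eq_square field_simps)
    have i: "integrable dA (\<lambda>w. (cmod (h w - g n w))\<^sup>2)" "integrable dA (\<lambda>w. (cmod (h w - k w))\<^sup>2)" for n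
      using L2_diff[OF h gL[of n]] L2_diff[OF h kL] by (auto simp: L2_def)
    have "N (\<lambda>w. g n w - g m w) = 2 * N (\<lambda>w. h w - g n w) + 2 * N (\<lambda>w. h w - g m w) - 4 * N (\<lambda>w. h w - k w)"
      unfolding N_def par using i by simp
    then show ?thesis using gd[of n] gd[of m] d_le[OF k] by linarith
  qed
  define G where "G w = lim (\<lambda>n. g n w)" for w
  have ul: "uniform_limit (cball 0 r) g G sequentially" if r: "0 \<le> r" "r < 1" for r
  proof -
    have "uniformly_Cauchy_on (cball 0 r) g"
    proof (rule uniformly_Cauchy_onI)
      fix e :: real assume e: "e > 0"
      \<comment> \<open>The Cauchy estimate gives less than 4 e', that is
        \<open>(e * (1 - r))\<^sup>2\<close>, and point evaluation on |x| \<le> r costs the factor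
        \<open>1 / (1 - r)\<^sup>2\<close>.\<close>
      define e' where "e' = (e * (1 - r))\<^sup>2 / 4"
      have "e' > 0" using e r by (simp add: e'_def)
      then obtain M where M: "inverse (real (Suc M)) < e'" using reals_Archimedean by blast
      have "dist (g m x) (g n x) < e" if "x \<in> cball 0 r" "m \<ge> M" "n \<ge> M" for x m n
      proof -
        have "inverse (real (Suc m)) \<le> inverse (real (Suc M))" "inverse (real (Suc n)) \<le> inverse (real (Suc M))"
          using that by (auto intro!: le_imp_inverse_le)
        then have N: "N (\<lambda>w. g m w - g n w) < (e * (1 - r))\<^sup>2" using cauchy[of m n] M unfolding e'_def by linarith
        have "(cmod (g m x - g n x))\<^sup>2 \<le> N (\<lambda>w. g m w - g n w) / (1 - r)\<^sup>2"
          unfolding N_def using that r by (intro bergman_local_bound bergman_diff gB) auto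
        also have "\<dots> < (e * (1 - r))\<^sup>2 / (1 - r)\<^sup>2"
          using N r by (intro divide_strict_right_mono) auto
        also have "\<dots> = e\<^sup>2" using r by (simp add: power_mult_distrib)
        finally show ?thesis using e power2_less_imp_less[of "cmod (g m x - g n x)" e] by (simp add: dist_norm)
      qed
      then show "\<exists>M. \<forall>x\<in>cball 0 r. \<forall>m\<ge>M. \<forall>n\<ge>M. dist (g m x) (g n x) < e" by blast
    qed
    then have "uniformly_convergent_on (cball 0 r) g" by (simp add: uniformly_convergent_eq_Cauchy)
    then show ?thesis unfolding uniformly_convergent_uniform_limit_iff G_def .
  qed
  have Ghol: "G holomorphic_on disc"
  proof (rule holomorphic_uniform_sequence[OF open_ball ghol])
    fix x :: complex assume x: "x \<in> disc"
    define e where "e = (1 - cmod x) / 2"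
    have e: "e > 0" using x by (simp add: e_def)
    have sub: "cball x e \<subseteq> cball 0 (cmod x + e)"
    proof
      fix w assume "w \<in> cball x e"
      then show "w \<in> cball 0 (cmod x + e)"
        using norm_triangle_ineq[of "w - x" x] by (simp add: dist_norm norm_minus_commute)
    qed
    have lt: "cmod x + e < 1" using x by (simp add: e_def field_simps)
    have "cball x e \<subseteq> disc"
      using sub lt by force
    moreover have "uniform_limit (cball x e) g G sequentially"
      by (rule uniform_limit_on_subset[OF ul sub]) (use e lt in auto)
    ultimately show "\<exists>d>0. cball x d \<subseteq> disc \<and> uniform_limit (cball x d) g G sequentially" using e by blast
  qed
  have lim: "(\<lambda>n. g n w) \<longlonglongrightarrow> G w" if "w \<in> disc" for w
    by (rule tendsto_uniform_limitI[OF ul[of "cmod w"]]) (use that in auto)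
  have mG: "G \<in> borel_measurable dA"
    by (intro continuous_measurable_dA holomorphic_on_imp_continuous_on Ghol)
  have mh: "h \<in> borel_measurable dA" using h by (simp add: L2_def)
  note [measurable] = mG mh
  have [measurable]: "g n \<in> borel_measurable dA" for n using gL by (simp add: L2_def)
  have "(\<integral>\<^sup>+w. ennreal ((cmod (h w - G w))\<^sup>2) \<partial>dA) \<le> (\<integral>\<^sup>+w. liminf (\<lambda>n. ennreal ((cmod (h w - g n w))\<^sup>2)) \<partial>dA)"
  proof (rule nn_integral_mono)
    fix w assume "w \<in> space dA"
    then have "(\<lambda>n. ennreal ((cmod (h w - g n w))\<^sup>2)) \<longlonglongrightarrow> ennreal ((cmod (h w - G w))\<^sup>2)"
      by (intro tendsto_intros tendsto_ennrealI lim) simp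
    from lim_imp_Liminf[OF sequentially_bot this]
    show "ennreal ((cmod (h w - G w))\<^sup>2) \<le> liminf (\<lambda>n. ennreal ((cmod (h w - g n w))\<^sup>2))"
      by (simp only: order.refl)
  qed
  \<comment> \<open>Fatou's lemma turns pointwise convergence on the disc into a bound for the
    distance from \<open>h\<close> to \<open>G\<close>.\<close>
  also have "\<dots> \<le> liminf (\<lambda>n. \<integral>\<^sup>+w. ennreal ((cmod (h w - g n w))\<^sup>2) \<partial>dA)"
    by (rule nn_integral_liminf) measurable
  also have "\<dots> \<le> liminf (\<lambda>n. ennreal (d + inverse (real (Suc n))))"
  proof (intro Liminf_mono always_eventually allI)
    fix n
    show "(\<integral>\<^sup>+w. ennreal ((cmod (h w - g n w))\<^sup>2) \<partial>dA) \<le> ennreal (d + inverse (real (Suc n)))"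
      unfolding L2_nn[OF L2_diff[OF h gL]] using gd[of n] by (simp add: N_def ennreal_leI)
  qed
  also have "\<dots> = ennreal d"
  proof (rule lim_imp_Liminf)
    have "(\<lambda>n. d + inverse (real (Suc n))) \<longlonglongrightarrow> d + 0"
      by (intro tendsto_intros LIMSEQ_inverse_real_of_nat)
    then show "(\<lambda>n. ennreal (d + inverse (real (Suc n)))) \<longlonglongrightarrow> ennreal d"
      by (intro tendsto_ennrealI) simp
  qed simp
  finally have le: "(\<integral>\<^sup>+w. ennreal ((cmod (h w - G w))\<^sup>2) \<partial>dA) \<le> ennreal d" .
  have hG: "(\<lambda>w. h w - G w) \<in> L2"
    by (rule L2_I) (use le in \<open>auto intro: le_less_trans\<close>)
  \<comment> \<open>Square integrability of \<open>G\<close> is recovered from that of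
    \<open>h\<close> and of \<open>h - G\<close>.\<close>
  have "(\<lambda>w. h w - (h w - G w)) \<in> L2" by (rule L2_diff[OF h hG])
  then have GB: "G \<in> bergman_space" using Ghol by (simp add: bergman_space_def)
  have d0: "0 \<le> d" unfolding d_def using zero N0 by (intro cINF_greatest) auto
  have "N (\<lambda>w. h w - G w) \<le> d"
    using le d0 unfolding L2_nn[OF hG] N_def by (simp add: ennreal_le_iff)
  then show ?thesis using that[OF GB] d_le unfolding N_def by force
qed

text \<open>Moving from \<open>g\<close> to g + t I k, with I the inner product in question, changes
  the squared distance by t |I|^2 (t N - 2). This is negative for small t unless I = 0. The factor I
  in the direction makes the linear term real.\<close>

lemma bergman_minimizer_orthogonal:
  assumes h: "h \<in> L2" and g: "g \<in> bergman_space" and k: "k \<in> bergman_space"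
    and min: "\<And>k. k \<in> bergman_space \<Longrightarrow>
      (LINT w|dA. (cmod (h w - g w))\<^sup>2) \<le> (LINT w|dA. (cmod (h w - k w))\<^sup>2)"
  shows "L2_inner (\<lambda>w. h w - g w) k = 0"
proof (rule ccontr)
  assume ne: "L2_inner (\<lambda>w. h w - g w) k \<noteq> 0"
  define I where "I = L2_inner (\<lambda>w. h w - g w) k"
  define N where "N = (LINT w|dA. (cmod (k w))\<^sup>2)"
  \<comment> \<open>Adding 1 keeps the denominator positive when \<open>k\<close> has norm 0 and
    yields \<open>t * N < 1\<close>.\<close>
  define t where "t = 1 / (N + 1)"
  have N: "0 \<le> N" by (simp add: N_def)
  have t: "t > 0" "t * N < 1" using N by (auto simp: t_def field_simps)
  have L: "g \<in> L2" "k \<in> L2" using g k by (auto simp: bergman_space_def)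
  have "(\<lambda>w. g w + (t * I) * k w) \<in> bergman_space" by (intro bergman_add bergman_cmult g k)
  from min[OF this] have "(LINT w|dA. (cmod (h w - g w))\<^sup>2) \<le> (LINT w|dA. (cmod ((h w - g w) - (t * I) * k w))\<^sup>2)"
    by (simp add: algebra_simps)
  also have "\<dots> = (LINT w|dA. (cmod (h w - g w))\<^sup>2) - 2 * Re (cnj (t * I) * I) + (cmod (t * I))\<^sup>2 * N"
    unfolding I_def N_def by (rule L2_square_diff_scaled[OF L2_diff[OF h L(1)] L(2)])
  also have "Re (cnj (t * I) * I) = t * (cmod I)\<^sup>2"
    by (simp only: cmod_power2) (simp add: power2_eq_square algebra_simps)
  also have "(cmod (t * I))\<^sup>2 * N = t * (cmod I)\<^sup>2 * (t * N)"
    by (simp add: norm_mult power_mult_distrib power2_eq_square)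
  finally have "2 * (t * (cmod I)\<^sup>2) \<le> t * (cmod I)\<^sup>2 * (t * N)" by simp
  also have "\<dots> \<le> t * (cmod I)\<^sup>2 * 1" using t by (intro mult_left_mono) auto
  finally have "t * (cmod I)\<^sup>2 \<le> 0" by simp
  then show False using t ne by (simp add: I_def mult_le_0_iff)
qed

text \<open>This discharges the definite description. The minimizer, set to 0 off the disc,
  satisfies it. The difference of two candidates lies in the Bergman space and is orthogonal to
  itself, so its norm is 0 and point evaluation makes it vanish on the disc.\<close>

lemma bergman_proj_props:
  assumes h: "h \<in> L2"
  shows "bergman_proj h \<in> bergman_space"
    and "k \<in> bergman_space \<Longrightarrow> L2_inner (\<lambda>w. h w - bergman_proj h w) k = 0"
proof -
  obtain g where g: "g \<in> bergman_space" and min: "\<And>k. k \<in> bergman_space \<Longrightarrow>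
    (LINT w|dA. (cmod (h w - g w))\<^sup>2) \<le> (LINT w|dA. (cmod (h w - k w))\<^sup>2)"
    using bergman_minimizer[OF h] by blast
  define g0 where "g0 w = (if w \<in> disc then g w else 0)" for w
  have g0: "g0 \<in> bergman_space"
  proof -
    have "g0 holomorphic_on disc"
      using g by (subst holomorphic_cong[of disc disc g0 g]) (auto simp: g0_def bergman_space_def)
    moreover have "g0 \<in> borel_measurable dA"
      using g by (subst measurable_cong[of dA g0 g]) (auto simp: g0_def bergman_space_def L2_def)
    moreover have "integrable dA (\<lambda>w. (cmod (g0 w))\<^sup>2)"
      using g by (subst Bochner_Integration.integrable_cong[of dA dA _ "\<lambda>w. (cmod (g w))\<^sup>2"])
        (auto simp: g0_def bergman_space_def L2_def)
    ultimately show ?thesis by (simp add: bergman_space_def L2_def)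
  qed
  have orth: "L2_inner (\<lambda>w. h w - g0 w) k = 0" if k: "k \<in> bergman_space" for k
  proof -
    have "L2_inner (\<lambda>w. h w - g0 w) k = L2_inner (\<lambda>w. h w - g w) k"
      unfolding L2_inner_def by (rule Bochner_Integration.integral_cong) (auto simp: g0_def)
    then show ?thesis using bergman_minimizer_orthogonal[OF h g k min] by simp
  qed
  let ?P = "\<lambda>g. g \<in> bergman_space \<and> (\<forall>w. w \<notin> disc \<longrightarrow> g w = 0) \<and>
    (\<forall>h'\<in>bergman_space. L2_inner (\<lambda>w. h w - g w) h' = 0)"
  have P0: "?P g0" using g0 orth by (auto simp: g0_def)
  have uniq: "g' = g0" if P': "?P g'" for g'
  proof
    fix z
    define e where "e w = g' w - g0 w" for w
    have e: "e \<in> bergman_space" unfolding e_def using P' g0 by (intro bergman_diff) auto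
    have L: "g' \<in> L2" "g0 \<in> L2" "e \<in> L2" using P' g0 e by (auto simp: bergman_space_def)
    have "L2_inner (\<lambda>w. h w - g0 w) e - L2_inner (\<lambda>w. h w - g' w) e = L2_inner e e"
      unfolding L2_inner_def
      by (subst Bochner_Integration.integral_diff[symmetric])
         (auto intro!: L2_inner_integrable L2_diff h L Bochner_Integration.integral_cong simp: e_def algebra_simps)
    then have "L2_inner e e = 0" using orth[OF e] P' e by simp
    moreover have "L2_inner e e = of_real (LINT w|dA. (cmod (e w))\<^sup>2)"
      unfolding L2_inner_def by (subst integral_complex_of_real[symmetric]) (simp only: complex_norm_square)
    ultimately have N: "(LINT w|dA. (cmod (e w))\<^sup>2) = 0" by simp
    show "g' z = g0 z"
    proof (cases "z \<in> disc")
      case True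
      then have "(cmod (e z))\<^sup>2 \<le> 0"
        using bergman_local_bound[OF e, of z "cmod z"] N by simp
      then show ?thesis by (simp add: e_def)
    next
      case False then show ?thesis using P' P0 by auto
    qed
  qed
  have "bergman_proj h = g0" unfolding bergman_proj_def by (rule the_equality, rule P0, rule uniq)
  then show "bergman_proj h \<in> bergman_space"
    and "k \<in> bergman_space \<Longrightarrow> L2_inner (\<lambda>w. h w - bergman_proj h w) k = 0" using g0 orth by auto
qed

text \<open>h - k is the residual h - P h minus k - P h. The latter lies in the Bergman space, to
  which the residual is orthogonal.\<close>

lemma bergman_proj_pythagoras:
  assumes h: "h \<in> L2" and k: "k \<in> bergman_space"
  shows "(LINT w|dA. (cmod (h w - k w))\<^sup>2) =
    (LINT w|dA. (cmod (h w - bergman_proj h w))\<^sup>2) + (LINT w|dA. (cmod (bergman_proj h w - k w))\<^sup>2)"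
proof -
  have B: "bergman_proj h \<in> bergman_space" by (rule bergman_proj_props(1)[OF h])
  define e where "e w = k w - bergman_proj h w" for w
  have e: "e \<in> bergman_space" unfolding e_def by (rule bergman_diff[OF k B])
  have L: "bergman_proj h \<in> L2" "e \<in> L2" using B e by (auto simp: bergman_space_def)
  have "(LINT w|dA. (cmod ((h w - bergman_proj h w) - 1 * e w))\<^sup>2) =
     (LINT w|dA. (cmod (h w - bergman_proj h w))\<^sup>2) + (LINT w|dA. (cmod (e w))\<^sup>2)"
    by (subst L2_square_diff_scaled[OF L2_diff[OF h L(1)] L(2)]) (simp add: bergman_proj_props(2)[OF h e])
  then show ?thesis by (simp add: e_def norm_minus_commute)
qed

lemma L2_norm_bergman_proj_le:
  assumes h: "h \<in> L2"
  shows "L2_norm (bergman_proj h) \<le> L2_norm h"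
proof -
  have "(\<lambda>w. 0) \<in> bergman_space" by (simp add: bergman_space_def L2_def)
  from bergman_proj_pythagoras[OF h this]
  have "(LINT w|dA. (cmod (bergman_proj h w))\<^sup>2) \<le> (LINT w|dA. (cmod (h w))\<^sup>2)"
    using Bochner_Integration.integral_nonneg[of dA "\<lambda>w. (cmod (h w - bergman_proj h w))\<^sup>2"] by simp
  then show ?thesis by (simp add: L2_norm_def)
qed

text \<open>The residual is the distance to the Bergman space. For the Hankel operator the
  competitor \<open>k\<close> will be u(z) k_z.\<close>

lemma L2_norm_diff_bergman_proj_le:
  assumes h: "h \<in> L2" and k: "k \<in> bergman_space"
  shows "L2_norm (\<lambda>w. h w - bergman_proj h w) \<le> L2_norm (\<lambda>w. h w - k w)"
  using bergman_proj_pythagoras[OF h k] Bochner_Integration.integral_nonneg[of dA "\<lambda>w. (cmod (bergman_proj h w - k w))\<^sup>2"]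
  by (simp add: L2_norm_def)


section \<open>Boundary decay of the derivative\<close>

text \<open>Parseval is available only on circles of radius r < 1, where the mean of |F|^2 is at
  most \<open>C\<^sup>2\<close>. For finite sums the radius may tend to 1.\<close>

lemma Hinf_coeff_bound:
  assumes F: "\<And>w. w \<in> disc \<Longrightarrow> (\<lambda>n. c n * w ^ n) sums F w"
    and C: "\<And>w. w \<in> disc \<Longrightarrow> cmod (F w) \<le> C"
  shows "(\<Sum>n<N. (cmod (c n))\<^sup>2) \<le> C\<^sup>2"
proof -
  have le: "(\<Sum>n<N. (cmod (c n))\<^sup>2 * r ^ (2 * n)) \<le> C\<^sup>2" if r: "r < 1" "0 \<le> r" for r
  proof -
    have v: "complex_of_real r \<in> disc" using r by simp
    note P = circ_parseval[OF F v]
    have "(\<Sum>n<N. (cmod (c n))\<^sup>2 * r ^ (2 * n)) = (\<Sum>n<N. (cmod (c n))\<^sup>2 * (cmod (complex_of_real r)) ^ (2 * n))"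
      using r by simp
    also have "\<dots> \<le> integral\<^sup>L circ (\<lambda>t. (cmod (F (cis t * of_real r)))\<^sup>2) / (2 * pi)"
      using sum_le_suminf[OF sums_summable[OF P(2)], of "{..<N}"] sums_unique[OF P(2)] by simp
    also have "\<dots> \<le> integral\<^sup>L circ (\<lambda>t. C\<^sup>2) / (2 * pi)"
    proof (intro divide_right_mono integral_mono circ_integral(1) continuous_intros continuous_on_subset[OF P(1)])
      fix t
      have "cis t * of_real r \<in> disc" using r by (simp add: norm_mult)
      then show "(cmod (F (cis t * of_real r)))\<^sup>2 \<le> C\<^sup>2" by (intro power_mono C) auto
    qed auto
    also have "\<dots> = C\<^sup>2"
      by (subst circ_integral(2)) auto
    finally show ?thesis .
  qed
  have "((\<lambda>r. \<Sum>n<N. (cmod (c n))\<^sup>2 * r ^ (2 * n)) \<longlongrightarrow> (\<Sum>n<N. (cmod (c n))\<^sup>2 * 1 ^ (2 * n))) (at_left (1::real))"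
    by (intro tendsto_intros)
  moreover have "\<forall>\<^sub>F r in at_left (1::real). (\<Sum>n<N. (cmod (c n))\<^sup>2 * r ^ (2 * n)) \<le> C\<^sup>2"

    using eventually_at_left_real[OF zero_less_one] by (rule eventually_mono) (auto intro!: le)
  ultimately have "(\<Sum>n<N. (cmod (c n))\<^sup>2 * 1 ^ (2 * n)) \<le> C\<^sup>2"
    by (rule tendsto_upperbound) simp
  then show ?thesis by simp
qed

text \<open>The value is the difference pi / (n + 1) - pi / (n + 2) of consecutive moments. Since
  values lie in \<open>ennreal\<close>, the moment for \<open>Suc n\<close> is first added to both
  sides and then cancelled, being finite.\<close>

lemma disc_weighted_moment:
  "(\<integral>\<^sup>+v\<in>disc. ennreal ((cmod v) ^ (2 * n)) * ennreal (1 - (cmod v)\<^sup>2) \<partial>lborel) =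
    ennreal (pi / ((real n + 1) * (real n + 2)))"
proof -
  let ?W = "\<integral>\<^sup>+v\<in>disc. ennreal ((cmod v) ^ (2 * n)) * ennreal (1 - (cmod v)\<^sup>2) \<partial>lborel"
  have [measurable]: "disc \<in> sets borel" by simp
  have "?W + ennreal (pi / (real (Suc n) + 1)) = ?W + (\<integral>\<^sup>+v\<in>disc. ennreal ((cmod v) ^ (2 * Suc n)) \<partial>lborel)"
    by (simp only: disc_moment)
  also have "\<dots> = (\<integral>\<^sup>+v. ennreal ((cmod v) ^ (2 * n)) * ennreal (1 - (cmod v)\<^sup>2) * indicator disc v
      + ennreal ((cmod v) ^ (2 * Suc n)) * indicator disc v \<partial>lborel)"
    by (rule nn_integral_add[symmetric]) measurable
  also have "\<dots> = (\<integral>\<^sup>+v\<in>disc. ennreal ((cmod v) ^ (2 * n)) \<partial>lborel)"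
  proof (rule nn_integral_cong)
    fix v :: complex
    have "ennreal ((cmod v) ^ (2 * n)) * ennreal (1 - (cmod v)\<^sup>2) + ennreal ((cmod v) ^ (2 * Suc n)) =
       ennreal ((cmod v) ^ (2 * n))" if "cmod v < 1"
    proof -
      have "(cmod v)\<^sup>2 \<le> 1" using that by (simp add: power_le_one)
      then have "ennreal ((cmod v) ^ (2 * n)) * ennreal (1 - (cmod v)\<^sup>2) + ennreal ((cmod v) ^ (2 * Suc n)) =
        ennreal ((cmod v) ^ (2 * n) * (1 - (cmod v)\<^sup>2) + (cmod v) ^ (2 * Suc n))"
        by (subst ennreal_mult[symmetric], simp, simp, subst ennreal_plus[symmetric]) auto
      also have "(cmod v) ^ (2 * n) * (1 - (cmod v)\<^sup>2) + (cmod v) ^ (2 * Suc n) = (cmod v) ^ (2 * n)"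
        by (simp add: algebra_simps power2_eq_square)
      finally show ?thesis .
    qed
    then show "ennreal ((cmod v) ^ (2 * n)) * ennreal (1 - (cmod v)\<^sup>2) * indicator disc v
      + ennreal ((cmod v) ^ (2 * Suc n)) * indicator disc v = ennreal ((cmod v) ^ (2 * n)) * indicator disc v"
      by (auto simp: indicator_def)
  qed
  also have "\<dots> = ennreal (pi / (real n + 1))" by (rule disc_moment)
  finally have "?W + ennreal (pi / (real (Suc n) + 1)) - ennreal (pi / (real (Suc n) + 1)) =
     ennreal (pi / (real n + 1)) - ennreal (pi / (real (Suc n) + 1))" by simp
  then have "?W = ennreal (pi / (real n + 1)) - ennreal (pi / (real (Suc n) + 1))"
    by (simp only: ennreal_add_diff_cancel_right ennreal_neq_top not_False_eq_True)
  also have "\<dots> = ennreal (pi / (real n + 1) - pi / (real (Suc n) + 1))" by (rule ennreal_minus) simp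
  also have "pi / (real n + 1) - pi / (real (Suc n) + 1) = pi / ((real n + 1) * (real n + 2))"
    by (simp add: divide_simps) (simp add: algebra_simps)
  finally show ?thesis .
qed

text \<open>The coefficients (n + 1) c_(n+1) of the derivative meet the weighted moments pi / ((n +
  1) (n + 2)). Each term is then at most pi |c_(n+1)|^2, and the coefficients of f are square
  summable with sum at most \<open>C\<^sup>2\<close>.\<close>

lemma Hinf_Littlewood_Paley:
  assumes f: "f holomorphic_on disc" and C: "\<And>w. w \<in> disc \<Longrightarrow> cmod (f w) \<le> C"
  shows "(\<integral>\<^sup>+v\<in>disc. ennreal ((cmod (deriv f v))\<^sup>2) * ennreal (1 - (cmod v)\<^sup>2) \<partial>lborel) \<le> ennreal (pi * C\<^sup>2)"
proof -
  define c where "c n = (deriv ^^ n) f 0 / fact n" for n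
  have F: "(\<lambda>n. c n * w ^ n) sums f w" if "w \<in> disc" for w
    using holomorphic_power_series[OF f that] by (simp add: c_def)
  have df: "deriv f holomorphic_on disc" by (intro holomorphic_deriv f) auto
  have F': "(\<lambda>n. (of_nat (Suc n) * c (Suc n)) * w ^ n) sums deriv f w" if "w \<in> disc" for w
  proof -
    have "(deriv ^^ n) (deriv f) 0 / fact n = of_nat (Suc n) * c (Suc n)" for n
    proof -
      have "(deriv ^^ n) (deriv f) 0 = (deriv ^^ Suc n) f 0" by (simp only: funpow_Suc_right o_apply)
      moreover have "fact (Suc n) = (of_nat (Suc n) * fact n :: complex)" by (rule fact_Suc)
      moreover have "of_nat (Suc n) \<noteq> (0::complex)" by (simp del: of_nat_Suc)
      ultimately show ?thesis by (simp add: c_def del: of_nat_Suc)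
    qed
    then show ?thesis using holomorphic_power_series[OF df that] by simp
  qed
  have "(\<integral>\<^sup>+v\<in>disc. ennreal ((cmod (deriv f v))\<^sup>2) * ennreal (1 - (cmod v)\<^sup>2) \<partial>lborel) =
    (\<Sum>n. ennreal ((cmod (of_nat (Suc n) * c (Suc n)))\<^sup>2) * ennreal (pi / ((real n + 1) * (real n + 2))))"
    by (subst disc_parseval[OF F', of "\<lambda>r. ennreal (1 - r\<^sup>2)"]) (simp_all only: disc_weighted_moment, measurable)
  also have "\<dots> \<le> ennreal (pi * C\<^sup>2)"
  proof (rule suminf_le_const[OF summableI])
    fix N
    have "(\<Sum>n<N. ennreal ((cmod (of_nat (Suc n) * c (Suc n)))\<^sup>2) * ennreal (pi / ((real n + 1) * (real n + 2)))) \<le>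
        (\<Sum>n<N. ennreal (pi * (cmod (c (Suc n)))\<^sup>2))"
    proof (rule sum_mono)
      fix n
      have "cmod (of_nat (Suc n) * c (Suc n)) = (real n + 1) * cmod (c (Suc n))"
        using norm_of_nat[of "Suc n", where 'a = complex] by (simp add: norm_mult del: of_nat_Suc)
      then have "(cmod (of_nat (Suc n) * c (Suc n)))\<^sup>2 * (pi / ((real n + 1) * (real n + 2))) =
          (pi * (cmod (c (Suc n)))\<^sup>2) * ((real n + 1) / (real n + 2))"
        by (simp add: power2_eq_square power_mult_distrib)
      also have "\<dots> \<le> pi * (cmod (c (Suc n)))\<^sup>2 * 1"
        by (intro mult_left_mono) auto
      finally show "ennreal ((cmod (of_nat (Suc n) * c (Suc n)))\<^sup>2) * ennreal (pi / ((real n + 1) * (real n + 2))) \<le>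
         ennreal (pi * (cmod (c (Suc n)))\<^sup>2)"
        by (subst ennreal_mult[symmetric]) (auto intro!: ennreal_leI)
    qed
    also have "\<dots> = ennreal (\<Sum>n<N. pi * (cmod (c (Suc n)))\<^sup>2)" by (rule sum_ennreal) simp
    also have "\<dots> \<le> ennreal (pi * C\<^sup>2)"
    proof (rule ennreal_leI)
      have "(\<Sum>n<N. (cmod (c (Suc n)))\<^sup>2) \<le> (\<Sum>n<Suc N. (cmod (c n))\<^sup>2)"
        by (subst sum.lessThan_Suc_shift) simp
      also have "\<dots> \<le> C\<^sup>2" by (rule Hinf_coeff_bound[OF F C])
      finally show "(\<Sum>n<N. pi * (cmod (c (Suc n)))\<^sup>2) \<le> pi * C\<^sup>2"
        by (simp add: sum_distrib_left[symmetric])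
    qed
    finally show "(\<Sum>n<N. ennreal ((cmod (of_nat (Suc n) * c (Suc n)))\<^sup>2) * ennreal (pi / ((real n + 1) * (real n + 2))))
      \<le> ennreal (pi * C\<^sup>2)" .
  qed
  finally show ?thesis .
qed

section \<open>Arc length of the part of the circle near a point\<close>

text \<open>A crude linear minorant, used to pass from chords to parameters. Up to pi / 3 the slope
  is at least 1 / 2; beyond it sin x \<ge> sqrt 3 / 2 \<ge> 2 / 3, while x / 3 < 2 / 3.\<close>

lemma sin_ge_third:
  assumes "0 \<le> x" "x \<le> pi / 2"
  shows "x / 3 \<le> sin x"
proof (cases "x \<le> pi / 3")
  case True
  show ?thesis
  proof (cases "x = 0")
    case False
    then have "\<exists>z. 0 < z \<and> z < x \<and> sin x - sin 0 = (x - 0) * cos z"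
      using assms by (intro MVT2) auto
    then obtain z where z: "0 < z" "z < x" "sin x = x * cos z" by auto
    have "cos (pi / 3) \<le> cos z" using z True by (intro cos_monotone_0_pi_le) auto
    then have "1 / 3 \<le> cos z" by (simp add: cos_60)
    then have "x * (1 / 3) \<le> x * cos z" using assms by (intro mult_left_mono) auto
    then show ?thesis using z by simp
  qed simp
next
  case False
  have "sin (pi / 3) \<le> sin x" using False assms by (intro sin_monotone_2pi_le) auto
  moreover have "4 / 3 \<le> sqrt 3" by (rule real_le_rsqrt) (simp add: power2_eq_square)
  ultimately have "2 / 3 \<le> sin x" by (simp add: sin_60)
  then show ?thesis using assms pi_less_4 by linarith
qed

lemma dist_cis: "cmod (cis t - cis s) = 2 * \<bar>sin ((t - s) / 2)\<bar>"
proof -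
  have half: "2 * ((t - s) / 2) = t - s" by simp
  have "(cmod (cis t - cis s))\<^sup>2 = 2 - 2 * cos (t - s)"
    by (simp add: cmod_power2 cos_diff power2_diff sin_squared_eq algebra_simps)
  also have "\<dots> = 2 - 2 * cos (2 * ((t - s) / 2))"
    by (simp only: half)
  also have "\<dots> = (2 * \<bar>sin ((t - s) / 2)\<bar>)\<^sup>2" by (subst cos_double_sin) (simp add: power_mult_distrib)
  finally show ?thesis by (subst (asm) power2_eq_iff_nonneg) auto
qed

text \<open>The chord is 2 sin x with x half the parameter distance. If x \<le> pi / 2, the
  parameters differ by less than 6 \<delta>. Otherwise \<open>s\<close> and \<open>t\<close> lie
  near opposite ends of the interval, the cut at the point 1, and the two end intervals catch
  \<open>t\<close>.\<close>

lemma arc_cover: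
  assumes st: "s \<in> {0..<2*pi}" "t \<in> {0..<2*pi}" and d: "cmod (cis t - cis s) < 2 * \<delta>"
  shows "t \<in> {s - 6 * \<delta>..s + 6 * \<delta>} \<union> {0..6 * \<delta>} \<union> {2 * pi - 6 * \<delta>..2 * pi}"
proof -
  define x where "x = \<bar>t - s\<bar> / 2"
  have x: "0 \<le> x" "x < pi" using st by (auto simp: x_def)
  have "\<bar>sin ((t - s) / 2)\<bar> = sin x"
  proof -
    have "(t - s) / 2 = x \<or> (t - s) / 2 = - x" by (auto simp: x_def abs_if)
    then have "\<bar>sin ((t - s) / 2)\<bar> = \<bar>sin x\<bar>" by (elim disjE) simp_all
    then show ?thesis using sin_ge_zero[of x] x by simp
  qed
  then have sx: "sin x < \<delta>" using d by (simp add: dist_cis)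
  show ?thesis
  proof (cases "x \<le> pi / 2")
    case True
    then have "x / 3 < \<delta>" using sin_ge_third[of x] x sx by simp
    then show ?thesis by (auto simp: x_def)
  next
    case False
    then have "(pi - x) / 3 < \<delta>" using sin_ge_third[of "pi - x"] x sx by simp
    then have "2 * pi - 6 * \<delta> < \<bar>t - s\<bar>" by (simp add: x_def)
    then show ?thesis using st by (auto simp: abs_if split: if_splits)
  qed
qed

lemma space_arc [simp]: "space arc_length = sphere 0 1"
  by (simp add: arc_length_def space_restrict_space)

lemma sets_arc [measurable_cong]: "sets arc_length = sets (restrict_space borel (sphere 0 1))"
  by (simp add: arc_length_def)

text \<open>\<open>w\<close> need not lie on the circle. Once some \<open>cis s\<close> is within
  \<delta> of \<open>w\<close>, every other point of the set is within 2 \<delta> of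
  \<open>cis s\<close>. The constant is the total length 12 + 6 + 6 of the three covering intervals,
  in units of \<delta>.\<close>

lemma emeasure_arc_le:
  assumes "\<delta> > 0"
  shows "emeasure arc_length {\<zeta> \<in> sphere 0 1. cmod (w - \<zeta>) < \<delta>} \<le> ennreal (24 * \<delta>)"
proof -
  let ?A = "{\<zeta> \<in> sphere 0 1. cmod (w - \<zeta>) < \<delta>}"
  let ?T = "{t \<in> {0..<2*pi}. cmod (w - cis t) < \<delta>}"
  have "?A \<in> sets (restrict_space borel (sphere 0 1))"
  proof -
    have "?A = sphere 0 1 \<inter> ball w \<delta>" by (auto simp: dist_norm)
    then show ?thesis by (simp add: sets_restrict_space_iff)
  qed
  then have "emeasure arc_length ?A = emeasure (lebesgue_on {0..<2*pi}) (cis -` ?A \<inter> space (lebesgue_on {0..<2*pi}))"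
    unfolding arc_length_def by (intro emeasure_distr measurable_cis_arc)
  also have "cis -` ?A \<inter> space (lebesgue_on {0..<2*pi}) = ?T" by (auto simp: space_restrict_space)
  also have "emeasure (lebesgue_on {0..<2*pi}) ?T = emeasure lebesgue ?T"
    by (rule emeasure_restrict_space) auto
  also have "\<dots> \<le> ennreal (24 * \<delta>)"
  proof (cases "?T = {}")
    case False
    then obtain s where s: "s \<in> {0..<2*pi}" "cmod (w - cis s) < \<delta>" by auto
    let ?I = "{s - 6 * \<delta>..s + 6 * \<delta>}" and ?J = "{0..6 * \<delta>}" and ?K = "{2 * pi - 6 * \<delta>..2 * pi}"
    have "?T \<subseteq> ?I \<union> ?J \<union> ?K"
    proof
      fix t assume t: "t \<in> ?T"
      have "cmod (cis t - cis s) < 2 * \<delta>"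
        using norm_triangle_ineq4[of "w - cis s" "w - cis t"] s t by simp
      then show "t \<in> ?I \<union> ?J \<union> ?K" using arc_cover[of s t \<delta>] s t by blast
    qed
    then have "emeasure lebesgue ?T \<le> emeasure lebesgue (?I \<union> ?J \<union> ?K)"
      by (rule emeasure_mono) auto
    also have "\<dots> \<le> emeasure lebesgue ?I + emeasure lebesgue ?J + emeasure lebesgue ?K"
      by (intro order_trans[OF emeasure_subadditive] add_right_mono) auto
    also have "\<dots> = ennreal (12 * \<delta> + 6 * \<delta> + 6 * \<delta>)"
      using assms by (simp flip: ennreal_plus)
    finally show ?thesis by simp
  qed (simp only: emeasure_empty, simp)
  finally show ?thesis .
qed

lemma finite_measure_arc: "finite_measure arc_length"
proof (rule finite_measureI)
  have "emeasure arc_length (space arc_length) = emeasure (lebesgue_on {0..<2*pi}) (space (lebesgue_on {0..<2*pi}))"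
    unfolding arc_length_def
    by (subst emeasure_distr[OF measurable_cis_arc])
       (auto simp: space_restrict_space sets_restrict_space_iff intro!: arg_cong[where f = "emeasure _"])
  also have "\<dots> \<noteq> \<infinity>" by (simp add: space_restrict_space emeasure_restrict_space)
  finally show "emeasure arc_length (space arc_length) \<noteq> \<infinity>" .
qed

interpretation arc: finite_measure arc_length by (rule finite_measure_arc)

section \<open>Cone integrals and decay of the derivative\<close>

text \<open>The points \<zeta> whose cone contains a given w lie within \<beta> (1 - |w|) of w, a
  set of arc length at most 24 \<beta> (1 - |w|). Integrating over \<zeta> first thus produces the
  Littlewood--Paley weight, because 1 - |w| \<le> 1 - |w|^2.\<close>

lemma Hinf_area_integral_finite:
  assumes f: "f holomorphic_on disc" and C: "\<And>w. w \<in> disc \<Longrightarrow> cmod (f w) \<le> C" and b: "\<beta> > 0"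
  shows "AE \<zeta> in arc_length. (\<integral>\<^sup>+w\<in>nontangential_region \<beta> \<zeta>. ennreal ((cmod (deriv f w))\<^sup>2) \<partial>lborel) < \<infinity>"
proof -
  define g where "g w = ennreal ((cmod (deriv f w))\<^sup>2) * indicator disc w" for w
  have "continuous_on disc (deriv f)"
    by (intro holomorphic_on_imp_continuous_on holomorphic_deriv f) auto
  then have g[measurable]: "g \<in> borel_measurable borel"
    unfolding g_def by (intro borel_measurable_norm_square_indicator) auto
  \<comment> \<open>The cone condition is written as a set of pairs so that the integrand is jointly
    measurable; the condition that \<open>w\<close> lies in the disc sits in
    \<open>g\<close>.\<close>
  define \<Phi> where "\<Phi> \<zeta> = (\<integral>\<^sup>+w. g w * indicator {p. cmod (fst p - snd p) < \<beta> * (1 - cmod (fst p))} (w, \<zeta>) \<partial>lborel)" for \<zeta>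
  have [measurable]: "(\<lambda>x. x) \<in> borel_measurable arc_length"
    by (subst measurable_cong_sets[OF sets_arc refl]) (rule measurable_restrict_space1, simp)
  interpret p: pair_sigma_finite "lborel :: complex measure" arc_length ..
  have m: "(\<lambda>(w, \<zeta>). g w * indicator {p. cmod (fst p - snd p) < \<beta> * (1 - cmod (fst p))} (w, \<zeta>)) \<in> borel_measurable (lborel \<Otimes>\<^sub>M arc_length)"
    unfolding indicator_def mem_Collect_eq fst_conv snd_conv by measurable
  have "(\<integral>\<^sup>+\<zeta>. \<Phi> \<zeta> \<partial>arc_length) = (\<integral>\<^sup>+w. \<integral>\<^sup>+\<zeta>. g w * indicator {p. cmod (fst p - snd p) < \<beta> * (1 - cmod (fst p))} (w, \<zeta>) \<partial>arc_length \<partial>lborel)"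
    unfolding \<Phi>_def by (rule p.Fubini'[OF m])
  also have "\<dots> \<le> (\<integral>\<^sup>+w. ennreal (24 * \<beta>) * (ennreal ((cmod (deriv f w))\<^sup>2) * ennreal (1 - (cmod w)\<^sup>2) * indicator disc w) \<partial>lborel)"
  proof (rule nn_integral_mono)
    fix w :: complex
    show "(\<integral>\<^sup>+\<zeta>. g w * indicator {p. cmod (fst p - snd p) < \<beta> * (1 - cmod (fst p))} (w, \<zeta>) \<partial>arc_length) \<le>
      ennreal (24 * \<beta>) * (ennreal ((cmod (deriv f w))\<^sup>2) * ennreal (1 - (cmod w)\<^sup>2) * indicator disc w)"
    proof (cases "w \<in> disc")
      case True
      then have w1: "cmod w < 1" by simp
      have set: "{\<zeta> \<in> sphere 0 1. cmod (w - \<zeta>) < \<beta> * (1 - cmod w)} \<in> sets arc_length"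
      proof -
        have "{\<zeta> \<in> sphere 0 1. cmod (w - \<zeta>) < \<beta> * (1 - cmod w)} = sphere 0 1 \<inter> ball w (\<beta> * (1 - cmod w))"
          by (auto simp: dist_norm)
        then show ?thesis by (simp add: sets_arc sets_restrict_space_iff)
      qed
      have "(\<integral>\<^sup>+\<zeta>. g w * indicator {p. cmod (fst p - snd p) < \<beta> * (1 - cmod (fst p))} (w, \<zeta>) \<partial>arc_length) =
          (\<integral>\<^sup>+\<zeta>. g w * indicator {\<zeta> \<in> sphere 0 1. cmod (w - \<zeta>) < \<beta> * (1 - cmod w)} \<zeta> \<partial>arc_length)"
        by (intro nn_integral_cong) (auto simp: indicator_def)
      also have "\<dots> = g w * emeasure arc_length {\<zeta> \<in> sphere 0 1. cmod (w - \<zeta>) < \<beta> * (1 - cmod w)}"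
        by (rule nn_integral_cmult_indicator[OF set])
      also have "\<dots> \<le> g w * ennreal (24 * (\<beta> * (1 - cmod w)))"
        using w1 b by (intro mult_left_mono emeasure_arc_le) auto
      also have "\<dots> \<le> g w * (ennreal (24 * \<beta>) * ennreal (1 - (cmod w)\<^sup>2))"
      proof (rule mult_left_mono)
        have "(cmod w)\<^sup>2 \<le> cmod w" using w1 by (simp add: power2_eq_square mult_left_le)
        then have "24 * (\<beta> * (1 - cmod w)) \<le> (24 * \<beta>) * (1 - (cmod w)\<^sup>2)"
          using b by simp
        then show "ennreal (24 * (\<beta> * (1 - cmod w))) \<le> ennreal (24 * \<beta>) * ennreal (1 - (cmod w)\<^sup>2)"
          using b by (subst ennreal_mult'[symmetric]) (auto intro!: ennreal_leI)
      qed simp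
      finally show ?thesis using True by (simp add: g_def mult_ac)
    next
      case False
      then show ?thesis by (simp add: g_def)
    qed
  qed
  also have "\<dots> = ennreal (24 * \<beta>) * (\<integral>\<^sup>+w\<in>disc. ennreal ((cmod (deriv f w))\<^sup>2) * ennreal (1 - (cmod w)\<^sup>2) \<partial>lborel)"
  proof -
    have "(\<lambda>w. g w * ennreal (1 - (cmod w)\<^sup>2)) \<in> borel_measurable borel" by measurable
    then have "(\<lambda>w. ennreal ((cmod (deriv f w))\<^sup>2) * ennreal (1 - (cmod w)\<^sup>2) * indicator disc w) \<in> borel_measurable borel"
      unfolding g_def by (simp only: mult_ac)
    then show ?thesis by (intro nn_integral_cmult) simp
  qed
  also have "\<dots> \<le> ennreal (24 * \<beta>) * ennreal (pi * C\<^sup>2)"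
    by (intro mult_left_mono Hinf_Littlewood_Paley f C) auto
  also have "\<dots> < \<infinity>" by (simp add: ennreal_mult_less_top)
  finally have fin: "(\<integral>\<^sup>+\<zeta>. \<Phi> \<zeta> \<partial>arc_length) \<noteq> \<infinity>" by simp
  have "\<Phi> \<in> borel_measurable arc_length"
    unfolding \<Phi>_def using m by (intro lborel.borel_measurable_nn_integral) (simp add: split_beta')
  then have "AE \<zeta> in arc_length. \<Phi> \<zeta> \<noteq> \<infinity>" by (rule nn_integral_PInf_AE[OF _ fin])
  moreover have "\<Phi> \<zeta> = (\<integral>\<^sup>+w\<in>nontangential_region \<beta> \<zeta>. ennreal ((cmod (deriv f w))\<^sup>2) \<partial>lborel)" for \<zeta>
    unfolding \<Phi>_def g_def nontangential_region_def by (intro nn_integral_cong) (auto simp: indicator_def)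
  ultimately show ?thesis by (simp add: less_top)
qed

text \<open>The ball about z of radius (1 - |z|) / 2 lies in a wider cone and, as z nears \<zeta>,
  in a thin annulus at the boundary. The part of a finite cone integral over such an annulus tends
  to 0.\<close>

lemma nontangential_deriv_decay:
  assumes f: "f holomorphic_on disc" and z1: "cmod \<zeta> = 1"
    and fin: "\<And>n::nat. (\<integral>\<^sup>+w\<in>nontangential_region (real n) \<zeta>. ennreal ((cmod (deriv f w))\<^sup>2) \<partial>lborel) < \<infinity>"
    and a: "\<alpha> > 0"
  shows "((\<lambda>z. (1 - cmod z) * cmod (deriv f z)) \<longlongrightarrow> 0) (at \<zeta> within nontangential_region \<alpha> \<zeta>)"
proof -
  \<comment> \<open>With r = (1 - |z|) / 2, points w of the ball satisfy |w - \<zeta>| < r + 2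
    \<alpha> r and 1 - |w| > r, so the aperture 2 \<alpha> + 1 suffices.\<close>
  obtain n :: nat where n: "2 * \<alpha> + 1 \<le> real n" using real_arch_simple by blast
  let ?\<Gamma> = "nontangential_region (real n) \<zeta>"
  have df: "deriv f holomorphic_on disc" by (intro holomorphic_deriv f) auto
  have \<Gamma>: "?\<Gamma> \<in> sets borel"
  proof -
    have "open (disc \<inter> {z. cmod (z - \<zeta>) < real n * (1 - cmod z)})"
      by (intro open_Int open_Collect_less continuous_intros) auto
    moreover have "disc \<inter> {z. cmod (z - \<zeta>) < real n * (1 - cmod z)} = ?\<Gamma>" by (auto simp: nontangential_region_def)
    ultimately show ?thesis by auto
  qed
  \<comment> \<open>The disc indicator is implied by the cone; it is kept for measurability, as
    \<open>deriv f\<close> is controlled on the disc only.\<close>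
  define g where "g w = ennreal ((cmod (deriv f w))\<^sup>2) * indicator disc w * indicator ?\<Gamma> w" for w
  have [measurable]: "g \<in> borel_measurable borel"
    unfolding g_def using \<Gamma> df
    by (intro borel_measurable_times_ennreal borel_measurable_norm_square_indicator borel_measurable_indicator
        holomorphic_on_imp_continuous_on) auto
  have g_eq: "g w = ennreal ((cmod (deriv f w))\<^sup>2) * indicator ?\<Gamma> w" for w
    by (auto simp: g_def indicator_def nontangential_region_def)
  \<comment> \<open>As a finite measure, the cone integral is continuous from above along the annuli
    \<open>A k\<close>, whose intersection is empty.\<close>
  define \<nu> where "\<nu> = density lborel g"
  define A where "A k = {w \<in> disc. 1 - cmod w \<le> inverse (real (Suc k))}" for k
  have A_borel: "A k \<in> sets borel" for k
  proof -
    have "A k = disc \<inter> {w. 1 - cmod w \<le> inverse (real (Suc k))}" by (auto simp: A_def)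
    moreover have "closed {w::complex. 1 - cmod w \<le> inverse (real (Suc k))}"
      by (intro closed_Collect_le continuous_intros)
    ultimately show ?thesis by auto
  qed
  have \<nu>: "emeasure \<nu> B = (\<integral>\<^sup>+w. g w * indicator B w \<partial>lborel)" if "B \<in> sets borel" for B
    unfolding \<nu>_def using that by (subst emeasure_density) auto
  have "(\<lambda>k. emeasure \<nu> (A k)) \<longlonglongrightarrow> emeasure \<nu> (\<Inter>k. A k)"
  proof (rule Lim_emeasure_decseq)
    show "range A \<subseteq> sets \<nu>" using A_borel by (auto simp: \<nu>_def)
    show "decseq A"
      by (intro decseq_SucI) (auto simp: A_def intro: order_trans[OF _ le_imp_inverse_le])
    fix k
    have "emeasure \<nu> (A k) \<le> (\<integral>\<^sup>+w. g w \<partial>lborel)"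
      unfolding \<nu>[OF A_borel] by (intro nn_integral_mono) (auto simp: indicator_def)
    also have "\<dots> < \<infinity>" using fin[of n] by (simp add: g_eq)
    finally show "emeasure \<nu> (A k) \<noteq> \<infinity>" by simp
  qed
  moreover have "(\<Inter>k. A k) = {}"
  proof -
    have "\<exists>k. w \<notin> A k" for w
    proof (cases "w \<in> disc")
      case True
      then have "0 < 1 - cmod w" by simp
      then obtain k where "inverse (real (Suc k)) < 1 - cmod w" using reals_Archimedean by blast
      then show ?thesis by (auto simp: A_def not_le)
    qed (auto simp: A_def)
    then show ?thesis by blast
  qed
  ultimately have lim0: "(\<lambda>k. emeasure \<nu> (A k)) \<longlonglongrightarrow> 0" by simp
  show ?thesis
  proof (rule tendstoI)
    fix e :: real assume e: "e > 0"
    \<comment> \<open>The ball used below has area pi (1 - |z|)^2 / 4.\<close>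
    define e' where "e' = pi * e\<^sup>2 / 4"
    have "e' > 0" using e by (simp add: e'_def)
    then have "0 < ennreal e'" by simp
    then obtain k where k: "emeasure \<nu> (A k) < ennreal e'"
      using order_tendstoD(2)[OF lim0, of "ennreal e'"] eventually_happens'[OF sequentially_bot] by blast
    \<comment> \<open>On the ball, 1 - |w| < 3 r = (3/2) (1 - |z|), and 1 - |z| \<le> |z - \<zeta>|;
      the factor 2/3 therefore puts the ball into \<open>A k\<close>.\<close>
    define d where "d = 2 / 3 * inverse (real (Suc k))"
    have d: "d > 0" by (simp add: d_def)
    have main: "(1 - cmod z) * cmod (deriv f z) < e"
      if z: "z \<in> nontangential_region \<alpha> \<zeta>" and zd: "cmod (z - \<zeta>) < d" for z
    proof -
      define r where "r = (1 - cmod z) / 2"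
      have zz: "cmod z < 1" "cmod (z - \<zeta>) < \<alpha> * (1 - cmod z)" using z by (auto simp: nontangential_region_def)
      have r: "r > 0" using zz by (simp add: r_def)
      have "1 - cmod z \<le> cmod (z - \<zeta>)" using norm_triangle_ineq2[of \<zeta> z] z1 by (simp add: norm_minus_commute)
      then have rd: "3 / 2 * (1 - cmod z) \<le> inverse (real (Suc k))" using zd by (simp add: d_def)
      have z_r: "1 - cmod z = 2 * r" by (simp add: r_def)
      then have rd3: "3 * r \<le> inverse (real (Suc k))" using rd by simp
      have ball: "w \<in> A k \<and> w \<in> ?\<Gamma> \<and> w \<in> disc" if w: "w \<in> ball z r" for w
      proof -
        have wz: "cmod (w - z) < r" using w by (simp add: dist_norm norm_minus_commute)
        have "cmod w \<le> cmod z + cmod (w - z)" using norm_triangle_ineq[of z "w - z"] by simp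
        then have 1: "r < 1 - cmod w" using wz by (simp add: r_def field_simps)
        have "cmod z \<le> cmod w + cmod (w - z)" using norm_triangle_ineq4[of w "w - z"] by simp
        then have 2: "1 - cmod w \<le> inverse (real (Suc k))" using wz rd3 z_r by linarith
        have "cmod (w - \<zeta>) \<le> cmod (w - z) + cmod (z - \<zeta>)" using norm_triangle_ineq[of "w - z" "z - \<zeta>"] by simp
        also have "\<dots> < r + \<alpha> * (2 * r)" using wz zz(2) unfolding z_r by linarith
        also have "\<dots> = (2 * \<alpha> + 1) * r" by (simp add: algebra_simps)
        also have "\<dots> \<le> real n * (1 - cmod w)" using n 1 r a by (intro mult_mono) auto
        finally show ?thesis using 1 2 r by (simp add: A_def nontangential_region_def)
      qed
      have "ennreal (pi * r\<^sup>2 * (cmod (deriv f z))\<^sup>2) \<le> (\<integral>\<^sup>+v\<in>ball z r. ennreal ((cmod (deriv f v))\<^sup>2) \<partial>lborel)"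
        using ball by (intro holomorphic_local_bound holomorphic_on_subset[OF df] r) auto
      also have "\<dots> \<le> emeasure \<nu> (A k)"
        unfolding \<nu>[OF A_borel] g_eq using ball by (intro nn_integral_mono) (auto simp: indicator_def)
      also have "\<dots> < ennreal e'" by (rule k)
      finally have "pi * r\<^sup>2 * (cmod (deriv f z))\<^sup>2 < e'" by (subst (asm) ennreal_less_iff) auto
      then have "((1 - cmod z) * cmod (deriv f z))\<^sup>2 < e\<^sup>2"
        by (simp add: e'_def r_def power_mult_distrib power_divide)
      then show ?thesis using e power2_less_imp_less by (metis less_imp_le)
    qed
    have "\<forall>\<^sub>F z in at \<zeta> within nontangential_region \<alpha> \<zeta>. z \<in> nontangential_region \<alpha> \<zeta> \<and> cmod (z - \<zeta>) < d"
      unfolding eventually_at using d by (auto simp: dist_norm)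
    then show "\<forall>\<^sub>F z in at \<zeta> within nontangential_region \<alpha> \<zeta>. dist ((1 - cmod z) * cmod (deriv f z)) 0 < e"
    proof eventually_elim
      case (elim z)
      then have "0 \<le> 1 - cmod z" by (simp add: nontangential_region_def)
      then show ?case using main[of z] elim by (simp add: dist_norm abs_mult)
    qed
  qed
qed

text \<open>The aperture is quantified inside the almost-everywhere statement. This is possible
  because every \<open>\<alpha>\<close> is served by the integer apertures, hence by one countable
  union of null sets.\<close>

lemma Hinf_deriv_decay:
  assumes "f \<in> Hinf"
  shows "AE \<zeta> in arc_length. \<forall>\<alpha>>0.
    ((\<lambda>z. (1 - cmod z) * cmod (deriv f z)) \<longlongrightarrow> 0) (at \<zeta> within nontangential_region \<alpha> \<zeta>)"
proof -
  have f: "f holomorphic_on disc" using assms by (simp add: Hinf_def)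
  obtain C where C: "\<And>w. w \<in> disc \<Longrightarrow> cmod (f w) \<le> C" using bounded_discE[of f] assms by (auto simp: Hinf_def)
  have "AE \<zeta> in arc_length. (\<integral>\<^sup>+w\<in>nontangential_region (real n) \<zeta>. ennreal ((cmod (deriv f w))\<^sup>2) \<partial>lborel) < \<infinity>" for n
  proof (cases "n = 0")
    case True
    then show ?thesis by (simp add: nontangential_region_def)
  next
    case False
    then show ?thesis by (intro Hinf_area_integral_finite[OF f C]) auto
  qed
  then have "AE \<zeta> in arc_length. \<forall>n. (\<integral>\<^sup>+w\<in>nontangential_region (real n) \<zeta>. ennreal ((cmod (deriv f w))\<^sup>2) \<partial>lborel) < \<infinity>"
    by (subst AE_all_countable) blast
  then show ?thesis
    using AE_space
  proof eventually_elim
    case (elim \<zeta>)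
    then show ?case by (intro allI impI nontangential_deriv_decay[OF f]) auto
  qed
qed


section \<open>The kernel on pseudohyperbolic discs\<close>

text \<open>
  The pseudohyperbolic disc \<open>{w. |w - z| < R |1 - cnj z w|}\<close>, given by its Euclidean centre and radius.
\<close>

definition pdisc :: "real \<Rightarrow> complex \<Rightarrow> complex set" where
  "pdisc R z = ball (of_real ((1 - R\<^sup>2) / (1 - R\<^sup>2 * (cmod z)\<^sup>2)) * z)
     (R * (1 - (cmod z)\<^sup>2) / (1 - R\<^sup>2 * (cmod z)\<^sup>2))"

lemma kernel_denominator:
  assumes "z \<in> disc" "w \<in> disc"
  shows "1 - cnj z * w \<noteq> 0"
proof
  assume "1 - cnj z * w = 0"
  then have "cmod (cnj z * w) = 1" by simp
  moreover have "cmod z * cmod w < 1"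
    using assms mult_strict_mono'[of "cmod z" 1 "cmod w" 1] by simp
  ultimately show False by (simp add: norm_mult)
qed

lemma borel_measurable_bergman_kernel [measurable]: "bergman_kernel z \<in> borel_measurable borel"
  unfolding bergman_kernel_def by measurable

lemma bergman_kernel_holomorphic: "z \<in> disc \<Longrightarrow> bergman_kernel z holomorphic_on disc"
  unfolding bergman_kernel_def using kernel_denominator by (intro holomorphic_intros) auto

lemma pdisc_denominator:
  assumes "0 < R" "R \<le> 1" "z \<in> disc"
  shows "1 - R\<^sup>2 * (cmod z)\<^sup>2 > 0"
proof -
  have "(cmod z)\<^sup>2 < 1" using assms by (simp add: abs_square_less_1)
  moreover have "R\<^sup>2 \<le> 1" using assms by (simp add: power_le_one)
  ultimately show ?thesis
    using mult_right_mono[of "R\<^sup>2" 1 "(cmod z)\<^sup>2"] by simp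
qed

text \<open>
  The affine map of the unit disc onto \<open>pdisc R z\<close> takes the kernel at \<open>z\<close> to a multiple of the kernel
  at \<open>R z\<close>.
\<close>

lemma kernel_integral_pdisc:
  assumes R: "0 < R" "R \<le> 1" and z: "z \<in> disc"
  shows "(\<integral>\<^sup>+w\<in>pdisc R z. ennreal ((cmod (bergman_kernel z w))\<^sup>2) \<partial>lborel) = ennreal (pi * R\<^sup>2)"
proof -
  define D where "D = 1 - R\<^sup>2 * (cmod z)\<^sup>2"
  define A where "A = (1 - (cmod z)\<^sup>2) / D"
  define c where "c = of_real ((1 - R\<^sup>2) / D) * z"
  have D: "D > 0" unfolding D_def by (rule pdisc_denominator[OF R z])
  have z2: "(cmod z)\<^sup>2 < 1" using z by (simp add: abs_square_less_1)
  have A: "A > 0" using D z2 by (simp add: A_def)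
  have RA: "R * A > 0" using R A by simp
  have AD: "1 - (cmod z)\<^sup>2 = A * D" using D by (simp add: A_def)
  have P: "pdisc R z = ball c (R * A)" by (simp add: pdisc_def c_def A_def D_def)
  \<comment> \<open>\<open>A\<close> is both the radius of \<open>pdisc R z\<close> divided by
    \<open>R\<close> and the kernel denominator at the centre; this is why the kernel rescales to a
    kernel at R z.\<close>
  have zc: "1 - cnj z * c = of_real A"
  proof -
    have "cnj z * c = of_real ((1 - R\<^sup>2) / D * (cmod z)\<^sup>2)"
      unfolding c_def using complex_norm_square[of z] by (simp add: mult_ac)
    moreover have "1 - (1 - R\<^sup>2) / D * (cmod z)\<^sup>2 = A"
      using D unfolding A_def by (simp add: field_simps) (simp add: D_def algebra_simps)
    ultimately show ?thesis by (metis of_real_1 of_real_diff)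
  qed
  have bk: "(cmod (bergman_kernel z (c + of_real (R * A) * v)))\<^sup>2 = (D / A)\<^sup>2 * (cmod (1 / (1 - (of_real R * cnj z) * v)\<^sup>2))\<^sup>2" for v
  proof -
    have "1 - cnj z * (c + of_real (R * A) * v) = of_real A * (1 - (of_real R * cnj z) * v)"
      using zc by (simp add: algebra_simps)
    then have "bergman_kernel z (c + of_real (R * A) * v) = of_real (D / A) * (1 / (1 - (of_real R * cnj z) * v)\<^sup>2)"
      unfolding bergman_kernel_def AD using A by (simp add: power_mult_distrib power2_eq_square)
    then show ?thesis using A D by (simp add: norm_mult power_mult_distrib norm_divide power_divide)
  qed
  have m: "(\<lambda>w. ennreal ((cmod (bergman_kernel z w))\<^sup>2) * indicator (ball c (R * A)) w) \<in> borel_measurable borel"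
    by measurable simp
  have ind: "indicator (ball c (R * A)) (c + of_real (R * A) * v) = (indicator disc v :: ennreal)" for v
    using RA R A by (simp add: indicator_def dist_norm norm_mult)
  have b: "cmod (of_real R * cnj z) < 1"
    using R z mult_right_mono[of R 1 "cmod z"] by (simp add: norm_mult)
  have "(\<integral>\<^sup>+w\<in>pdisc R z. ennreal ((cmod (bergman_kernel z w))\<^sup>2) \<partial>lborel) =
     ennreal ((R * A)\<^sup>2) * (\<integral>\<^sup>+v. ennreal ((D / A)\<^sup>2 * (cmod (1 / (1 - (of_real R * cnj z) * v)\<^sup>2))\<^sup>2) * indicator disc v \<partial>lborel)"
    unfolding P by (subst nn_integral_affine_complex[OF RA m, of c]) (simp only: bk ind)
  also have "(\<integral>\<^sup>+v. ennreal ((D / A)\<^sup>2 * (cmod (1 / (1 - (of_real R * cnj z) * v)\<^sup>2))\<^sup>2) * indicator disc v \<partial>lborel) =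
     ennreal ((D / A)\<^sup>2) * ennreal (pi / (1 - (cmod (of_real R * cnj z))\<^sup>2)\<^sup>2)"
  proof -
    have "(\<lambda>v. ennreal ((cmod (1 / (1 - (of_real R * cnj z) * v)\<^sup>2))\<^sup>2) * indicator disc v) \<in> borel_measurable borel"
      by measurable simp
    then show ?thesis
      by (simp only: disc_kernel_integral[OF b, symmetric] ennreal_mult''[OF zero_le_power2] mult.assoc)
        (rule nn_integral_cmult, simp)
  qed
  also have "1 - (cmod (of_real R * cnj z))\<^sup>2 = D" using R by (simp add: D_def norm_mult power_mult_distrib)
  also have "ennreal ((R * A)\<^sup>2) * (ennreal ((D / A)\<^sup>2) * ennreal (pi / D\<^sup>2)) = ennreal ((R * A)\<^sup>2 * ((D / A)\<^sup>2 * (pi / D\<^sup>2)))"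
    using D by (simp flip: ennreal_mult)
  also have "(R * A)\<^sup>2 * ((D / A)\<^sup>2 * (pi / D\<^sup>2)) = pi * R\<^sup>2"
    using A D by (simp add: power_mult_distrib power_divide)
  finally show ?thesis .
qed

text \<open>Up to constants depending on \<open>R\<close> alone, \<open>pdisc R z\<close> has the
  size of the distance from \<open>z\<close> to the circle and keeps a comparable distance from it.
  The largest modulus is approached at |c| + \<rho>, and 1 - |c| - \<rho> equals (1 - x)(1 - R) / (1
  + R x), with denominator at most 2. The second estimate is the diameter 2 \<rho>.\<close>

lemma pdisc_geometry:
  assumes R: "0 < R" "R < 1" and z: "z \<in> disc"
  shows "z \<in> pdisc R z" "convex (pdisc R z)" "open (pdisc R z)"
    and "w \<in> pdisc R z \<Longrightarrow> (1 - cmod z) * (1 - R) / 2 \<le> 1 - cmod w"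
    and "w \<in> pdisc R z \<Longrightarrow> cmod (w - z) \<le> 4 * (1 - cmod z) / (1 - R)"
    and "pdisc R z \<subseteq> disc"
proof -
  define x where "x = cmod z"
  define D where "D = 1 - R\<^sup>2 * x\<^sup>2"
  define c where "c = of_real ((1 - R\<^sup>2) / D) * z"
  define \<rho> where "\<rho> = R * (1 - x\<^sup>2) / D"
  have D: "D > 0" unfolding D_def x_def by (rule pdisc_denominator) (use R z in auto)
  have x: "0 \<le> x" "x < 1" using z by (auto simp: x_def)
  have x2: "x\<^sup>2 < 1" using x by (simp add: abs_square_less_1)
  have R2: "R\<^sup>2 < 1" using R by (simp add: abs_square_less_1)
  have Rx: "R * x < 1" using R x mult_strict_mono'[of R 1 x 1] by simp
  have P: "pdisc R z = ball c \<rho>" by (simp add: pdisc_def c_def \<rho>_def D_def x_def)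
  show "convex (pdisc R z)" "open (pdisc R z)" by (simp_all add: P)
  have \<rho>: "\<rho> > 0" using R x2 D by (simp add: \<rho>_def)
  have "cmod (z - c) = x * (R\<^sup>2 * (1 - x\<^sup>2) / D)"
  proof -
    have "z - c = of_real (1 - (1 - R\<^sup>2) / D) * z" by (simp add: c_def algebra_simps)
    also have "1 - (1 - R\<^sup>2) / D = R\<^sup>2 * (1 - x\<^sup>2) / D" using D by (simp add: field_simps) (simp add: D_def algebra_simps)
    finally have "z - c = of_real (R\<^sup>2 * (1 - x\<^sup>2) / D) * z" .
    then have "cmod (z - c) = \<bar>R\<^sup>2 * (1 - x\<^sup>2) / D\<bar> * x" by (simp only: norm_mult norm_of_real x_def)
    then show ?thesis using D x2 by simp
  qed
  also have "\<dots> = (R * x) * \<rho>" by (simp add: \<rho>_def power2_eq_square)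
  also have "\<dots> < 1 * \<rho>" using Rx \<rho> by (intro mult_strict_right_mono) auto
  finally have zc: "cmod (z - c) < \<rho>" by simp
  then show zP: "z \<in> pdisc R z" by (simp add: P dist_norm norm_minus_commute)
  have cc: "cmod c = (1 - R\<^sup>2) / D * x" using D R2 by (simp add: c_def norm_mult x_def del: of_real_divide)
  have "(1 - (cmod c + \<rho>)) * D = D - (1 - R\<^sup>2) * x - R * (1 - x\<^sup>2)"
  proof -
    have "D * \<rho> = R * (1 - x\<^sup>2)" using D by (simp add: \<rho>_def)
    moreover have "D * cmod c = (1 - R\<^sup>2) * x" using D by (simp add: cc)
    ultimately show ?thesis by (simp add: algebra_simps)
  qed
  also have "\<dots> = ((1 - x) * (1 - R) / (1 + R * x)) * D"
  proof -
    have "D = (1 - R * x) * (1 + R * x)" by (simp add: D_def power2_eq_square algebra_simps)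
    moreover have "1 + R * x \<noteq> 0" using R x by (simp add: add_nonneg_eq_0_iff)
    moreover have "D - (1 - R\<^sup>2) * x - R * (1 - x\<^sup>2) = (1 - x) * (1 - R) * (1 - R * x)"
      by (simp add: D_def power2_eq_square algebra_simps)
    ultimately show ?thesis by simp
  qed
  finally have "1 - (cmod c + \<rho>) = (1 - x) * (1 - R) / (1 + R * x)"
    using D by (subst (asm) mult_right_cancel) auto
  also have "(1 - x) * (1 - R) / 2 \<le> \<dots>"
    using x R Rx by (intro divide_left_mono) (auto intro!: mult_nonneg_nonneg add_pos_nonneg)
  finally have bd: "(1 - x) * (1 - R) / 2 \<le> 1 - (cmod c + \<rho>)" .
  show dist: "(1 - cmod z) * (1 - R) / 2 \<le> 1 - cmod w" if "w \<in> pdisc R z" for w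
  proof -
    have "cmod w \<le> cmod c + \<rho>" using that norm_triangle_ineq[of c "w - c"]
      by (simp add: P dist_norm norm_minus_commute)
    then show ?thesis using bd by (simp add: x_def)
  qed
  have "0 < (1 - cmod z) * (1 - R) / 2" using x R by (simp add: x_def)
  then show "pdisc R z \<subseteq> disc" using dist by fastforce
  have \<rho>_le: "\<rho> \<le> 2 * (1 - x) / (1 - R)"
  proof -
    have "R\<^sup>2 * x\<^sup>2 \<le> R * 1" using R x x2 by (intro mult_mono) (auto simp: power2_eq_square mult_left_le)
    then have "1 - R \<le> D" by (simp add: D_def)
    moreover have "R * (1 - x\<^sup>2) \<le> 2 * (1 - x)"
    proof -
      have "R * (1 - x\<^sup>2) \<le> 1 * (1 - x\<^sup>2)" using R x2 by (intro mult_right_mono) auto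
      also have "\<dots> = (1 + x) * (1 - x)" by (simp add: power2_eq_square algebra_simps)
      also have "\<dots> \<le> 2 * (1 - x)" using x by (intro mult_right_mono) auto
      finally show ?thesis .
    qed
    ultimately show ?thesis unfolding \<rho>_def using R x2 x by (intro frac_le) auto
  qed
  show "cmod (w - z) \<le> 4 * (1 - cmod z) / (1 - R)" if "w \<in> pdisc R z" for w
  proof -
    have "cmod (w - c) < \<rho>" using that by (simp add: P dist_norm norm_minus_commute)
    then have "cmod (w - z) \<le> 2 * \<rho>" using norm_triangle_ineq4[of "w - c" "z - c"] zc by simp
    also have "\<dots> \<le> 2 * (2 * (1 - x) / (1 - R))" using \<rho>_le by (intro mult_left_mono) auto
    also have "\<dots> = 4 * (1 - cmod z) / (1 - R)" by (simp add: x_def)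
    finally show ?thesis .
  qed
qed


section \<open>Oscillation against the kernel\<close>

text \<open>The squared norm of (v - v(z)) k_z, or the mean square deviation of \<open>v\<close>
  from \<open>v z\<close> under the probability density |k_z|^2.\<close>

definition osc :: "(complex \<Rightarrow> complex) \<Rightarrow> complex \<Rightarrow> real" where
  "osc v z = (LINT w|dA. (cmod (v w - v z))\<^sup>2 * (cmod (bergman_kernel z w))\<^sup>2)"

lemma osc_nonneg: "0 \<le> osc v z"
  by (simp add: osc_def)

lemma kernel_weight:
  assumes z: "z \<in> disc" and R: "0 < R" "R \<le> 1" and sub: "pdisc R z \<subseteq> disc"
  shows "integrable dA (\<lambda>w. indicator (pdisc R z) w * (cmod (bergman_kernel z w))\<^sup>2)"
    and "(LINT w|dA. indicator (pdisc R z) w * (cmod (bergman_kernel z w))\<^sup>2) = R\<^sup>2"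
proof -
  have [measurable]: "pdisc R z \<in> sets borel" by (simp add: pdisc_def)
  have [measurable]: "disc \<in> sets borel" by simp
  have "(\<integral>\<^sup>+w. ennreal (indicator (pdisc R z) w * (cmod (bergman_kernel z w))\<^sup>2) \<partial>dA) =
      (\<integral>\<^sup>+w\<in>disc. ennreal (indicator (pdisc R z) w * (cmod (bergman_kernel z w))\<^sup>2) \<partial>lborel) / ennreal pi"
    by (rule nn_integral_dA) measurable
  also have "(\<integral>\<^sup>+w\<in>disc. ennreal (indicator (pdisc R z) w * (cmod (bergman_kernel z w))\<^sup>2) \<partial>lborel) =
      (\<integral>\<^sup>+w\<in>pdisc R z. ennreal ((cmod (bergman_kernel z w))\<^sup>2) \<partial>lborel)"
    using sub by (intro nn_integral_cong) (auto simp: indicator_def)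
  also have "\<dots> = ennreal (pi * R\<^sup>2)" by (rule kernel_integral_pdisc[OF R z])
  also have "ennreal (pi * R\<^sup>2) / ennreal pi = ennreal (R\<^sup>2)" by (simp add: divide_ennreal)
  finally have nn: "(\<integral>\<^sup>+w. ennreal (indicator (pdisc R z) w * (cmod (bergman_kernel z w))\<^sup>2) \<partial>dA) = ennreal (R\<^sup>2)" .
  have "(\<lambda>w. indicator (pdisc R z) w * (cmod (bergman_kernel z w))\<^sup>2) \<in> borel_measurable (lebesgue_on disc)"
    by (intro measurable_restrict_space1 measurable_completion) simp
  then have "(\<lambda>w. indicator (pdisc R z) w * (cmod (bergman_kernel z w))\<^sup>2) \<in> borel_measurable dA"
    by (simp add: measurable_cong_sets[OF sets_dA refl])
  from nn_integral_eq_integrable[OF this, of "R\<^sup>2"] nn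
  show "integrable dA (\<lambda>w. indicator (pdisc R z) w * (cmod (bergman_kernel z w))\<^sup>2)"
    "(LINT w|dA. indicator (pdisc R z) w * (cmod (bergman_kernel z w))\<^sup>2) = R\<^sup>2" by auto
qed

lemma kernel_total:
  assumes z: "z \<in> disc"
  shows "integrable dA (\<lambda>w. (cmod (bergman_kernel z w))\<^sup>2)" "(LINT w|dA. (cmod (bergman_kernel z w))\<^sup>2) = 1"
proof -
  have D: "1 - (cmod z)\<^sup>2 > 0" using pdisc_denominator[of 1 z] z by simp
  then have p: "pdisc 1 z = disc" by (simp add: pdisc_def)
  have "integrable dA (\<lambda>w. (cmod (bergman_kernel z w))\<^sup>2) \<longleftrightarrow> integrable dA (\<lambda>w. indicator (pdisc 1 z) w * (cmod (bergman_kernel z w))\<^sup>2)"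
    by (rule Bochner_Integration.integrable_cong) (auto simp: p)
  then show "integrable dA (\<lambda>w. (cmod (bergman_kernel z w))\<^sup>2)" using kernel_weight(1)[OF z, of 1] p by simp
  have "(LINT w|dA. (cmod (bergman_kernel z w))\<^sup>2) = (LINT w|dA. indicator (pdisc 1 z) w * (cmod (bergman_kernel z w))\<^sup>2)"
    by (rule Bochner_Integration.integral_cong) (auto simp: p)
  then show "(LINT w|dA. (cmod (bergman_kernel z w))\<^sup>2) = 1" using kernel_weight(2)[OF z, of 1] p by simp
qed

lemma osc_integrable:
  assumes v: "continuous_on disc v" and C: "\<And>w. w \<in> disc \<Longrightarrow> cmod (v w) \<le> C" and z: "z \<in> disc"
  shows "integrable dA (\<lambda>w. (cmod (v w - v z))\<^sup>2 * (cmod (bergman_kernel z w))\<^sup>2)"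
proof -
  have "integrable dA (\<lambda>w. (2 * C)\<^sup>2 * (cmod (bergman_kernel z w))\<^sup>2)"
    using kernel_total(1)[OF z] by simp
  then show ?thesis
  proof (rule Bochner_Integration.integrable_bound)
    show "(\<lambda>w. (cmod (v w - v z))\<^sup>2 * (cmod (bergman_kernel z w))\<^sup>2) \<in> borel_measurable dA"
      using continuous_measurable_dA[OF v]
        continuous_measurable_dA[OF holomorphic_on_imp_continuous_on[OF bergman_kernel_holomorphic[OF z]]]
      by measurable
    show "AE w in dA. norm ((cmod (v w - v z))\<^sup>2 * (cmod (bergman_kernel z w))\<^sup>2) \<le> norm ((2 * C)\<^sup>2 * (cmod (bergman_kernel z w))\<^sup>2)"
    proof (intro AE_I2)
      fix w assume w: "w \<in> space dA"
      have "cmod (v w - v z) \<le> 2 * C"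
        using norm_triangle_ineq4[of "v w" "v z"] C[of w] C[OF z] w by simp
      then have "(cmod (v w - v z))\<^sup>2 \<le> (2 * C)\<^sup>2" by (intro power_mono) auto
      then show "norm ((cmod (v w - v z))\<^sup>2 * (cmod (bergman_kernel z w))\<^sup>2) \<le> norm ((2 * C)\<^sup>2 * (cmod (bergman_kernel z w))\<^sup>2)"
        by (simp add: abs_mult mult_right_mono)
    qed
  qed
qed

text \<open>Off \<open>pdisc R z\<close> there is only the crude bound \<open>2 * C\<close>, but the
  kernel mass there is \<open>1 - R\<^sup>2\<close>.\<close>

lemma osc_le_pdisc:
  assumes v: "continuous_on disc v" and C: "\<And>w. w \<in> disc \<Longrightarrow> cmod (v w) \<le> C" and z: "z \<in> disc"
    and R: "0 < R" "R < 1" and near: "\<And>w. w \<in> pdisc R z \<Longrightarrow> cmod (v w - v z) \<le> \<eta>"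
  shows "osc v z \<le> \<eta>\<^sup>2 + (2 * C)\<^sup>2 * (1 - R\<^sup>2)"
proof -
  let ?k = "\<lambda>w. (cmod (bergman_kernel z w))\<^sup>2"
  let ?E = "pdisc R z"
  note E = kernel_weight[OF z R(1) less_imp_le[OF R(2)] pdisc_geometry(6)[OF R z]]
  note T = kernel_total[OF z]
  have "osc v z \<le> (LINT w|dA. \<eta>\<^sup>2 * ?k w + (2 * C)\<^sup>2 * (?k w - indicator ?E w * ?k w))"
    unfolding osc_def
  proof (rule integral_mono)
    show "integrable dA (\<lambda>w. (cmod (v w - v z))\<^sup>2 * ?k w)" by (rule osc_integrable[OF v C z])
    show "integrable dA (\<lambda>w. \<eta>\<^sup>2 * ?k w + (2 * C)\<^sup>2 * (?k w - indicator ?E w * ?k w))" using E T by simp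
    fix w assume w: "w \<in> space dA"
    show "(cmod (v w - v z))\<^sup>2 * ?k w \<le> \<eta>\<^sup>2 * ?k w + (2 * C)\<^sup>2 * (?k w - indicator ?E w * ?k w)"
    proof (cases "w \<in> ?E")
      case True
      then have "(cmod (v w - v z))\<^sup>2 \<le> \<eta>\<^sup>2" by (intro power_mono near) auto
      then show ?thesis using True by (simp add: mult_right_mono)
    next
      case False
      have "cmod (v w - v z) \<le> 2 * C"
        using norm_triangle_ineq4[of "v w" "v z"] C[of w] C[OF z] w by simp
      then have "(cmod (v w - v z))\<^sup>2 \<le> (2 * C)\<^sup>2" by (intro power_mono) auto
      then have "(cmod (v w - v z))\<^sup>2 * ?k w \<le> (2 * C)\<^sup>2 * ?k w" by (rule mult_right_mono) simp
      also have "\<dots> \<le> \<eta>\<^sup>2 * ?k w + (2 * C)\<^sup>2 * ?k w" by simp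
      finally show ?thesis using False by simp
    qed
  qed
  also have "\<dots> = \<eta>\<^sup>2 + (2 * C)\<^sup>2 * (1 - R\<^sup>2)" using E T by simp
  finally show ?thesis .
qed

text \<open>Two comparison functions accommodate sums and products; the constant \<open>e\<close>
  accommodates uniform limits and survives integration unchanged because the kernel has total mass
  1.\<close>

lemma osc_le:
  assumes v: "continuous_on disc v" "bounded (v ` disc)"
    and v1: "continuous_on disc v1" "bounded (v1 ` disc)"
    and v2: "continuous_on disc v2" "bounded (v2 ` disc)"
    and z: "z \<in> disc"
    and le: "\<And>w. w \<in> disc \<Longrightarrow>
      (cmod (v w - v z))\<^sup>2 \<le> A * (cmod (v1 w - v1 z))\<^sup>2 + B * (cmod (v2 w - v2 z))\<^sup>2 + e"
  shows "osc v z \<le> A * osc v1 z + B * osc v2 z + e"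
proof -
  let ?k = "\<lambda>w. (cmod (bergman_kernel z w))\<^sup>2"
  obtain C where C: "\<And>w. w \<in> disc \<Longrightarrow> cmod (v w) \<le> C" using bounded_discE[OF v(2)] by blast
  obtain C1 where C1: "\<And>w. w \<in> disc \<Longrightarrow> cmod (v1 w) \<le> C1" using bounded_discE[OF v1(2)] by blast
  obtain C2 where C2: "\<And>w. w \<in> disc \<Longrightarrow> cmod (v2 w) \<le> C2" using bounded_discE[OF v2(2)] by blast
  note i = osc_integrable[OF v(1) C z] osc_integrable[OF v1(1) C1 z] osc_integrable[OF v2(1) C2 z] kernel_total[OF z]
  have "osc v z \<le> (LINT w|dA. A * ((cmod (v1 w - v1 z))\<^sup>2 * ?k w) + B * ((cmod (v2 w - v2 z))\<^sup>2 * ?k w) + e * ?k w)"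
    unfolding osc_def
  proof (rule integral_mono)
    show "integrable dA (\<lambda>w. (cmod (v w - v z))\<^sup>2 * ?k w)" by (rule i)
    show "integrable dA (\<lambda>w. A * ((cmod (v1 w - v1 z))\<^sup>2 * ?k w) + B * ((cmod (v2 w - v2 z))\<^sup>2 * ?k w) + e * ?k w)"
      using i by simp
    fix w assume "w \<in> space dA"
    then have "(cmod (v w - v z))\<^sup>2 * ?k w \<le> (A * (cmod (v1 w - v1 z))\<^sup>2 + B * (cmod (v2 w - v2 z))\<^sup>2 + e) * ?k w"
      by (intro mult_right_mono le) auto
    then show "(cmod (v w - v z))\<^sup>2 * ?k w \<le> A * ((cmod (v1 w - v1 z))\<^sup>2 * ?k w) + B * ((cmod (v2 w - v2 z))\<^sup>2 * ?k w) + e * ?k w"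
      by (simp add: distrib_right mult.assoc)
  qed
  also have "\<dots> = A * osc v1 z + B * osc v2 z + e" using i by (simp add: osc_def)
  finally show ?thesis .
qed

text \<open>The mean value inequality on the convex set \<open>pdisc R z\<close> converts a
  derivative of size \<epsilon> / (1 - |z|) into an oscillation bounded independently of
  \<open>z\<close>, since the diameter is comparable to 1 - |z|.\<close>

lemma Hinf_osc:
  assumes f: "f \<in> Hinf"
  shows "AE \<zeta> in arc_length. has_nontangential_limit (osc f) 0 \<zeta>"
proof -
  have hol: "f holomorphic_on disc" using f by (simp add: Hinf_def)
  obtain C0 where C0: "\<And>w. w \<in> disc \<Longrightarrow> cmod (f w) \<le> C0" using bounded_discE[of f] f by (auto simp: Hinf_def)
  \<comment> \<open>The maximum with 1 permits division by \<open>C\<^sup>2\<close>.\<close>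
  define C where "C = max C0 1"
  have C: "cmod (f w) \<le> C" if "w \<in> disc" for w using C0[OF that] by (simp add: C_def)
  have C1: "C \<ge> 1" by (simp add: C_def)
  have cont: "continuous_on disc f" using hol by (rule holomorphic_on_imp_continuous_on)
  show ?thesis
    using Hinf_deriv_decay[OF f] AE_space
  proof eventually_elim
    case (elim \<zeta>)
    have \<zeta>: "cmod \<zeta> = 1" using elim(2) by simp
    show "has_nontangential_limit (osc f) 0 \<zeta>"
      unfolding has_nontangential_limit_def
    proof (intro allI impI tendstoI)
      fix \<alpha> e :: real assume \<alpha>: "\<alpha> > 1" and e: "e > 0"
      \<comment> \<open>Since \<open>1 - R\<^sup>2 \<le> 2 * s\<close>, the tail is at most
        \<open>8 * C\<^sup>2 * s\<close>, and 32 turns this into \<open>e / 4\<close>; the cap 1/2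
        keeps \<open>R\<close> positive.\<close>
      define s where "s = min (1/2) (e / (32 * C\<^sup>2))"
      define R where "R = 1 - s"
      have s: "0 < s" "s \<le> 1/2" "s \<le> e / (32 * C\<^sup>2)" using e C1 by (auto simp: s_def)
      have R: "0 < R" "R < 1" "1 - R = s" using s by (auto simp: R_def)
      have tail: "(2 * C)\<^sup>2 * (1 - R\<^sup>2) \<le> e / 4"
      proof -
        have "1 - R\<^sup>2 \<le> 2 * s" by (simp add: R_def power2_eq_square algebra_simps)
        then have "(2 * C)\<^sup>2 * (1 - R\<^sup>2) \<le> (2 * C)\<^sup>2 * (2 * (e / (32 * C\<^sup>2)))" using s by (intro mult_left_mono) auto
        also have "\<dots> = e / 4" using C1 by (simp add: power2_eq_square)
        finally show ?thesis .
      qed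
      define \<eta> where "\<eta> = sqrt (e / 4)"
      have \<eta>: "\<eta> > 0" "\<eta>\<^sup>2 = e / 4" using e by (auto simp: \<eta>_def)
      \<comment> \<open>The derivative bound 2 \<epsilon> / ((1 - |z|) s) times the displacement 4
        (1 - |z|) / s is then exactly \<eta>.\<close>
      define \<epsilon> where "\<epsilon> = \<eta> * s\<^sup>2 / 8"
      have \<epsilon>: "\<epsilon> > 0" using \<eta> s by (simp add: \<epsilon>_def)
      \<comment> \<open>For w in \<open>pdisc R z\<close>, |w - \<zeta>| < K (1 - |z|), and 1 - |z|
        is at most 2 / s times 1 - |w|; this dictates the wider aperture
        \<open>\<beta>\<close>.\<close>
      define K where "K = 4 / s + \<alpha>"
      have K: "K > 0" "4 / s > 0" using s \<alpha> by (auto simp: K_def intro!: add_pos_pos)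
      define \<beta> where "\<beta> = K * (2 / s)"
      have \<beta>: "\<beta> > 0" using K s by (simp add: \<beta>_def)
      have "\<forall>\<^sub>F w in at \<zeta> within nontangential_region \<beta> \<zeta>. dist ((1 - cmod w) * cmod (deriv f w)) 0 < \<epsilon>"
        using elim(1) \<beta> \<epsilon> tendstoD by blast
      then obtain d where d: "d > 0" and dec0: "\<And>w. w \<in> nontangential_region \<beta> \<zeta> \<Longrightarrow> w \<noteq> \<zeta> \<Longrightarrow> dist w \<zeta> < d \<Longrightarrow>
          dist ((1 - cmod w) * cmod (deriv f w)) 0 < \<epsilon>"
        unfolding eventually_at by blast
      have dec: "(1 - cmod w) * cmod (deriv f w) < \<epsilon>" if "w \<in> nontangential_region \<beta> \<zeta>" "cmod (w - \<zeta>) < d" for w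
      proof -
        have "w \<noteq> \<zeta>" using that(1) \<zeta> by (auto simp: nontangential_region_def)
        then show ?thesis using dec0[OF that(1)] that(2) by (simp add: dist_norm)
      qed
      \<comment> \<open>As 1 - |z| \<le> |z - \<zeta>|, points of \<open>pdisc R z\<close> are at
        most \<open>q\<close> times as far from \<zeta> as z is.\<close>
      define q where "q = 4 / s + 1"
      have q: "q > 0" unfolding q_def by (rule add_pos_pos[OF K(2) zero_less_one])
      define d' where "d' = d / q"
      have d': "d' > 0" using d q by (simp add: d'_def)
      have main: "osc f z < e" if z: "z \<in> nontangential_region \<alpha> \<zeta>" and zd: "cmod (z - \<zeta>) < d'" for z
      proof -
        have zz: "z \<in> disc" "cmod z < 1" "cmod (z - \<zeta>) < \<alpha> * (1 - cmod z)" using z by (auto simp: nontangential_region_def)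
        note G = pdisc_geometry[OF R(1,2) zz(1)]
        have z1: "1 - cmod z \<le> cmod (z - \<zeta>)" using norm_triangle_ineq2[of \<zeta> z] \<zeta> by (simp add: norm_minus_commute)
        have bound: "cmod (deriv f w) \<le> 2 * \<epsilon> / ((1 - cmod z) * s)" if w: "w \<in> pdisc R z" for w
        proof -
          have w1: "(1 - cmod z) * s / 2 \<le> 1 - cmod w" using G(4)[OF w] R by simp
          have w2: "cmod (w - z) \<le> 4 / s * (1 - cmod z)" using G(5)[OF w] R by simp
          have tri: "cmod (w - \<zeta>) \<le> cmod (w - z) + cmod (z - \<zeta>)" using norm_triangle_ineq[of "w - z" "z - \<zeta>"] by simp
          have "cmod (w - \<zeta>) < K * (1 - cmod z)"
            using tri w2 zz(3) by (simp add: K_def distrib_right)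
          also have "\<dots> = \<beta> * ((1 - cmod z) * s / 2)" using s by (simp add: \<beta>_def)
          also have "\<dots> \<le> \<beta> * (1 - cmod w)" using w1 \<beta> by (intro mult_left_mono) auto
          finally have 1: "w \<in> nontangential_region \<beta> \<zeta>" using G(6) w by (auto simp: nontangential_region_def)
          have "cmod (w - \<zeta>) \<le> 4 / s * cmod (z - \<zeta>) + cmod (z - \<zeta>)"
            using tri w2 mult_left_mono[OF z1, of "4 / s"] K by linarith
          also have "\<dots> = q * cmod (z - \<zeta>)" by (simp add: q_def distrib_right)
          also have "\<dots> < q * d'" by (rule mult_strict_left_mono[OF zd q])
          also have "\<dots> = d" using q by (simp add: d'_def)
          finally have 2: "cmod (w - \<zeta>) < d" .
          have "(1 - cmod z) * s / 2 * cmod (deriv f w) \<le> (1 - cmod w) * cmod (deriv f w)"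
            by (intro mult_right_mono w1) auto
          also have "\<dots> \<le> \<epsilon>" using dec[OF 1 2] by simp
          finally have "(1 - cmod z) * s * cmod (deriv f w) \<le> 2 * \<epsilon>" by simp
          moreover have "(1 - cmod z) * s > 0" using zz s by simp
          ultimately show ?thesis by (simp add: pos_le_divide_eq mult.commute)
        qed
        have "cmod (f w - f z) \<le> \<eta>" if w: "w \<in> pdisc R z" for w
        proof -
          have "cmod (f w - f z) \<le> 2 * \<epsilon> / ((1 - cmod z) * s) * cmod (w - z)"
          proof (rule field_differentiable_bound[OF G(2) _ bound w G(1)])
            fix x assume "x \<in> pdisc R z"
            then have x: "x \<in> disc" using G(6) by blast
            show "(f has_field_derivative deriv f x) (at x within pdisc R z)"
              by (rule has_field_derivative_at_within[OF holomorphic_derivI[OF hol open_ball x]])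
          qed
          also have "\<dots> \<le> 2 * \<epsilon> / ((1 - cmod z) * s) * (4 * (1 - cmod z) / s)"
            using G(5)[OF w] R zz s \<epsilon> by (intro mult_left_mono) auto
          also have "\<dots> = \<eta>" using zz s by (simp add: \<epsilon>_def power2_eq_square)
          finally show ?thesis .
        qed
        then have "osc f z \<le> \<eta>\<^sup>2 + (2 * C)\<^sup>2 * (1 - R\<^sup>2)"
          by (intro osc_le_pdisc[OF cont C zz(1) R(1,2)])
        then show ?thesis using tail \<eta> e by simp
      qed
      have "\<forall>\<^sub>F z in at \<zeta> within nontangential_region \<alpha> \<zeta>. z \<in> nontangential_region \<alpha> \<zeta> \<and> cmod (z - \<zeta>) < d'"
        unfolding eventually_at using d' by (auto simp: dist_norm)
      then show "\<forall>\<^sub>F z in at \<zeta> within nontangential_region \<alpha> \<zeta>. dist (osc f z) 0 < e"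
        by eventually_elim (use main osc_nonneg in \<open>auto simp: dist_norm\<close>)
    qed
  qed
qed


section \<open>The algebra generated by bounded analytic functions\<close>

lemma calU_cstar_subalgebra_le: "cstar_subalgebra A \<Longrightarrow> Hinf \<subseteq> A \<Longrightarrow> calU \<subseteq> A"
  unfolding calU_def by (rule hull_minimal)

text \<open>The hull is an intersection, and every closure condition passes to intersections;
  approximants in \<open>calU\<close> lie in each competing algebra, which handles norm
  limits.\<close>

lemma calU_closed:
  shows "(\<lambda>w. 0) \<in> calU"
    and "f \<in> calU \<Longrightarrow> g \<in> calU \<Longrightarrow> (\<lambda>w. f w + g w) \<in> calU"
    and "f \<in> calU \<Longrightarrow> g \<in> calU \<Longrightarrow> (\<lambda>w. f w * g w) \<in> calU"
    and "f \<in> calU \<Longrightarrow> (\<lambda>w. c * f w) \<in> calU"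
    and "f \<in> calU \<Longrightarrow> (\<lambda>w. cnj (f w)) \<in> calU"
    and "f \<in> Linf \<Longrightarrow> (\<And>\<epsilon>. \<epsilon> > 0 \<Longrightarrow> \<exists>g\<in>calU. Linf_norm (\<lambda>w. f w - g w) < ereal \<epsilon>) \<Longrightarrow> f \<in> calU"
proof -
  have I: "h \<in> calU" if "\<And>A. cstar_subalgebra A \<Longrightarrow> Hinf \<subseteq> A \<Longrightarrow> h \<in> A" for h
    using that by (auto simp: calU_def hull_def)
  have D: "h \<in> A" if "cstar_subalgebra A" "Hinf \<subseteq> A" "h \<in> calU" for h A
    using calU_cstar_subalgebra_le[OF that(1,2)] that(3) by blast
  show "(\<lambda>w. 0) \<in> calU" by (rule I) (simp add: cstar_subalgebra_def)
  show "(\<lambda>w. f w + g w) \<in> calU" "(\<lambda>w. f w * g w) \<in> calU" if fg: "f \<in> calU" "g \<in> calU"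
  proof -
    show "(\<lambda>w. f w + g w) \<in> calU"
      by (rule I, frule (1) D[OF _ _ fg(1)], frule (1) D[OF _ _ fg(2)]) (unfold cstar_subalgebra_def, blast)
    show "(\<lambda>w. f w * g w) \<in> calU"
      by (rule I, frule (1) D[OF _ _ fg(1)], frule (1) D[OF _ _ fg(2)]) (unfold cstar_subalgebra_def, blast)
  qed
  show "(\<lambda>w. c * f w) \<in> calU" "(\<lambda>w. cnj (f w)) \<in> calU" if f: "f \<in> calU"
  proof -
    show "(\<lambda>w. c * f w) \<in> calU"
      by (rule I, frule (1) D[OF _ _ f]) (unfold cstar_subalgebra_def, blast)
    show "(\<lambda>w. cnj (f w)) \<in> calU"
      by (rule I, frule (1) D[OF _ _ f]) (unfold cstar_subalgebra_def, blast)
  qed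
  show "f \<in> calU" if f: "f \<in> Linf" and ap: "\<And>\<epsilon>. \<epsilon> > 0 \<Longrightarrow> \<exists>g\<in>calU. Linf_norm (\<lambda>w. f w - g w) < ereal \<epsilon>"
  proof (rule I)
    fix A assume A: "cstar_subalgebra A" "Hinf \<subseteq> A"
    have "\<forall>\<epsilon>>0. \<exists>g\<in>A. Linf_norm (\<lambda>w. f w - g w) < ereal \<epsilon>" using ap D[OF A] by blast
    then show "f \<in> A" using A(1) f unfolding cstar_subalgebra_def by blast
  qed
qed

text \<open>The means of computing with \<open>cont_rep\<close>: exhibit a continuous function equal
  to \<open>f\<close> almost everywhere.\<close>

lemma cont_rep_eq:
  assumes "f \<in> calU" "continuous_on disc v" "AE w in dA. f w = v w" "z \<in> disc"
  shows "cont_rep f z = v z"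
  by (rule cont_rep_unique[OF calU_cont_rep(1)[OF assms(1)] assms(2) calU_cont_rep(3)[OF assms(1)] assms(3,4)])

lemma calU_measurable_Linf:
  assumes f: "f \<in> calU" "f \<in> borel_measurable dA"
  shows "f \<in> Linf"
proof -
  obtain c where c: "\<And>w. w \<in> disc \<Longrightarrow> cmod (cont_rep f w) \<le> c"
    using bounded_discE[OF calU_cont_rep(2)[OF f(1)]] by blast
  have "AE w in dA. cmod (f w) \<le> c"
    using calU_cont_rep(3)[OF f(1)] AE_space by eventually_elim (use c in auto)
  then show ?thesis by (rule bounded_imp_Linf[OF f(2)])
qed

section \<open>Nontangential limits under inequalities\<close>

lemma eventually_nontangential: "\<forall>\<^sub>F z in at \<zeta> within nontangential_region \<alpha> \<zeta>. z \<in> disc"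
  unfolding eventually_at by (auto simp: nontangential_region_def intro: exI[of _ 1])

lemma nontangential_limit_squeeze:
  fixes F G :: "complex \<Rightarrow> real"
  assumes G: "has_nontangential_limit G 0 \<zeta>"
    and le: "\<And>z. z \<in> disc \<Longrightarrow> 0 \<le> F z" "\<And>z. z \<in> disc \<Longrightarrow> F z \<le> G z"
  shows "has_nontangential_limit F 0 \<zeta>"
  unfolding has_nontangential_limit_def
proof (intro allI impI)
  fix \<alpha> :: real assume "\<alpha> > 1"
  then have lim: "(G \<longlongrightarrow> 0) (at \<zeta> within nontangential_region \<alpha> \<zeta>)"
    using G by (simp add: has_nontangential_limit_def)
  have "\<forall>\<^sub>F z in at \<zeta> within nontangential_region \<alpha> \<zeta>. 0 \<le> F z"
    using eventually_nontangential by eventually_elim (rule le)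
  moreover have "\<forall>\<^sub>F z in at \<zeta> within nontangential_region \<alpha> \<zeta>. F z \<le> G z"
    using eventually_nontangential by eventually_elim (rule le)
  ultimately show "(F \<longlongrightarrow> 0) (at \<zeta> within nontangential_region \<alpha> \<zeta>)"
    by (rule tendsto_sandwich[OF _ _ tendsto_const lim])
qed

text \<open>\<open>A\<close> and \<open>B\<close> are fixed before \<open>z\<close>, so the
  integrated bound tends to 0 along every cone.\<close>

lemma osc_nontangential_combine:
  assumes "has_nontangential_limit (osc v1) 0 \<zeta>" "has_nontangential_limit (osc v2) 0 \<zeta>"
    and v: "continuous_on disc v" "bounded (v ` disc)"
    and v1: "continuous_on disc v1" "bounded (v1 ` disc)"
    and v2: "continuous_on disc v2" "bounded (v2 ` disc)"
    and le: "\<And>w z. w \<in> disc \<Longrightarrow> z \<in> disc \<Longrightarrow>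
      (cmod (v w - v z))\<^sup>2 \<le> A * (cmod (v1 w - v1 z))\<^sup>2 + B * (cmod (v2 w - v2 z))\<^sup>2"
  shows "has_nontangential_limit (osc v) 0 \<zeta>"
proof (rule nontangential_limit_squeeze)
  show "has_nontangential_limit (\<lambda>z. A * osc v1 z + B * osc v2 z) 0 \<zeta>"
    unfolding has_nontangential_limit_def
  proof (intro allI impI)
    fix \<alpha> :: real assume "\<alpha> > 1"
    then have "((\<lambda>z. A * osc v1 z + B * osc v2 z) \<longlongrightarrow> A * 0 + B * 0) (at \<zeta> within nontangential_region \<alpha> \<zeta>)"
      using assms(1,2) by (intro tendsto_intros) (auto simp: has_nontangential_limit_def)
    then show "((\<lambda>z. A * osc v1 z + B * osc v2 z) \<longlongrightarrow> 0) (at \<zeta> within nontangential_region \<alpha> \<zeta>)" by simp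
  qed
  fix z assume z: "z \<in> disc"
  show "0 \<le> osc v z" by (rule osc_nonneg)
  show "osc v z \<le> A * osc v1 z + B * osc v2 z"
    using osc_le[OF v v1 v2 z, of A B 0] le z by simp
qed

lemma square_sum_le: "(a + b)\<^sup>2 \<le> 2 * a\<^sup>2 + 2 * (b::real)\<^sup>2"
  using zero_le_power2[of "a - b"] by (simp add: power2_eq_square algebra_simps)

lemma cmod_square_sum_le: "(cmod (a + b))\<^sup>2 \<le> 2 * (cmod a)\<^sup>2 + 2 * (cmod b)\<^sup>2"
  by (rule order_trans[OF power_mono[OF norm_triangle_ineq] square_sum_le]) simp

lemma calU_osc:
  assumes "u \<in> calU"
  shows "u \<in> borel_measurable dA" "AE \<zeta> in arc_length. has_nontangential_limit (osc (cont_rep u)) 0 \<zeta>"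
proof -
  let ?v = cont_rep
  \<comment> \<open>Membership in \<open>calU\<close> is built in because the rules for
    \<open>cont_rep\<close> depend on it. Membership in \<open>Linf\<close> is the first clause of
    \<open>cstar_subalgebra\<close> and yields the measurability of \<open>u\<close>.\<close>
  define B where "B = {f \<in> Linf \<inter> calU. AE \<zeta> in arc_length. has_nontangential_limit (osc (?v f)) 0 \<zeta>}"
  have Bm: "f \<in> borel_measurable dA" if "f \<in> B" for f using that by (auto simp: B_def Linf_def)
  have BU: "f \<in> calU" if "f \<in> B" for f using that by (auto simp: B_def)
  have Bcont: "continuous_on disc (?v f)" and Bbdd: "bounded (?v f ` disc)" and Bae: "AE w in dA. f w = ?v f w" if "f \<in> B" for f
    using calU_cont_rep[OF BU[OF that]] by auto
  have combine: "h \<in> B" if h: "h \<in> calU" "h \<in> borel_measurable dA" and f: "f \<in> B" and g: "g \<in> B"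
    and le: "\<And>w z. w \<in> disc \<Longrightarrow> z \<in> disc \<Longrightarrow>
      (cmod (?v h w - ?v h z))\<^sup>2 \<le> a * (cmod (?v f w - ?v f z))\<^sup>2 + b * (cmod (?v g w - ?v g z))\<^sup>2" for h f g a b
  proof -
    have "AE \<zeta> in arc_length. has_nontangential_limit (osc (?v f)) 0 \<zeta>"
      "AE \<zeta> in arc_length. has_nontangential_limit (osc (?v g)) 0 \<zeta>" using f g by (auto simp: B_def)
    then have "AE \<zeta> in arc_length. has_nontangential_limit (osc (?v h)) 0 \<zeta>"
    proof eventually_elim
      case (elim \<zeta>)
      then show ?case
        by (rule osc_nontangential_combine[where A = a and B = b])
           (intro calU_cont_rep[OF h(1)] Bcont Bbdd f g le | assumption)+
    qed
    then show ?thesis using h by (simp add: B_def calU_measurable_Linf)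
  qed
  have "cstar_subalgebra B"
    unfolding cstar_subalgebra_def
  proof (intro conjI ballI allI impI)
    show "B \<subseteq> Linf" by (auto simp: B_def)
    have "?v (\<lambda>w. 0) z = 0" if "z \<in> disc" for z
      by (rule cont_rep_eq[OF calU_closed(1) _ _ that]) auto
    then have le0: "osc (?v (\<lambda>w. 0)) z \<le> 0" if "z \<in> disc" for z
      using osc_le[OF calU_cont_rep(1,2)[OF calU_closed(1)] calU_cont_rep(1,2)[OF calU_closed(1)] calU_cont_rep(1,2)[OF calU_closed(1)] that, of 0 0 0]
        that by simp
    have "has_nontangential_limit (osc (?v (\<lambda>w. 0))) 0 \<zeta>" for \<zeta>
      by (rule nontangential_limit_squeeze[of "\<lambda>_. 0"]) (auto simp: has_nontangential_limit_def osc_nonneg le0)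
    then show "(\<lambda>w. 0) \<in> B" by (auto simp: B_def intro!: calU_closed(1) calU_measurable_Linf)
  next
    fix f g assume f: "f \<in> B" and g: "g \<in> B"
    note [measurable] = Bm[OF f] Bm[OF g]
    note c = Bcont[OF f] Bcont[OF g]
    note ae = Bae[OF f] Bae[OF g]
    have U: "(\<lambda>w. f w + g w) \<in> calU" "(\<lambda>w. f w * g w) \<in> calU" by (intro calU_closed BU f g)+
    have a: "?v (\<lambda>w. f w + g w) z = ?v f z + ?v g z" if "z \<in> disc" for z
      by (rule cont_rep_eq[OF U(1) _ _ that]) (use c ae in \<open>auto intro!: continuous_intros elim: eventually_elim2\<close>)
    have m: "?v (\<lambda>w. f w * g w) z = ?v f z * ?v g z" if "z \<in> disc" for z
      by (rule cont_rep_eq[OF U(2) _ _ that]) (use c ae in \<open>auto intro!: continuous_intros elim: eventually_elim2\<close>)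
    show "(\<lambda>w. f w + g w) \<in> B"
    proof (rule combine[OF U(1) _ f g, of 2 2])
      fix w z :: complex assume wz: "w \<in> disc" "z \<in> disc"
      show "(cmod (?v (\<lambda>w. f w + g w) w - ?v (\<lambda>w. f w + g w) z))\<^sup>2 \<le> 2 * (cmod (?v f w - ?v f z))\<^sup>2 + 2 * (cmod (?v g w - ?v g z))\<^sup>2"
        using cmod_square_sum_le[of "?v f w - ?v f z" "?v g w - ?v g z"] unfolding a[OF wz(1)] a[OF wz(2)] by (simp add: algebra_simps)
    qed measurable
    obtain C where C: "\<And>w. w \<in> disc \<Longrightarrow> cmod (?v f w) \<le> C" using bounded_discE[OF Bbdd[OF f]] by blast
    obtain C' where C': "\<And>w. w \<in> disc \<Longrightarrow> cmod (?v g w) \<le> C'" using bounded_discE[OF Bbdd[OF g]] by blast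
    show "(\<lambda>w. f w * g w) \<in> B"
    \<comment> \<open>In f(w) g(w) - f(z) g(z) = g(z) (f(w) - f(z)) + f(w) (g(w) - g(z)), the bound
      of each factor multiplies the oscillation of the other; the 2 comes from squaring the
      sum.\<close>
    proof (rule combine[OF U(2) _ f g, of "2 * C'\<^sup>2" "2 * C\<^sup>2"])
      fix w z :: complex assume wz: "w \<in> disc" "z \<in> disc"
      have "(cmod (?v f w * ?v g w - ?v f z * ?v g z))\<^sup>2 =
          (cmod (?v g z * (?v f w - ?v f z) + ?v f w * (?v g w - ?v g z)))\<^sup>2"
        by (simp add: algebra_simps)
      also have "\<dots> \<le> 2 * (cmod (?v g z * (?v f w - ?v f z)))\<^sup>2 + 2 * (cmod (?v f w * (?v g w - ?v g z)))\<^sup>2"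
        by (rule cmod_square_sum_le)
      also have "\<dots> \<le> 2 * (C'\<^sup>2 * (cmod (?v f w - ?v f z))\<^sup>2) + 2 * (C\<^sup>2 * (cmod (?v g w - ?v g z))\<^sup>2)"
        unfolding norm_mult power_mult_distrib using C C' wz
        by (intro add_mono mult_left_mono mult_right_mono power_mono) auto
      finally show "(cmod (?v (\<lambda>w. f w * g w) w - ?v (\<lambda>w. f w * g w) z))\<^sup>2 \<le>
        2 * C'\<^sup>2 * (cmod (?v f w - ?v f z))\<^sup>2 + 2 * C\<^sup>2 * (cmod (?v g w - ?v g z))\<^sup>2"
        unfolding m[OF wz(1)] m[OF wz(2)] by (simp only: mult.assoc)
    qed measurable
  next
    fix c f assume f: "f \<in> B"
    note [measurable] = Bm[OF f]
    have U: "(\<lambda>w. c * f w) \<in> calU" by (intro calU_closed BU f)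
    have e: "?v (\<lambda>w. c * f w) z = c * ?v f z" if "z \<in> disc" for z
      by (rule cont_rep_eq[OF U _ _ that]) (use Bcont[OF f] Bae[OF f] in \<open>auto intro!: continuous_intros\<close>)
    show "(\<lambda>w. c * f w) \<in> B"
    proof (rule combine[OF U _ f f, of "(cmod c)\<^sup>2" 0])
      fix w z :: complex assume wz: "w \<in> disc" "z \<in> disc"
      have "cmod (c * ?v f w - c * ?v f z) = cmod c * cmod (?v f w - ?v f z)"
        by (simp add: right_diff_distrib[symmetric] norm_mult)
      then show "(cmod (?v (\<lambda>w. c * f w) w - ?v (\<lambda>w. c * f w) z))\<^sup>2 \<le> (cmod c)\<^sup>2 * (cmod (?v f w - ?v f z))\<^sup>2 + 0 * (cmod (?v f w - ?v f z))\<^sup>2"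
        unfolding e[OF wz(1)] e[OF wz(2)] by (simp add: power_mult_distrib)
    qed measurable
  next
    fix f assume f: "f \<in> B"
    have U: "(\<lambda>w. cnj (f w)) \<in> calU" by (intro calU_closed BU f)
    have e: "?v (\<lambda>w. cnj (f w)) z = cnj (?v f z)" if "z \<in> disc" for z
      by (rule cont_rep_eq[OF U _ _ that]) (use Bcont[OF f] Bae[OF f] in \<open>auto intro!: continuous_on_cnj\<close>)
    show "(\<lambda>w. cnj (f w)) \<in> B"
    proof (rule combine[OF U _ f f, of 1 0])
      show "(\<lambda>w. cnj (f w)) \<in> borel_measurable dA"
        by (rule borel_measurable_continuous_on[OF _ Bm[OF f]]) (intro continuous_on_cnj continuous_on_id)
      fix w z :: complex assume wz: "w \<in> disc" "z \<in> disc"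
      have "cmod (cnj (?v f w) - cnj (?v f z)) = cmod (?v f w - ?v f z)"
        by (metis complex_cnj_diff complex_mod_cnj)
      then show "(cmod (?v (\<lambda>w. cnj (f w)) w - ?v (\<lambda>w. cnj (f w)) z))\<^sup>2 \<le> 1 * (cmod (?v f w - ?v f z))\<^sup>2 + 0 * (cmod (?v f w - ?v f z))\<^sup>2"
        unfolding e[OF wz(1)] e[OF wz(2)] by simp
    qed
  next
    fix f assume f: "f \<in> Linf" and ap: "\<forall>\<epsilon>>0. \<exists>g\<in>B. Linf_norm (\<lambda>w. f w - g w) < ereal \<epsilon>"
    \<comment> \<open>\<open>cont_rep f\<close> has its defining properties only for members of
      \<open>calU\<close>, so the limit must be placed there first.\<close>
    have fU: "f \<in> calU"
      by (rule calU_closed(6)[OF f]) (use ap BU in blast)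
    note v = calU_cont_rep[OF fU]
    have "\<exists>g\<in>B. Linf_norm (\<lambda>w. f w - g w) < ereal (inverse (real (Suc n)))" for n
      using ap by simp
    then obtain g where g: "\<And>n. g n \<in> B" and gl: "\<And>n. Linf_norm (\<lambda>w. f w - g n w) < ereal (inverse (real (Suc n)))"
      by metis
    \<comment> \<open>Closeness almost everywhere becomes closeness everywhere by continuity; the
      particular points \<open>w\<close> and \<open>z\<close> are needed below.\<close>
    have near: "cmod (?v f w - ?v (g n) w) \<le> inverse (real (Suc n))" if w: "w \<in> disc" for n w
    proof (rule continuous_AE_le[OF _ _ w])
      show "continuous_on disc (\<lambda>w. ?v f w - ?v (g n) w)" by (intro continuous_intros v Bcont g)
      show "AE w in dA. cmod (?v f w - ?v (g n) w) \<le> inverse (real (Suc n))"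
        using Linf_norm_less_AE[OF gl[of n]] v(3) Bae[OF g[of n]] by eventually_elim simp
    qed
    \<comment> \<open>Replacing \<open>f\<close> by \<open>g n\<close> at both \<open>w\<close> and
      \<open>z\<close> costs at most 2 d with d = 1 / (n + 1), and 2 (2 d)^2 = 8 d^2.\<close>
    have osc_n: "osc (?v f) z \<le> 2 * osc (?v (g n)) z + 8 * (inverse (real (Suc n)))\<^sup>2" if z: "z \<in> disc" for n z
    proof -
      have "osc (?v f) z \<le> 2 * osc (?v (g n)) z + 0 * osc (?v (g n)) z + 8 * (inverse (real (Suc n)))\<^sup>2"
      proof (rule osc_le[OF v(1,2) Bcont[OF g] Bbdd[OF g] Bcont[OF g] Bbdd[OF g] z])
        fix w assume w: "w \<in> disc"
        let ?d = "inverse (real (Suc n))"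
        have "(cmod (?v f w - ?v f z))\<^sup>2 = (cmod ((?v (g n) w - ?v (g n) z) + ((?v f w - ?v (g n) w) - (?v f z - ?v (g n) z))))\<^sup>2"
          by simp
        also have "\<dots> \<le> 2 * (cmod (?v (g n) w - ?v (g n) z))\<^sup>2 + 2 * (cmod ((?v f w - ?v (g n) w) - (?v f z - ?v (g n) z)))\<^sup>2"
          by (rule cmod_square_sum_le)
        also have "\<dots> \<le> 2 * (cmod (?v (g n) w - ?v (g n) z))\<^sup>2 + 2 * (?d + ?d)\<^sup>2"
        proof (intro add_left_mono mult_left_mono power_mono)
          show "cmod ((?v f w - ?v (g n) w) - (?v f z - ?v (g n) z)) \<le> ?d + ?d"
            by (rule order_trans[OF norm_triangle_ineq4 add_mono[OF near[OF w] near[OF z]]])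
        qed auto
        also have "2 * (?d + ?d)\<^sup>2 = 8 * ?d\<^sup>2" by (simp add: power2_eq_square algebra_simps)
        finally show "(cmod (?v f w - ?v f z))\<^sup>2 \<le> 2 * (cmod (?v (g n) w - ?v (g n) z))\<^sup>2 + 0 * (cmod (?v (g n) w - ?v (g n) z))\<^sup>2 + 8 * ?d\<^sup>2"
          by simp
      qed
      then show ?thesis by simp
    qed
    have "AE \<zeta> in arc_length. has_nontangential_limit (osc (?v (g n))) 0 \<zeta>" for n using g[of n] by (simp add: B_def)
    \<comment> \<open>One null set for the whole sequence, so that \<open>n\<close> may be chosen
      after \<zeta>, depending on \<open>e\<close>.\<close>
    then have "AE \<zeta> in arc_length. \<forall>n. has_nontangential_limit (osc (?v (g n))) 0 \<zeta>"
      by (subst AE_all_countable) blast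
    then have "AE \<zeta> in arc_length. has_nontangential_limit (osc (?v f)) 0 \<zeta>"
    proof eventually_elim
      case (elim \<zeta>)
      show ?case
        unfolding has_nontangential_limit_def
      proof (intro allI impI tendstoI)
        fix \<alpha> e :: real assume a: "\<alpha> > 1" and e: "e > 0"
        have "(\<lambda>n. 8 * (inverse (real (Suc n)))\<^sup>2) \<longlonglongrightarrow> 8 * 0\<^sup>2"
          by (intro tendsto_intros LIMSEQ_inverse_real_of_nat)
        from order_tendstoD(2)[OF this, of "e / 2"]
        have "\<forall>\<^sub>F n in sequentially. 8 * (inverse (real (Suc n)))\<^sup>2 < e / 2"
          using e by simp
        then obtain n where n: "8 * (inverse (real (Suc n)))\<^sup>2 < e / 2"
          using eventually_happens'[OF sequentially_bot] by blast
        have "(osc (?v (g n)) \<longlongrightarrow> 0) (at \<zeta> within nontangential_region \<alpha> \<zeta>)"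
          using elim a by (simp add: has_nontangential_limit_def)
        then have "\<forall>\<^sub>F z in at \<zeta> within nontangential_region \<alpha> \<zeta>. osc (?v (g n)) z < e / 4"
          using e by (intro order_tendstoD(2)) auto
        then show "\<forall>\<^sub>F z in at \<zeta> within nontangential_region \<alpha> \<zeta>. dist (osc (?v f) z) 0 < e"
          using eventually_nontangential
        proof eventually_elim
          case (elim z)
          then have "osc (?v f) z < e" using osc_n[of z n] n by simp
          then show ?case by (simp add: dist_norm osc_nonneg)
        qed
      qed
    qed
    then show "f \<in> B" using f fU by (simp add: B_def)
  qed
  moreover have "Hinf \<subseteq> B"
  proof
    fix f assume f: "f \<in> Hinf"
    have fU: "f \<in> calU" using f hull_subset[of Hinf cstar_subalgebra] by (auto simp: calU_def)
    have c: "continuous_on disc f" and b: "bounded (f ` disc)"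
      using f by (auto simp: Hinf_def holomorphic_on_imp_continuous_on)
    have e: "?v f z = f z" if "z \<in> disc" for z by (rule cont_rep_eq[OF fU c _ that]) simp
    \<comment> \<open>\<open>cont_rep f\<close> and \<open>f\<close> agree on the disc only, so
      \<open>osc\<close> is carried over by comparison, with constants 1 and 0.\<close>
    have "AE \<zeta> in arc_length. has_nontangential_limit (osc (?v f)) 0 \<zeta>"
      using Hinf_osc[OF f]
    proof eventually_elim
      case (elim \<zeta>)
      show ?case
        by (rule osc_nontangential_combine[where A = 1 and B = 0, OF elim elim calU_cont_rep(1,2)[OF fU] c b c b])
           (simp add: e)
    qed
    then show "f \<in> B" using fU c by (simp add: B_def calU_measurable_Linf continuous_measurable_dA)
  qed
  ultimately have "u \<in> B" using calU_cstar_subalgebra_le assms by blast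
  then show "u \<in> borel_measurable dA" "AE \<zeta> in arc_length. has_nontangential_limit (osc (?v u)) 0 \<zeta>"
    by (auto simp: B_def Linf_def)
qed

section \<open>The two operators applied to the kernel\<close>

lemma bergman_kernel_in_bergman_space:
  assumes z: "z \<in> disc"
  shows "bergman_kernel z \<in> bergman_space"
  using bergman_kernel_holomorphic[OF z] kernel_total(1)[OF z]
  by (auto simp: bergman_space_def L2_def intro!: continuous_measurable_dA holomorphic_on_imp_continuous_on)

text \<open>The bridge from the class \<open>u\<close> to its continuous representative: they agree
  almost everywhere, which the integral cannot distinguish, while the constant subtracted is the
  point value of the representative.\<close>

lemma calU_kernel_L2:
  assumes u: "u \<in> calU" and z: "z \<in> disc"
  shows "(\<lambda>w. (u w - cont_rep u z) * bergman_kernel z w) \<in> L2"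
    and "L2_norm (\<lambda>w. (u w - cont_rep u z) * bergman_kernel z w) = sqrt (osc (cont_rep u) z)"
proof -
  let ?v = "cont_rep u"
  note [measurable] = calU_osc(1)[OF u]
  have [measurable]: "bergman_kernel z \<in> borel_measurable dA"
    using bergman_kernel_in_bergman_space[OF z] by (simp add: bergman_space_def L2_def)
  obtain C where C: "\<And>w. w \<in> disc \<Longrightarrow> cmod (?v w) \<le> C" using bounded_discE[OF calU_cont_rep(2)[OF u]] by blast
  have [measurable]: "?v \<in> borel_measurable dA" by (rule continuous_measurable_dA[OF calU_cont_rep(1)[OF u]])
  have ae: "AE w in dA. (cmod ((u w - ?v z) * bergman_kernel z w))\<^sup>2 = (cmod (?v w - ?v z))\<^sup>2 * (cmod (bergman_kernel z w))\<^sup>2"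
    using calU_cont_rep(3)[OF u] by eventually_elim (simp add: norm_mult power_mult_distrib)
  have i: "integrable dA (\<lambda>w. (cmod (?v w - ?v z))\<^sup>2 * (cmod (bergman_kernel z w))\<^sup>2)"
    by (rule osc_integrable[OF calU_cont_rep(1)[OF u] C z])
  have "integrable dA (\<lambda>w. (cmod ((u w - ?v z) * bergman_kernel z w))\<^sup>2)"
    by (subst integrable_cong_AE[OF _ _ ae]) (use i in measurable)
  then show "(\<lambda>w. (u w - ?v z) * bergman_kernel z w) \<in> L2" by (simp add: L2_def)
  have "(LINT w|dA. (cmod ((u w - ?v z) * bergman_kernel z w))\<^sup>2) = osc ?v z"
    unfolding osc_def by (rule integral_cong_AE[OF _ _ ae]) measurable
  then show "L2_norm (\<lambda>w. (u w - ?v z) * bergman_kernel z w) = sqrt (osc ?v z)" by (simp add: L2_norm_def)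
qed

theorem corollary3p7:
  fixes u :: "complex \<Rightarrow> complex"
  assumes "u \<in> calU"
  shows "(AE \<zeta> in arc_length.
      has_nontangential_limit
        (\<lambda>z. L2_norm (toeplitz (\<lambda>w. u w - cont_rep u z) (bergman_kernel z))) 0 \<zeta>) \<and>
    (AE \<zeta> in arc_length.
      has_nontangential_limit (\<lambda>z. L2_norm (hankel u (bergman_kernel z))) 0 \<zeta>)"
proof -
  let ?v = "cont_rep u"
  have nonneg: "0 \<le> L2_norm f" for f by (simp add: L2_norm_def)
  have T: "L2_norm (toeplitz (\<lambda>w. u w - ?v z) (bergman_kernel z)) \<le> sqrt (osc ?v z)" if z: "z \<in> disc" for z
    using L2_norm_bergman_proj_le[OF calU_kernel_L2(1)[OF assms z]]
    by (simp add: toeplitz_def calU_kernel_L2(2)[OF assms z])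
  have H: "L2_norm (hankel u (bergman_kernel z)) \<le> sqrt (osc ?v z)" if z: "z \<in> disc" for z
  proof -
    \<comment> \<open>u(z) k_z belongs to the Bergman space, so the residual of u k_z is at most the
      norm of u k_z - u(z) k_z.\<close>
    let ?k = "\<lambda>w. ?v z * bergman_kernel z w"
    have k: "?k \<in> bergman_space" by (intro bergman_cmult bergman_kernel_in_bergman_space z)
    \<comment> \<open>Adding u(z) k_z back shows that u k_z is square integrable, as the projection
      estimate requires.\<close>
    then have "(\<lambda>w. (u w - ?v z) * bergman_kernel z w + ?k w) \<in> L2"
      by (intro L2_add calU_kernel_L2(1)[OF assms z]) (simp add: bergman_space_def)
    then have "(\<lambda>w. u w * bergman_kernel z w) \<in> L2" by (simp add: algebra_simps)
    from L2_norm_diff_bergman_proj_le[OF this k]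
    show ?thesis by (simp add: hankel_def calU_kernel_L2(2)[OF assms z, symmetric] algebra_simps)
  qed
  have "AE \<zeta> in arc_length. has_nontangential_limit (\<lambda>z. sqrt (osc ?v z)) 0 \<zeta>"
    using calU_osc(2)[OF assms]
  proof eventually_elim
    case (elim \<zeta>)
    then show ?case
      unfolding has_nontangential_limit_def using tendsto_real_sqrt[where x = 0] by fastforce
  qed
  then show ?thesis
  proof (intro conjI)
    assume ae: "AE \<zeta> in arc_length. has_nontangential_limit (\<lambda>z. sqrt (osc ?v z)) 0 \<zeta>"
    show "AE \<zeta> in arc_length. has_nontangential_limit
        (\<lambda>z. L2_norm (toeplitz (\<lambda>w. u w - ?v z) (bergman_kernel z))) 0 \<zeta>"
      using ae by eventually_elim (erule nontangential_limit_squeeze, auto intro: nonneg T)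
    show "AE \<zeta> in arc_length. has_nontangential_limit (\<lambda>z. L2_norm (hankel u (bergman_kernel z))) 0 \<zeta>"
      using ae by eventually_elim (erule nontangential_limit_squeeze, auto intro: nonneg H)
  qed
qed

end
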